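(* Let $\varphi, \psi$ be invertible functions in $L^\infty(\mathbb{T})$. The following are equivalent. (i) $\ker(T_{\varphi \psi^{-1}})=\ker(T_{\varphi^{-1} \psi})=\{ 0 \}$. (ii) There is a geodesic in $Gr$ joining $P_\varphi$ and $P_\psi$. (iii) There is a unique geodesic of minimal length in $Gr$ joining $P_\varphi$ and $P_\psi$, given by $$\delta(t)=e^{itX}P_\varphi e^{-itX}, \quad t \in[0,1],$$ where $X=X_{\varphi, \psi}$ is a uniquely determined bounded selfadjoint operator on $L^2$ such that $\|X\|\leq \pi / 2$, $e^{iX}P_\varphi e^{-iX}=P_\psi$, and $X$ is co-diagonal with respect to both $P_\varphi$ and $P_\psi$.
   Context: $L^p=L^p(\mathbb{T})$ are the Lebesgue spaces of complex functions on the unit circle $\mathbb{T}$; $H^2\subset L^2$ is the Hardy space (functions in $L^2$ with vanishing negative Fourier coefficients), and $P_+$ is the orthogonal projection of $L^2$ onto $H^2$. For $\varphi\in L^\infty$, the Toeplitz operator is $T_\varphi:H^2\to H^2$, $T_\varphi f=P_+(\varphi f)$. If $\varphi$ is invertible in $L^\infty$, then $\varphi H^2$ is a closed subspace of $L^2$, and $P_\varphi$ denotes the orthogonal projection of $L^2$ onto $\varphi H^2$. $Gr$ is the Grassmann manifold of $L^2$, i.e. the set of all orthogonal projections in $\mathcal{B}(L^2)$ (identified with the closed subspaces of $L^2$). An operator $Y\in\mathcal{B}(L^2)$ is co-diagonal with respect to a projection $P$ if $PYP=(I-P)Y(I-P)=0$. The geodesics of $Gr$ starting at $P$ are the curves $\delta(t)=e^{itX}Pe^{-itX}$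 with $X\in\mathcal{B}(L^2)$ selfadjoint and co-diagonal with respect to $P$; such a geodesic joins $P$ and $Q$ if $\delta(1)=Q$ (geodesics are considered up to reparametrization). The length of a piecewise $C^1$ curve $\alpha:[0,1]\to Gr$ is $L(\alpha)=\int_0^1\|\dot\alpha(t)\|\,dt$, with $\|\cdot\|$ the operator norm; a geodesic has minimal length if its length is at most that of any piecewise $C^1$ curve in $Gr$ with the same endpoints. *)

theory Defs
  imports "HOL-Analysis.Analysis"
begin

section \<open>The Hilbert space of square-integrable functions on the unit circle\<close>

text \<open>Normalised arc length on the unit circle. Borel representatives suffice, since every
  Lebesgue measurable function agrees almost everywhere with a Borel one.\<close>

definition circle_measure :: "complex measure" where
  "circle_measure =
     distr (uniform_measure lborel {0..<2 * pi}) (restrict_space borel (sphere 0 1)) cis"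

lemma measurable_cnj [measurable]: "cnj \<in> borel_measurable borel"
  by (intro borel_measurable_continuous_onI continuous_intros)

definition square_integrable :: "(complex \<Rightarrow> complex) \<Rightarrow> bool" where
  "square_integrable f \<longleftrightarrow>
     f \<in> borel_measurable circle_measure \<and> integrable circle_measure (\<lambda>z. (cmod (f z))\<^sup>2)"

lemma square_integrable_measurable [measurable_dest]:
  "square_integrable f \<Longrightarrow> f \<in> borel_measurable circle_measure"
  by (simp add: square_integrable_def)

lemma square_integrable_zero: "square_integrable (\<lambda>_. 0)"
  by (simp add: square_integrable_def)

lemma square_integrable_bounded_mult:
  assumes "square_integrable f" and [measurable]: "\<phi> \<in> borel_measurable circle_measure"
    and bd: "AE z in circle_measure. cmod (\<phi> z) \<le> C"
  shows "square_integrable (\<lambda>z. \<phi> z * f z)"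
proof -
  note [measurable] = square_integrable_measurable[OF assms(1)]
  have "integrable circle_measure (\<lambda>z. C\<^sup>2 * (cmod (f z))\<^sup>2)"
    using assms(1) by (simp add: square_integrable_def)
  then have "integrable circle_measure (\<lambda>z. (cmod (\<phi> z * f z))\<^sup>2)"
  proof (rule Bochner_Integration.integrable_bound)
    show "AE z in circle_measure. norm ((cmod (\<phi> z * f z))\<^sup>2) \<le> norm (C\<^sup>2 * (cmod (f z))\<^sup>2)"
      using bd
    proof eventually_elim
      case (elim z)
      have "(cmod (\<phi> z))\<^sup>2 \<le> C\<^sup>2"
        using elim by (simp add: power_mono)
      then have "(cmod (\<phi> z))\<^sup>2 * (cmod (f z))\<^sup>2 \<le> C\<^sup>2 * (cmod (f z))\<^sup>2"
        by (rule mult_right_mono) simp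
      then show ?case
        by (simp add: norm_mult power_mult_distrib)
    qed
  qed measurable
  then show ?thesis
    by (simp add: square_integrable_def)
qed

lemma square_integrable_cmult: "square_integrable f \<Longrightarrow> square_integrable (\<lambda>z. c * f z)"
  using square_integrable_bounded_mult[of f "\<lambda>_. c" "cmod c"] by simp

lemma square_integrable_add:
  assumes "square_integrable f" "square_integrable g"
  shows "square_integrable (\<lambda>z. f z + g z)"
proof -
  note [measurable] = square_integrable_measurable[OF assms(1)] square_integrable_measurable[OF assms(2)]
  have "integrable circle_measure (\<lambda>z. 2 * (cmod (f z))\<^sup>2 + 2 * (cmod (g z))\<^sup>2)"
    using assms by (simp add: square_integrable_def)
  then have "integrable circle_measure (\<lambda>z. (cmod (f z + g z))\<^sup>2)"
  proof (rule Bochner_Integration.integrable_bound)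
    have "(cmod (a + b))\<^sup>2 \<le> 2 * (cmod a)\<^sup>2 + 2 * (cmod b)\<^sup>2" for a b :: complex
    proof -
      have "(cmod (a + b))\<^sup>2 \<le> (cmod a + cmod b)\<^sup>2"
        by (simp add: norm_triangle_ineq power_mono)
      also have "\<dots> \<le> 2 * (cmod a)\<^sup>2 + 2 * (cmod b)\<^sup>2"
        using sum_squares_bound[of "cmod a" "cmod b"] by (simp add: power2_sum)
      finally show ?thesis .
    qed
    then show "AE z in circle_measure. norm ((cmod (f z + g z))\<^sup>2)
        \<le> norm (2 * (cmod (f z))\<^sup>2 + 2 * (cmod (g z))\<^sup>2)"
      by simp
  qed measurable
  then show ?thesis
    by (simp add: square_integrable_def)
qed

lemma square_integrable_product:
  assumes "square_integrable f" "square_integrable g"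
  shows "integrable circle_measure (\<lambda>z. f z * cnj (g z))"
proof -
  note [measurable] = square_integrable_measurable[OF assms(1)] square_integrable_measurable[OF assms(2)]
  have "integrable circle_measure (\<lambda>z. (cmod (f z))\<^sup>2 + (cmod (g z))\<^sup>2)"
    using assms by (simp add: square_integrable_def)
  then show ?thesis
  proof (rule Bochner_Integration.integrable_bound)
    have "cmod (a * cnj b) \<le> (cmod a)\<^sup>2 + (cmod b)\<^sup>2" for a b :: complex
    proof -
      have "0 \<le> cmod a * cmod b" by simp
      moreover have "2 * (cmod a * cmod b) \<le> (cmod a)\<^sup>2 + (cmod b)\<^sup>2"
        using sum_squares_bound[of "cmod a" "cmod b"] by (simp add: mult.assoc)
      ultimately show ?thesis
        unfolding norm_mult complex_mod_cnj by linarith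
    qed
    then show "AE z in circle_measure. norm (f z * cnj (g z))
        \<le> norm ((cmod (f z))\<^sup>2 + (cmod (g z))\<^sup>2)"
      by simp
  qed measurable
qed

quotient_type L2 = "complex \<Rightarrow> complex" / partial:
  "\<lambda>f g. square_integrable f \<and> square_integrable g \<and> (AE z in circle_measure. f z = g z)"
proof (rule part_equivpI)
  show "\<exists>f. square_integrable f \<and> square_integrable f \<and> (AE z in circle_measure. f z = f z)"
    using square_integrable_zero by auto
  show "symp (\<lambda>f g. square_integrable f \<and> square_integrable g \<and> (AE z in circle_measure. f z = g z))"
    by (rule sympI) (auto elim: eventually_mono)
  show "transp (\<lambda>f g. square_integrable f \<and> square_integrable g \<and> (AE z in circle_measure. f z = g z))"
    by (rule transpI) (auto elim: eventually_elim2)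
qed

lift_definition scaleC :: "complex \<Rightarrow> L2 \<Rightarrow> L2" (infixr \<open>*\<^sub>C\<close> 75) is "\<lambda>c f z. c * f z"
  by (auto intro: square_integrable_cmult elim: eventually_mono)

lift_definition cinner :: "L2 \<Rightarrow> L2 \<Rightarrow> complex"
  is "\<lambda>f g. \<integral>z. f z * cnj (g z) \<partial>circle_measure"
proof -
  fix f f' g g' :: "complex \<Rightarrow> complex"
  assume a: "square_integrable f \<and> square_integrable f' \<and> (AE z in circle_measure. f z = f' z)"
    "square_integrable g \<and> square_integrable g' \<and> (AE z in circle_measure. g z = g' z)"
  then have [measurable]: "f \<in> borel_measurable circle_measure" "f' \<in> borel_measurable circle_measure"
    "g \<in> borel_measurable circle_measure" "g' \<in> borel_measurable circle_measure"
    by (auto simp: square_integrable_def)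
  from a have "AE z in circle_measure. f z = f' z" "AE z in circle_measure. g z = g' z"
    by auto
  then have "AE z in circle_measure. f z * cnj (g z) = f' z * cnj (g' z)"
    by eventually_elim simp
  then show "(\<integral>z. f z * cnj (g z) \<partial>circle_measure) = (\<integral>z. f' z * cnj (g' z) \<partial>circle_measure)"
    by (intro integral_cong_AE) measurable
qed

instantiation L2 :: real_inner
begin

lift_definition zero_L2 :: L2 is "\<lambda>_. 0"
  by (simp add: square_integrable_zero)

lift_definition plus_L2 :: "L2 \<Rightarrow> L2 \<Rightarrow> L2" is "\<lambda>f g z. f z + g z"
  by (auto intro: square_integrable_add)

definition uminus_L2 :: "L2 \<Rightarrow> L2" where "uminus_L2 f = (-1) *\<^sub>C f"

definition minus_L2 :: "L2 \<Rightarrow> L2 \<Rightarrow> L2" where "minus_L2 f g = f + - g"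

definition scaleR_L2 :: "real \<Rightarrow> L2 \<Rightarrow> L2" where "scaleR_L2 r f = complex_of_real r *\<^sub>C f"

definition inner_L2 :: "L2 \<Rightarrow> L2 \<Rightarrow> real" where "inner_L2 f g = Re (cinner f g)"

definition norm_L2 :: "L2 \<Rightarrow> real" where "norm_L2 f = sqrt (inner f f)"

definition sgn_L2 :: "L2 \<Rightarrow> L2" where "sgn_L2 f = inverse (norm f) *\<^sub>R f"

definition dist_L2 :: "L2 \<Rightarrow> L2 \<Rightarrow> real" where "dist_L2 f g = norm (f - g)"

definition uniformity_L2 :: "(L2 \<times> L2) filter" where
  "uniformity_L2 = (INF e\<in>{0<..}. principal {(f, g). dist f g < e})"

definition open_L2 :: "L2 set \<Rightarrow> bool" where
  "open_L2 U \<longleftrightarrow> (\<forall>f\<in>U. eventually (\<lambda>(f', g). f' = f \<longrightarrow> g \<in> U) uniformity)"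

instance
proof
  fix f g h :: L2 and r s :: real and U :: "L2 set"
  show add_assoc: "f + g + h = f + (g + h)"
    by transfer (auto intro!: square_integrable_add simp: add.assoc)
  show "f + g = g + f"
    by transfer (auto intro!: square_integrable_add simp: add.commute)
  show "0 + f = f"
    by transfer auto
  show "- f + f = 0"
    unfolding uminus_L2_def
    by transfer (auto intro!: square_integrable_add square_integrable_zero dest: square_integrable_cmult[where c="-1"])
  show "f - g = f + - g"
    by (rule minus_L2_def)
  show "r *\<^sub>R (f + g) = r *\<^sub>R f + r *\<^sub>R g"
    unfolding scaleR_L2_def
    by transfer (auto intro!: square_integrable_add square_integrable_cmult simp: distrib_left)
  show "(r + s) *\<^sub>R f = r *\<^sub>R f + s *\<^sub>R f"
    unfolding scaleR_L2_def
    by transfer (auto intro!: square_integrable_add square_integrable_cmult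
        simp del: of_real_add simp: of_real_add ring_distribs)
  show "r *\<^sub>R s *\<^sub>R f = (r * s) *\<^sub>R f"
    unfolding scaleR_L2_def
    by transfer (auto intro!: square_integrable_cmult simp: mult.assoc)
  show "1 *\<^sub>R f = f"
    unfolding scaleR_L2_def by transfer auto
  show "sgn f = inverse (norm f) *\<^sub>R f"
    by (rule sgn_L2_def)
  show "dist f g = norm (f - g)"
    by (rule dist_L2_def)
  show "uniformity = (INF e\<in>{0<..}. principal {(f :: L2, g). dist f g < e})"
    by (rule uniformity_L2_def)
  show "open U \<longleftrightarrow> (\<forall>f\<in>U. eventually (\<lambda>(f', g). f' = f \<longrightarrow> g \<in> U) uniformity)"
    by (rule open_L2_def)
  show "norm f = sqrt (inner f f)"
    by (rule norm_L2_def)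
  show "inner f g = inner g f"
    unfolding inner_L2_def
  proof transfer
    fix f g :: "complex \<Rightarrow> complex"
    have "(\<integral>z. g z * cnj (f z) \<partial>circle_measure) = (\<integral>z. cnj (f z * cnj (g z)) \<partial>circle_measure)"
      by (simp add: mult.commute)
    also have "\<dots> = cnj (\<integral>z. f z * cnj (g z) \<partial>circle_measure)"
      by (rule Bochner_Integration.integral_cnj)
    finally show "Re (\<integral>z. f z * cnj (g z) \<partial>circle_measure) = Re (\<integral>z. g z * cnj (f z) \<partial>circle_measure)"
      by simp
  qed
  show "inner (f + g) h = inner f h + inner g h"
    unfolding inner_L2_def
    by transfer (simp add: ring_distribs square_integrable_product)
  show "inner (r *\<^sub>R f) g = r * inner f g"
    unfolding inner_L2_def scaleR_L2_def
    by transfer (simp add: mult.assoc)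
  have *: "(\<integral>z. f z * cnj (f z) \<partial>circle_measure)
      = complex_of_real (\<integral>z. (cmod (f z))\<^sup>2 \<partial>circle_measure)" for f :: "complex \<Rightarrow> complex"
    by (simp add: complex_norm_square[symmetric] flip: integral_complex_of_real)
  show "0 \<le> inner f f"
    unfolding inner_L2_def by transfer (simp add: *)
  show "inner f f = 0 \<longleftrightarrow> f = 0"
    unfolding inner_L2_def
  proof transfer
    fix f :: "complex \<Rightarrow> complex"
    assume "square_integrable f \<and> square_integrable f \<and> (AE z in circle_measure. f z = f z)"
    then have f: "square_integrable f" by simp
    then have "(\<integral>z. (cmod (f z))\<^sup>2 \<partial>circle_measure) = 0 \<longleftrightarrow> (AE z in circle_measure. (cmod (f z))\<^sup>2 = 0)"
      by (intro integral_nonneg_eq_0_iff_AE) (auto simp: square_integrable_def)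
    then show "Re (\<integral>z. f z * cnj (f z) \<partial>circle_measure) = 0 \<longleftrightarrow>
        square_integrable f \<and> square_integrable (\<lambda>_. 0) \<and> (AE z in circle_measure. f z = 0)"
      using f by (simp add: * square_integrable_zero)
  qed
qed

end

lemma cinner_scaleC_self: "cinner (c *\<^sub>C f) (c *\<^sub>C f) = (cmod c)\<^sup>2 * cinner f f"
proof transfer
  fix c :: complex and f :: "complex \<Rightarrow> complex"
  have "c * f z * cnj (c * f z) = complex_of_real ((cmod c)\<^sup>2) * (f z * cnj (f z))" for z
    unfolding complex_norm_square complex_cnj_mult by (simp only: mult_ac)
  then have "(\<lambda>z. c * f z * cnj (c * f z)) = (\<lambda>z. complex_of_real ((cmod c)\<^sup>2) * (f z * cnj (f z)))"
    by (rule ext)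
  then show "(\<integral>z. c * f z * cnj (c * f z) \<partial>circle_measure)
      = complex_of_real ((cmod c)\<^sup>2) * (\<integral>z. f z * cnj (f z) \<partial>circle_measure)"
    by (simp only: integral_mult_right_zero)
qed

lemma norm_scaleC: "norm (c *\<^sub>C f) = cmod c * norm f"
  by (simp add: norm_L2_def inner_L2_def cinner_scaleC_self real_sqrt_mult flip: of_real_power)

lemma bounded_linear_scaleC: "bounded_linear (scaleC c)"
proof (rule bounded_linear_intro)
  show "c *\<^sub>C (f + g) = c *\<^sub>C f + c *\<^sub>C g" for f g
    by transfer (auto intro!: square_integrable_add square_integrable_cmult simp: algebra_simps)
  show "c *\<^sub>C r *\<^sub>R f = r *\<^sub>R c *\<^sub>C f" for r f
    unfolding scaleR_L2_def
    by transfer (auto intro!: square_integrable_cmult simp: mult.left_commute)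
  show "norm (c *\<^sub>C f) \<le> norm f * cmod c" for f
    by (simp add: norm_scaleC mult.commute)
qed

lift_definition fourier_coeff :: "L2 \<Rightarrow> int \<Rightarrow> complex"
  is "\<lambda>f n. \<integral>z. f z * cnj (z powi n) \<partial>circle_measure"
proof -
  fix f f' :: "complex \<Rightarrow> complex"
  assume a: "square_integrable f \<and> square_integrable f' \<and> (AE z in circle_measure. f z = f' z)"
  then have [measurable]: "f \<in> borel_measurable circle_measure" "f' \<in> borel_measurable circle_measure"
    by (auto simp: square_integrable_def)
  have [measurable]: "(\<lambda>z. z) \<in> borel_measurable circle_measure"
    by (simp add: circle_measure_def measurable_restrict_space1)
  have [measurable]: "(\<lambda>z. z powi n) \<in> borel_measurable circle_measure" for n
    unfolding power_int_def by (cases "n \<ge> 0") simp_all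
  have "AE z in circle_measure. f z * cnj (z powi n) = f' z * cnj (z powi n)" for n
    using a by (auto elim: eventually_mono)
  then show "(\<lambda>n. \<integral>z. f z * cnj (z powi n) \<partial>circle_measure) = (\<lambda>n. \<integral>z. f' z * cnj (z powi n) \<partial>circle_measure)"
    by (intro ext integral_cong_AE) measurable
qed

definition H2 :: "L2 set" where
  "H2 = {f. \<forall>n<0. fourier_coeff f n = 0}"


section \<open>Operators\<close>

text \<open>The type of bounded linear functions is real-linear, hence the restriction to the
  operators commuting with complex scalars.\<close>

definition bounded_ops :: "(L2 \<Rightarrow>\<^sub>L L2) set" where
  "bounded_ops = {A. \<forall>c f. blinfun_apply A (c *\<^sub>C f) = c *\<^sub>C blinfun_apply A f}"

definition scaleC_op :: "complex \<Rightarrow> (L2 \<Rightarrow>\<^sub>L L2) \<Rightarrow> (L2 \<Rightarrow>\<^sub>L L2)" where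
  "scaleC_op c A = Blinfun (scaleC c) o\<^sub>L A"

lemma scaleC_op_apply: "blinfun_apply (scaleC_op c A) f = c *\<^sub>C blinfun_apply A f"
  by (simp add: scaleC_op_def bounded_linear_Blinfun_apply bounded_linear_scaleC)

definition selfadjoint :: "(L2 \<Rightarrow>\<^sub>L L2) \<Rightarrow> bool" where
  "selfadjoint A \<longleftrightarrow>
     (\<forall>f g. cinner (blinfun_apply A f) g = cinner f (blinfun_apply A g))"

definition exp_op :: "(L2 \<Rightarrow>\<^sub>L L2) \<Rightarrow> (L2 \<Rightarrow>\<^sub>L L2)" where
  "exp_op A = (\<Sum>n. (1 / fact n) *\<^sub>R ((\<lambda>B. A o\<^sub>L B) ^^ n) id_blinfun)"

definition Gr :: "(L2 \<Rightarrow>\<^sub>L L2) set" where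
  "Gr = {P \<in> bounded_ops. selfadjoint P \<and> P o\<^sub>L P = P}"

definition proj :: "L2 set \<Rightarrow> (L2 \<Rightarrow>\<^sub>L L2)" where
  "proj S = (THE P. P \<in> Gr \<and> range (blinfun_apply P) = S)"

definition codiagonal :: "(L2 \<Rightarrow>\<^sub>L L2) \<Rightarrow> (L2 \<Rightarrow>\<^sub>L L2) \<Rightarrow> bool" where
  "codiagonal P Y \<longleftrightarrow>
     P o\<^sub>L Y o\<^sub>L P = 0 \<and> (id_blinfun - P) o\<^sub>L Y o\<^sub>L (id_blinfun - P) = 0"


section \<open>Symbols and Toeplitz operators\<close>

definition Linf :: "(complex \<Rightarrow> complex) set" where
  "Linf = {\<phi> \<in> borel_measurable circle_measure. \<exists>C. AE z in circle_measure. cmod (\<phi> z) \<le> C}"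

definition Linf_invertible :: "(complex \<Rightarrow> complex) \<Rightarrow> bool" where
  "Linf_invertible \<phi> \<longleftrightarrow>
     \<phi> \<in> Linf \<and> (\<exists>\<eta>\<in>Linf. (AE z in circle_measure. \<phi> z * \<eta> z = 1))"

lift_definition mult_op :: "(complex \<Rightarrow> complex) \<Rightarrow> L2 \<Rightarrow> L2"
  is "\<lambda>\<phi> f z. if \<phi> \<in> Linf then \<phi> z * f z else 0"
proof -
  fix \<phi> f g :: "complex \<Rightarrow> complex"
  assume a: "square_integrable f \<and> square_integrable g \<and> (AE z in circle_measure. f z = g z)"
  show "square_integrable (\<lambda>z. if \<phi> \<in> Linf then \<phi> z * f z else 0) \<and>
      square_integrable (\<lambda>z. if \<phi> \<in> Linf then \<phi> z * g z else 0) \<and>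
      (AE z in circle_measure. (if \<phi> \<in> Linf then \<phi> z * f z else 0)
                             = (if \<phi> \<in> Linf then \<phi> z * g z else 0))"
  proof (cases "\<phi> \<in> Linf")
    case True
    then obtain C where C: "\<phi> \<in> borel_measurable circle_measure" "AE z in circle_measure. cmod (\<phi> z) \<le> C"
      by (auto simp: Linf_def)
    have "AE z in circle_measure. \<phi> z * f z = \<phi> z * g z"
      using a by (auto elim: eventually_mono)
    with True a square_integrable_bounded_mult[OF _ C] show ?thesis
      by simp
  next
    case False
    then show ?thesis
      by (simp add: square_integrable_zero)
  qed
qed

definition toeplitz :: "(complex \<Rightarrow> complex) \<Rightarrow> L2 \<Rightarrow> L2" where
  "toeplitz \<phi> f = blinfun_apply (proj H2) (mult_op \<phi> f)"

definition toeplitz_kernel :: "(complex \<Rightarrow> complex) \<Rightarrow> L2 set" where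
  "toeplitz_kernel \<phi> = {f \<in> H2. toeplitz \<phi> f = 0}"

definition proj_symbol :: "(complex \<Rightarrow> complex) \<Rightarrow> (L2 \<Rightarrow>\<^sub>L L2)" where
  "proj_symbol \<phi> = proj (mult_op \<phi> ` H2)"


section \<open>Geodesics\<close>

definition geodesic_curve :: "(L2 \<Rightarrow>\<^sub>L L2) \<Rightarrow> (L2 \<Rightarrow>\<^sub>L L2) \<Rightarrow> real \<Rightarrow> (L2 \<Rightarrow>\<^sub>L L2)" where
  "geodesic_curve P X t =
     exp_op (scaleC_op (\<i> * of_real t) X) o\<^sub>L P o\<^sub>L exp_op (scaleC_op (- \<i> * of_real t) X)"

definition geodesic_joining ::
  "(L2 \<Rightarrow>\<^sub>L L2) \<Rightarrow> (L2 \<Rightarrow>\<^sub>L L2) \<Rightarrow> (real \<Rightarrow> (L2 \<Rightarrow>\<^sub>L L2)) \<Rightarrow> bool" where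
  "geodesic_joining P Q \<delta> \<longleftrightarrow>
     (\<exists>X\<in>bounded_ops. selfadjoint X \<and> codiagonal P X \<and> \<delta> = geodesic_curve P X) \<and> \<delta> 1 = Q"

text \<open>Here \<open>S\<close> is the set of nodes of a partition, and the curve is continuously differentiable
  on each closed piece. The library's \<open>piecewise_C1_differentiable_on\<close> is weaker: it allows the
  derivative to be unbounded near the nodes, so that the length integral need not exist.\<close>

definition piecewise_C1_curve :: "(real \<Rightarrow> 'a::real_normed_vector) \<Rightarrow> bool" where
  "piecewise_C1_curve \<alpha> \<longleftrightarrow>
     (\<exists>S. finite S \<and> {0, 1} \<subseteq> S \<and> S \<subseteq> {0..1} \<and>
       (\<forall>a\<in>S. \<forall>b\<in>S. a < b \<and> {a<..<b} \<inter> S = {} \<longrightarrow>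
         (\<exists>D. continuous_on {a..b} D \<and>
           (\<forall>t\<in>{a..b}. (\<alpha> has_vector_derivative D t) (at t within {a..b})))))"

definition curve_length :: "(real \<Rightarrow> 'a::real_normed_vector) \<Rightarrow> real" where
  "curve_length \<alpha> = integral {0..1} (\<lambda>t. norm (vector_derivative \<alpha> (at t within {0..1})))"

definition minimal_geodesic_joining ::
  "(L2 \<Rightarrow>\<^sub>L L2) \<Rightarrow> (L2 \<Rightarrow>\<^sub>L L2) \<Rightarrow> (real \<Rightarrow> (L2 \<Rightarrow>\<^sub>L L2)) \<Rightarrow> bool" where
  "minimal_geodesic_joining P Q \<delta> \<longleftrightarrow>
     geodesic_joining P Q \<delta> \<and>
     (\<forall>\<alpha>. piecewise_C1_curve \<alpha> \<and> \<alpha> ` {0..1} \<subseteq> Gr \<and> \<alpha> 0 = P \<and> \<alpha> 1 = Q \<longrightarrow>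
        curve_length \<delta> \<le> curve_length \<alpha>)"

definition geodesic_generator :: "(L2 \<Rightarrow>\<^sub>L L2) \<Rightarrow> (L2 \<Rightarrow>\<^sub>L L2) \<Rightarrow> (L2 \<Rightarrow>\<^sub>L L2) \<Rightarrow> bool" where
  "geodesic_generator P Q X \<longleftrightarrow>
     X \<in> bounded_ops \<and> selfadjoint X \<and> norm X \<le> pi / 2 \<and>
     exp_op (scaleC_op \<i> X) o\<^sub>L P o\<^sub>L exp_op (scaleC_op (- \<i>) X) = Q \<and>
     codiagonal P X \<and> codiagonal Q X"

end

theory Submission
  imports Defs "HOL-Computational_Algebra.Fundamental_Theorem_Algebra"
begin

text \<open>
  With the symmetries \<open>R\<^sub>1 = 2P - 1\<close> and \<open>R\<^sub>2 = 2Q - 1\<close>, a selfadjoint \<open>X\<close> is co-diagonal with respect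
  to \<open>P\<close> iff it anticommutes with \<open>R\<^sub>1\<close>, and then \<open>e\<^sup>i\<^sup>X P e\<^sup>-\<^sup>i\<^sup>X = Q\<close> means \<open>e\<^sup>2\<^sup>i\<^sup>X = R\<^sub>2R\<^sub>1\<close>. If
  \<open>ran P \<inter> ker Q\<close> and \<open>ker P \<inter> ran Q\<close> are trivial, then \<open>-1\<close> is not an eigenvalue of \<open>R\<^sub>2R\<^sub>1\<close>; so
  \<open>\<bar>X\<bar> \<le> \<pi>/2\<close> forces \<open>cos X\<close> to be the injective positive root of \<open>(1 + cos 2X)/2\<close>, which determines
  \<open>sin X\<close> and hence \<open>X = arcsin (sin X)\<close>, and this recipe also constructs \<open>X\<close>. Minimality holds because a
  curve \<open>R(t)\<close> of symmetries moves a unit vector \<open>x\<close> along the sphere, where its length is at least the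
  angle between \<open>R\<^sub>1x\<close> and \<open>R\<^sub>2x\<close>; for approximate eigenvectors of \<open>X\<close> this angle tends to \<open>2\<bar>X\<bar>\<close>.
  Conversely, along any geodesic \<open>e\<^sup>i\<^sup>X\<close> carries \<open>ran P \<inter> ker Q\<close> into \<open>ker P \<inter> ran Q\<close> and vice versa, while
  Coburn's argument shows that one of the two is trivial when \<open>P = P\<^sub>\<phi>\<close> and \<open>Q = P\<^sub>\<psi>\<close>. By Beurling's
  theorem for \<open>\<psi>H\<^sup>2\<close> and \<open>\<phi>H\<^sup>2\<close>, the two intersections are isomorphic to the two Toeplitz kernels.
\<close>

text \<open>The obstacle is that \<open>-1\<close>, although not an eigenvalue of
  \<open>W = R2 * R1\<close>, may lie in its spectrum, where no branch of the logarithm is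
  continuous. Hence only selfadjoint operators enter the functional calculus: \<open>W\<close> is
  split as \<open>c + \<iota> * K\<close> with selfadjoint \<open>c\<close> and \<open>K\<close> in
  the roles of \<open>cos 2X\<close> and \<open>sin 2X\<close>, and half angles are taken. Dividing
  \<open>K / 2\<close> by \<open>cos X\<close> is impossible, because \<open>cos X\<close> is
  injective but perhaps not invertible; \<open>sin X\<close> is the bounded extension from the dense
  range of \<open>cos X\<close>, and identities for it are checked after multiplication by
  \<open>cos X\<close>. From there on nothing is singular, since \<open>arcsin\<close> is continuous
  on all of \<open>[-1, 1]\<close>, end points included. The calculus uses an interval
  \<open>[-M, M]\<close> with \<open>norm T \<le> M\<close> in place of the spectrum, so scalar
  identities have to hold on the whole interval, as the trigonometric ones do. In the length
  estimate approximate eigenvectors stand in for an eigenvector to plus or minus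
  \<open>norm X\<close>, which need not exist.\<close>

section \<open>The Banach algebra of bounded operators\<close>

text \<open>A copy of the bounded linear self-maps that can be made a Banach algebra, so that the library's
  \<open>exp\<close>, \<open>sin\<close> and \<open>cos\<close> apply to operators.\<close>

typedef (overloaded) 'a endo = "UNIV :: ('a::real_normed_vector \<Rightarrow>\<^sub>L 'a) set"
  morphisms blinfun_of Endo ..

setup_lifting type_definition_endo

lift_definition app :: "'a::real_normed_vector endo \<Rightarrow> 'a \<Rightarrow> 'a"  (infixr \<open>\<cdot>\<close> 75)
  is blinfun_apply .

lemma endo_eqI: "(\<And>x. A \<cdot> x = B \<cdot> x) \<Longrightarrow> A = B"
  by transfer (rule blinfun_eqI)

text \<open>The sort \<open>perfect_space\<close> excludes the zero space, where
  \<open>norm 1 = 1\<close> and \<open>0 \<noteq> 1\<close> would fail.\<close>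

instantiation endo :: ("{real_normed_vector, perfect_space}") real_normed_algebra_1
begin

lift_definition zero_endo :: "'a endo" is 0 .
lift_definition one_endo :: "'a endo" is id_blinfun .
lift_definition plus_endo :: "'a endo \<Rightarrow> 'a endo \<Rightarrow> 'a endo" is "(+)" .
lift_definition minus_endo :: "'a endo \<Rightarrow> 'a endo \<Rightarrow> 'a endo" is "(-)" .
lift_definition uminus_endo :: "'a endo \<Rightarrow> 'a endo" is uminus .
lift_definition times_endo :: "'a endo \<Rightarrow> 'a endo \<Rightarrow> 'a endo" is "(o\<^sub>L)" .
lift_definition scaleR_endo :: "real \<Rightarrow> 'a endo \<Rightarrow> 'a endo" is scaleR .
lift_definition norm_endo :: "'a endo \<Rightarrow> real" is norm .
lift_definition dist_endo :: "'a endo \<Rightarrow> 'a endo \<Rightarrow> real" is dist .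
lift_definition sgn_endo :: "'a endo \<Rightarrow> 'a endo" is sgn .

definition uniformity_endo :: "('a endo \<times> 'a endo) filter" where
  "uniformity_endo = (INF e\<in>{0<..}. principal {(A, B). dist A B < e})"

definition open_endo :: "'a endo set \<Rightarrow> bool" where
  "open_endo U \<longleftrightarrow> (\<forall>A\<in>U. eventually (\<lambda>(A', B). A' = A \<longrightarrow> B \<in> U) uniformity)"

instance
proof
  fix A B C :: "'a endo" and r s :: real and U :: "'a endo set"
  show "uniformity = (INF e\<in>{0<..}. principal {(A :: 'a endo, B). dist A B < e})"
    by (rule uniformity_endo_def)
  show "open U \<longleftrightarrow> (\<forall>A\<in>U. eventually (\<lambda>(A', B). A' = A \<longrightarrow> B \<in> U) uniformity)"
    by (rule open_endo_def)
  show "norm (A * B) \<le> norm A * norm B"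
    by transfer (rule norm_blinfun_compose)
  show norm_1: "norm (1 :: 'a endo) = 1"
    by transfer (rule norm_blinfun_id)
  have "norm (0 :: 'a endo) = 0"
    by transfer simp
  with norm_1 show "(0 :: 'a endo) \<noteq> 1"
    by auto
qed (transfer; auto simp: blinfun_eqI algebra_simps blinfun.bilinear_simps dist_norm
      sgn_div_norm norm_triangle_ineq intro!: blinfun_eqI)+

end

lemma blinfun_of_simps:
  "blinfun_of 0 = 0" "blinfun_of 1 = id_blinfun" "blinfun_of (A + B) = blinfun_of A + blinfun_of B"
  "blinfun_of (A - B) = blinfun_of A - blinfun_of B" "blinfun_of (- A) = - blinfun_of A"
  "blinfun_of (A * B) = blinfun_of A o\<^sub>L blinfun_of B"
  "blinfun_of (r *\<^sub>R A) = r *\<^sub>R blinfun_of A" "norm (blinfun_of A) = norm A"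
  by (transfer; simp)+

lemma app_simps [simp]:
  "0 \<cdot> x = 0" "1 \<cdot> x = x" "(A + B) \<cdot> x = A \<cdot> x + B \<cdot> x" "(A - B) \<cdot> x = A \<cdot> x - B \<cdot> x"
  "(- A) \<cdot> x = - (A \<cdot> x)" "(A * B) \<cdot> x = A \<cdot> B \<cdot> x" "(r *\<^sub>R A) \<cdot> x = r *\<^sub>R (A \<cdot> x)"
  "A \<cdot> (x + y) = A \<cdot> x + A \<cdot> y" "A \<cdot> (x - y) = A \<cdot> x - A \<cdot> y" "A \<cdot> (- x) = - (A \<cdot> x)"
  "A \<cdot> (r *\<^sub>R x) = r *\<^sub>R (A \<cdot> x)" "A \<cdot> 0 = 0"
  by (transfer; simp add: blinfun.bilinear_simps)+

lemma norm_app: "norm (A \<cdot> x) \<le> norm A * norm x"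
  for A :: "'a::{real_normed_vector, perfect_space} endo"
  by transfer (rule norm_blinfun)

lemma norm_endo_bound:
  fixes A :: "'a::{real_normed_vector, perfect_space} endo"
  shows "0 \<le> b \<Longrightarrow> (\<And>x. norm (A \<cdot> x) \<le> b * norm x) \<Longrightarrow> norm A \<le> b"
  by transfer (rule norm_blinfun_bound)

lemma bounded_bilinear_app:
  "bounded_bilinear (app :: 'a::{real_normed_vector, perfect_space} endo \<Rightarrow> 'a \<Rightarrow> 'a)"
  by (rule bounded_bilinear.intro)
    (auto intro!: exI[of _ 1] norm_app)

lemmas tendsto_app = bounded_bilinear.tendsto[OF bounded_bilinear_app]

lemma bounded_linear_blinfun_of:
  "bounded_linear (blinfun_of :: 'a::{real_normed_vector, perfect_space} endo \<Rightarrow> _)"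
  by (rule bounded_linear_intro[where K=1]) (simp_all add: blinfun_of_simps)

lemma bounded_linear_Endo:
  "bounded_linear (Endo :: _ \<Rightarrow> 'a::{real_normed_vector, perfect_space} endo)"
proof (rule bounded_linear_intro[where K=1])
  fix A B :: "'a \<Rightarrow>\<^sub>L 'a" and r :: real
  show "Endo (A + B) = Endo A + Endo B" "Endo (r *\<^sub>R A) = r *\<^sub>R Endo A"
    by (simp_all add: plus_endo.abs_eq scaleR_endo.abs_eq eq_onp_same_args)
  show "norm (Endo A) \<le> norm A * 1"
    by (simp add: norm_endo.abs_eq eq_onp_same_args)
qed

instance endo :: ("{banach, perfect_space}") banach
proof
  fix X :: "nat \<Rightarrow> 'a endo"
  assume "Cauchy X"
  then have "Cauchy (\<lambda>n. blinfun_of (X n))"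
    by (rule bounded_linear.Cauchy[OF bounded_linear_blinfun_of])
  then obtain L where "(\<lambda>n. blinfun_of (X n)) \<longlonglongrightarrow> L"
    using Cauchy_convergent_iff convergent_def by blast
  then have "(\<lambda>n. Endo (blinfun_of (X n))) \<longlonglongrightarrow> Endo L"
    by (rule bounded_linear.tendsto[OF bounded_linear_Endo])
  then show "convergent X"
    by (auto simp: blinfun_of_inverse convergent_def)
qed

lemma bounded_linear_endo:
  assumes "bounded_linear (f :: 'a::{real_normed_vector, perfect_space} \<Rightarrow> 'a)"
  obtains A where "\<And>x. A \<cdot> x = f x"
proof
  show "Endo (Blinfun f) \<cdot> x = f x" for x
    by (simp add: app.abs_eq bounded_linear_Blinfun_apply[OF assms] eq_onp_same_args)
qed

section \<open>Adjoints and approximate eigenvalues\<close>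

text \<open>A relation rather than an operation, because every adjoint that occurs below is given
  explicitly. The inner product is the real one; for operators commuting with the complex structure
  this is the complex adjoint.\<close>

definition adj :: "'a::real_inner endo \<Rightarrow> 'a endo \<Rightarrow> bool" where
  "adj A B \<longleftrightarrow> (\<forall>x y. (A \<cdot> x) \<bullet> y = x \<bullet> (B \<cdot> y))"

context
  fixes A A' B B' :: "'a::{real_inner, perfect_space} endo"
begin

lemma adj_commute: "adj A A' \<Longrightarrow> adj A' A"
  by (simp add: adj_def inner_commute)

lemma adj_0: "adj (0 :: 'a endo) 0" and adj_1: "adj (1 :: 'a endo) 1"
  by (simp_all add: adj_def)

lemma adj_add: "adj A A' \<Longrightarrow> adj B B' \<Longrightarrow> adj (A + B) (A' + B')"
  and adj_diff: "adj A A' \<Longrightarrow> adj B B' \<Longrightarrow> adj (A - B) (A' - B')"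
  and adj_minus: "adj A A' \<Longrightarrow> adj (- A) (- A')"
  and adj_scaleR: "adj A A' \<Longrightarrow> adj (r *\<^sub>R A) (r *\<^sub>R A')"
  and adj_mult: "adj A A' \<Longrightarrow> adj B B' \<Longrightarrow> adj (A * B) (B' * A')"
  by (simp_all add: adj_def inner_simps)

end

lemma adj_power:
  fixes A A' :: "'a::{real_inner, perfect_space} endo"
  shows "adj A A' \<Longrightarrow> adj (A ^ n) (A' ^ n)"
  by (induction n) (simp_all add: adj_1 adj_mult power_commutes[symmetric, of A])

lemma adj_sum:
  fixes A A' :: "'b \<Rightarrow> 'a::{real_inner, perfect_space} endo"
  assumes "\<And>n. n \<in> N \<Longrightarrow> adj (A n) (A' n)"
  shows "adj (sum A N) (sum A' N)"
  using assms by (induction N rule: infinite_finite_induct) (auto simp: adj_0 adj_add)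

lemma adj_limit:
  fixes A A' :: "nat \<Rightarrow> 'a::{real_inner, perfect_space} endo"
  assumes "\<And>n. adj (A n) (A' n)" "A \<longlonglongrightarrow> B" "A' \<longlonglongrightarrow> B'"
  shows "adj B B'"
  unfolding adj_def
proof (intro allI)
  fix x y
  have "(\<lambda>n. (A n \<cdot> x) \<bullet> y) \<longlonglongrightarrow> (B \<cdot> x) \<bullet> y" "(\<lambda>n. x \<bullet> (A' n \<cdot> y)) \<longlonglongrightarrow> x \<bullet> (B' \<cdot> y)"
    by (intro tendsto_intros tendsto_app assms)+
  with assms(1) show "(B \<cdot> x) \<bullet> y = x \<bullet> (B' \<cdot> y)"
    by (auto simp: adj_def intro: LIMSEQ_unique)
qed

lemma adj_exp:
  fixes A A' :: "'a::{real_inner, banach, perfect_space} endo"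
  assumes "adj A A'"
  shows "adj (exp A) (exp A')"
proof (rule adj_limit)
  show "adj (\<Sum>i<n. A ^ i /\<^sub>R fact i) (\<Sum>i<n. A' ^ i /\<^sub>R fact i)" for n
    by (intro adj_sum adj_scaleR adj_power assms)
  show "(\<lambda>n. \<Sum>i<n. A ^ i /\<^sub>R fact i) \<longlonglongrightarrow> exp A" "(\<lambda>n. \<Sum>i<n. A' ^ i /\<^sub>R fact i) \<longlonglongrightarrow> exp A'"
    using exp_converges[of A] exp_converges[of A'] by (simp_all add: sums_def)
qed

lemma adj_isometry:
  fixes A B :: "'a::{real_inner, perfect_space} endo"
  assumes "adj A B" "B * A = 1"
  shows "norm (A \<cdot> x) = norm x"
proof -
  have "(A \<cdot> x) \<bullet> (A \<cdot> x) = x \<bullet> ((B * A) \<cdot> x)"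
    using assms(1) by (simp add: adj_def)
  then show ?thesis
    by (simp add: assms(2) norm_eq_sqrt_inner)
qed

text \<open>Failure of this for \<open>T - l *\<^sub>R 1\<close> means that \<open>l\<close> is an
  approximate eigenvalue of \<open>T\<close>; for symmetric operators this replaces membership in
  the spectrum.\<close>

definition bounded_below :: "'a::real_normed_vector endo \<Rightarrow> bool" where
  "bounded_below A \<longleftrightarrow> (\<exists>c>0. \<forall>x. c * norm x \<le> norm (A \<cdot> x))"

lemma bounded_below_mult:
  fixes A B :: "'a::{real_normed_vector, perfect_space} endo"
  assumes "bounded_below A" "bounded_below B"
  shows "bounded_below (A * B)"
proof -
  obtain c d where c: "c > 0" "\<And>x. c * norm x \<le> norm (A \<cdot> x)"
    and d: "d > 0" "\<And>x. d * norm x \<le> norm (B \<cdot> x)"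
    using assms unfolding bounded_below_def by metis
  have "c * d * norm x \<le> norm (A \<cdot> B \<cdot> x)" for x
    using c(2)[of "B \<cdot> x"] mult_left_mono[OF d(2)[of x] less_imp_le[OF c(1)]] by (simp add: mult.assoc)
  then show ?thesis
    unfolding bounded_below_def using c(1) d(1) by (intro exI[of _ "c * d"]) simp
qed

lemma ex_nonzero: "\<exists>x :: 'a::{real_normed_vector, perfect_space}. x \<noteq> 0"
proof (rule ccontr)
  assume "\<not> ?thesis"
  then have "UNIV = {0::'a}" by auto
  then show False using open_UNIV not_open_singleton by metis
qed

text \<open>If both operators were bounded below, so would be their product
  \<open>T * T - N\<^sup>2 *\<^sub>R 1\<close>. Expanding the norm of its values then bounds
  \<open>norm (T \<cdot> x)\<close> by a factor strictly smaller than \<open>N\<close>, against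
  \<open>N = norm T\<close>.\<close>

lemma symmetric_norm_approximate_eigenvalue:
  fixes T :: "'a::{real_inner, perfect_space} endo"
  assumes T: "adj T T"
  shows "\<not> bounded_below (T - norm T *\<^sub>R 1) \<or> \<not> bounded_below (T + norm T *\<^sub>R 1)"
proof (rule ccontr)
  define N where "N = norm T"
  assume "\<not> ?thesis"
  then have "bounded_below ((T - N *\<^sub>R 1) * (T + N *\<^sub>R 1))"
    using bounded_below_mult N_def by blast
  then obtain c where c: "c > 0" "\<And>x. c * norm x \<le> norm (((T - N *\<^sub>R 1) * (T + N *\<^sub>R 1)) \<cdot> x)"
    unfolding bounded_below_def by blast
  have key: "c\<^sup>2 * (norm x)\<^sup>2 \<le> N\<^sup>2 * (N\<^sup>2 * (norm x)\<^sup>2 - (norm (T \<cdot> x))\<^sup>2)" for x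
  proof -
    have eq: "((T - N *\<^sub>R 1) * (T + N *\<^sub>R 1)) \<cdot> x = T \<cdot> T \<cdot> x - N\<^sup>2 *\<^sub>R x"
      by (simp add: algebra_simps power2_eq_square)
    have "(T \<cdot> T \<cdot> x) \<bullet> x = (T \<cdot> x) \<bullet> (T \<cdot> x)"
      using T unfolding adj_def by blast
    moreover have "(norm (u - r *\<^sub>R v))\<^sup>2 = (norm u)\<^sup>2 - 2 * r * (u \<bullet> v) + r\<^sup>2 * (norm v)\<^sup>2" for u v :: 'a and r
      unfolding power2_norm_eq_inner
      by (simp add: inner_diff_left inner_diff_right inner_commute power2_eq_square algebra_simps)
    ultimately have "(norm (T \<cdot> T \<cdot> x - N\<^sup>2 *\<^sub>R x))\<^sup>2
        = (norm (T \<cdot> T \<cdot> x))\<^sup>2 - 2 * N\<^sup>2 * (norm (T \<cdot> x))\<^sup>2 + (N\<^sup>2)\<^sup>2 * (norm x)\<^sup>2"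
      by (simp add: power2_norm_eq_inner)
    moreover have "(norm (T \<cdot> T \<cdot> x))\<^sup>2 \<le> N\<^sup>2 * (norm (T \<cdot> x))\<^sup>2"
      using power_mono[OF norm_app[of T "T \<cdot> x"], of 2] by (simp add: N_def power_mult_distrib)
    moreover have "(c * norm x)\<^sup>2 \<le> (norm (T \<cdot> T \<cdot> x - N\<^sup>2 *\<^sub>R x))\<^sup>2"
      using c eq by (intro power_mono) (metis, simp)
    ultimately show ?thesis
      by (simp add: power_mult_distrib algebra_simps power2_eq_square)
  qed
  obtain x :: 'a where x: "x \<noteq> 0" using ex_nonzero by blast
  have "0 < c\<^sup>2 * (norm x)\<^sup>2" using c x by simp
  \<comment> \<open>For \<open>N = 0\<close> the right-hand side of \<open>key\<close> vanishes;
    excluding this allows the division by \<open>N\<^sup>2\<close>.\<close>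
  with key[of x] have N: "N > 0"
    by (cases "N = 0") (auto simp: N_def)
  have le: "(norm (T \<cdot> x))\<^sup>2 \<le> (N\<^sup>2 - c\<^sup>2 / N\<^sup>2) * (norm x)\<^sup>2" for x
    using key[of x] N by (simp add: field_simps power2_eq_square)
  have "0 \<le> (N\<^sup>2 - c\<^sup>2 / N\<^sup>2) * (norm x)\<^sup>2"
    using le[of x] by (meson order_trans zero_le_power2)
  then have nonneg: "0 \<le> N\<^sup>2 - c\<^sup>2 / N\<^sup>2"
    using x by (simp add: zero_le_mult_iff)
  have "norm T \<le> sqrt (N\<^sup>2 - c\<^sup>2 / N\<^sup>2)"
  proof (rule norm_endo_bound)
    show "norm (T \<cdot> x) \<le> sqrt (N\<^sup>2 - c\<^sup>2 / N\<^sup>2) * norm x" for x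
      using le[of x] real_le_rsqrt by (fastforce simp: real_sqrt_mult)
  qed (use nonneg in simp)
  then have "N\<^sup>2 \<le> N\<^sup>2 - c\<^sup>2 / N\<^sup>2"
    using nonneg by (metis N_def norm_ge_zero power_mono real_sqrt_pow2)
  then show False using c N by (simp add: field_simps)
qed

section \<open>Polynomial and continuous functional calculus\<close>

text \<open>Horner evaluation in an arbitrary real algebra, so that the same rules serve operators
  and the complex numbers, where roots are found.\<close>

definition peval :: "real poly \<Rightarrow> 'a \<Rightarrow> 'a::real_algebra_1" where
  "peval p T = fold_coeffs (\<lambda>a B. a *\<^sub>R 1 + T * B) p 0"

lemma peval_0 [simp]: "peval 0 T = 0"
  by (simp add: peval_def)

lemma peval_pCons [simp]: "peval (pCons a p) T = a *\<^sub>R 1 + T * peval p T"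
  by (cases "p = 0 \<and> a = 0") (auto simp: peval_def)

lemma peval_add [simp]: "peval (p + q) T = peval p T + peval q T"
  by (induction p q rule: poly_induct2) (simp_all add: algebra_simps)

lemma peval_smult [simp]: "peval (smult c p) T = c *\<^sub>R peval p T"
  by (induction p) (simp_all add: algebra_simps)

lemma peval_minus [simp]: "peval (- p) T = - peval p T"
  by (induction p) (simp_all add: algebra_simps)

lemma peval_diff [simp]: "peval (p - q) T = peval p T - peval q T"
  using peval_add[of p "- q" T] by simp

lemma peval_commute_arg: "T * peval p T = peval p T * T"
  by (induction p) (simp_all add: distrib_left distrib_right, metis mult.assoc)

lemma peval_intertwine: "A * T = T' * A \<Longrightarrow> A * peval p T = peval p T' * A"
  by (induction p) (simp_all add: distrib_left distrib_right, metis mult.assoc)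

lemma peval_mult [simp]: "peval (p * q) T = peval p T * peval q T"
  by (induction p) (simp_all add: algebra_simps)

lemma peval_monom [simp]: "peval (monom a n) T = a *\<^sub>R T ^ n"
  by (induction n) (simp_all add: monom_0 monom_Suc)

lemma peval_sum [simp]: "peval (sum p N) T = (\<Sum>n\<in>N. peval (p n) T)"
  by (induction N rule: infinite_finite_induct) simp_all

lemma peval_complex: "peval p (z::complex) = poly (map_poly of_real p) z"
  by (induction p) (simp_all add: map_poly_pCons scaleR_conv_of_real)

lemma peval_of_real: "peval p (of_real x :: 'a::real_algebra_1) = of_real (poly p x)"
  by (induction p) (simp_all add: scaleR_conv_of_real)

lemma adj_peval: "adj T T \<Longrightarrow> adj (peval p T) (peval p T)"
  for T :: "'a::{real_inner, perfect_space} endo"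
proof (induction p)
  case (pCons a p)
  then have "adj (T * peval p T) (peval p T * T)"
    by (intro adj_mult) auto
  with pCons show ?case
    by (simp add: adj_add adj_scaleR adj_1 peval_commute_arg)
qed (simp add: adj_0)

lemma bounded_below_linear:
  fixes T :: "'a::{real_inner, perfect_space} endo"
  assumes "norm T < \<bar>a\<bar>"
  shows "bounded_below (T - a *\<^sub>R 1)"
  unfolding bounded_below_def
proof (intro exI conjI allI)
  fix x
  have "norm (a *\<^sub>R x) \<le> norm (T \<cdot> x) + norm ((T - a *\<^sub>R 1) \<cdot> x)"
    using norm_triangle_ineq4[of "T \<cdot> x" "(T - a *\<^sub>R 1) \<cdot> x"] by simp
  then show "(\<bar>a\<bar> - norm T) * norm x \<le> norm ((T - a *\<^sub>R 1) \<cdot> x)"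
    using norm_app[of T x] by (simp add: algebra_simps)
qed (use assms in simp)

text \<open>The square of the symmetric \<open>T - a *\<^sub>R 1\<close> has a nonnegative quadratic
  form, so adding \<open>b\<^sup>2\<close> makes the form at least \<open>b\<^sup>2\<close>, and
  Cauchy-Schwarz turns this into a bound for the norm. It is the real form of the fact that non-real
  numbers are not in the spectrum.\<close>

lemma bounded_below_quadratic:
  fixes T :: "'a::{real_inner, perfect_space} endo"
  assumes T: "adj T T" and b: "b \<noteq> 0"
  shows "bounded_below ((T - a *\<^sub>R 1) * (T - a *\<^sub>R 1) + b\<^sup>2 *\<^sub>R 1)"
  unfolding bounded_below_def
proof (intro exI conjI allI)
  fix x
  let ?U = "T - a *\<^sub>R 1" and ?V = "(T - a *\<^sub>R 1) * (T - a *\<^sub>R 1) + b\<^sup>2 *\<^sub>R 1"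
  have "adj ?U ?U"
    by (intro adj_diff adj_scaleR adj_1 T)
  then have "(?U \<cdot> ?U \<cdot> x) \<bullet> x = (?U \<cdot> x) \<bullet> (?U \<cdot> x)"
    unfolding adj_def by blast
  moreover have "?V \<cdot> x = ?U \<cdot> ?U \<cdot> x + b\<^sup>2 *\<^sub>R x"
    by (simp only: app_simps)
  ultimately have "(?V \<cdot> x) \<bullet> x = (norm (?U \<cdot> x))\<^sup>2 + b\<^sup>2 * (norm x)\<^sup>2"
    by (simp only: inner_simps power2_norm_eq_inner)
  then have "b\<^sup>2 * (norm x)\<^sup>2 \<le> (?V \<cdot> x) \<bullet> x"
    by simp
  also have "\<dots> \<le> norm (?V \<cdot> x) * norm x"
    by (rule norm_cauchy_schwarz)
  finally have *: "(b\<^sup>2 * norm x) * norm x \<le> norm (?V \<cdot> x) * norm x"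
    by (simp add: power2_eq_square mult.assoc)
  show "b\<^sup>2 * norm x \<le> norm (?V \<cdot> x)"
  proof (cases "x = 0")
    case False
    with mult_right_le_imp_le[OF *] show ?thesis by simp
  qed simp
qed (use b in simp)

text \<open>A real version of spectral mapping. A complex root splits off a factor: a real root lies
  outside \<open>[-M, M]\<close> and gives a linear factor bounded below, a non-real root gives
  together with its conjugate a quadratic one; induction on the degree treats the cofactor.\<close>

lemma bounded_below_peval:
  fixes T :: "'a::{real_inner, perfect_space} endo"
  assumes T: "adj T T" "norm T \<le> M"
  shows "(\<And>x. x \<in> {-M..M} \<Longrightarrow> poly p x \<noteq> 0) \<Longrightarrow> bounded_below (peval p T)"
proof (induction "degree p" arbitrary: p rule: less_induct)
  case less
  have "0 \<le> M" using T norm_ge_zero order_trans by blast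
  then have p0: "p \<noteq> 0" using less.prems[of 0] by auto
  show ?case
  proof (cases "degree p = 0")
    case True
    then obtain c where c: "p = [:c:]"
      by (rule degree_eq_zeroE)
    with p0 show ?thesis
      unfolding bounded_below_def by (intro exI[of _ "\<bar>c\<bar>"]) auto
  next
    case False
    have step: "bounded_below (peval p T)"
      if q: "p = q * s" "degree q > 0" "bounded_below (peval q T)" for q s
    proof -
      have "s \<noteq> 0" "q \<noteq> 0" using p0 q by auto
      then have "degree s < degree p"
        using q by (simp add: degree_mult_eq)
      moreover have "poly s x \<noteq> 0" if "x \<in> {-M..M}" for x
        using less.prems[OF that] q by auto
      ultimately have "bounded_below (peval s T)"
        by (rule less.hyps)
      with q show ?thesis
        by (simp add: bounded_below_mult)
    qed
    have "degree (map_poly complex_of_real p) \<noteq> 0"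
      using False by (simp add: degree_map_poly)
    then have "\<not> constant (poly (map_poly complex_of_real p))"
      by (simp add: constant_degree)
    then obtain z :: complex where z: "peval p z = 0"
      using fundamental_theorem_of_algebra by (auto simp: peval_complex)
    show ?thesis
    proof (cases "Im z = 0")
      case True
      then have "z \<in> \<real>"
        by (simp add: complex_is_Real_iff)
      then obtain x where x: "z = of_real x"
        by (rule Reals_cases)
      then have root: "poly p x = 0"
        using z by (simp only: peval_of_real of_real_eq_0_iff)
      with less.prems[of "x"] have "M < \<bar>x\<bar>"
        by fastforce
      with T(2) have bb: "bounded_below (T - x *\<^sub>R 1)"
        by (intro bounded_below_linear) linarith
      from root obtain s where s: "p = [:- x, 1:] * s"
        using poly_eq_0_iff_dvd dvdE by metis
      show ?thesis
        using bb by (intro step[OF s]) simp_all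
    next
      case False
      \<comment> \<open>The real polynomial with the roots \<open>z\<close> and
        \<open>cnj z\<close>.\<close>
      define q where "q = [:(Re z)\<^sup>2 + (Im z)\<^sup>2, - (Re z + Re z), 1:]"
      have q_eq: "peval q A = (A - Re z *\<^sub>R 1) * (A - Re z *\<^sub>R 1) + (Im z)\<^sup>2 *\<^sub>R 1"
        for A :: "'b::real_algebra_1"
        by (simp add: q_def algebra_simps power2_eq_square, metis mult_2_right scaleR_add_left)
      have qz: "peval q z = 0"
        by (simp add: q_eq complex_eq_iff power2_eq_square)
      have q0: "q \<noteq> 0" and deg: "degree q = 2"
        by (simp_all add: q_def)
      \<comment> \<open>The remainder \<open>u + v * X\<close> vanishes at the non-real
        \<open>z\<close>, so \<open>v = 0\<close> from the imaginary part and then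
        \<open>u = 0\<close>: \<open>q\<close> divides \<open>p\<close>.\<close>
      have rz: "peval (p mod q) z = 0"
      proof -
        have "peval p z = peval (p div q * q + p mod q) z"
          by simp
        also have "\<dots> = peval (p mod q) z"
          unfolding peval_add peval_mult qz by simp
        finally show ?thesis
          using z by simp
      qed
      have "degree (p mod q) < 2" if "p mod q \<noteq> 0"
        using degree_mod_less[OF q0, of p] deg that by simp
      then have "coeff (p mod q) n = 0" if "n \<ge> 2" for n
        using that by (cases "p mod q = 0") (auto intro: coeff_eq_0)
      then have "p mod q = [:coeff (p mod q) 0, coeff (p mod q) 1:]"
        by (intro poly_eqI) (auto simp: coeff_pCons split: nat.splits)
      then obtain u v where uv: "p mod q = [:u, v:]"
        by blast
      with rz have "u + v * Re z = 0" "v * Im z = 0"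
        by (simp_all add: complex_eq_iff mult.commute)
      with False uv have "p mod q = 0"
        by simp
      then obtain s where "p = q * s"
        by (metis dvd_eq_mod_eq_0 dvdE)
      then show ?thesis
        by (rule step) (simp_all only: deg q_eq bounded_below_quadratic[OF T(1) False] zero_less_numeral)
    qed
  qed
qed

text \<open>One of the numbers plus or minus \<open>N = norm (peval p T)\<close> is an approximate
  eigenvalue of \<open>peval p T\<close>. By \<open>bounded_below_peval\<close> it is then a value
  of \<open>p\<close> on \<open>[-M, M]\<close>.\<close>

lemma norm_peval_le:
  fixes T :: "'a::{real_inner, perfect_space} endo"
  assumes T: "adj T T" "norm T \<le> M" and S: "\<And>x. x \<in> {-M..M} \<Longrightarrow> \<bar>poly p x\<bar> \<le> S"
  shows "norm (peval p T) \<le> S"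
proof -
  define N where "N = norm (peval p T)"
  from symmetric_norm_approximate_eigenvalue[OF adj_peval[OF T(1)], of p]
  have "\<not> bounded_below (peval (p - [:N:]) T) \<or> \<not> bounded_below (peval (p + [:N:]) T)"
    by (simp add: N_def)
  then obtain x where "x \<in> {-M..M}" "poly (p - [:N:]) x = 0 \<or> poly (p + [:N:]) x = 0"
    using bounded_below_peval[OF T] by blast
  with S[of x] have "\<bar>N\<bar> \<le> S"
    by (auto simp: eq_neg_iff_add_eq_0[symmetric])
  then show ?thesis
    by (simp add: N_def)
qed

text \<open>The relation that \<open>B\<close> is the value \<open>f(T)\<close> of the functional calculus on \<open>[-M, M]\<close>.\<close>

definition fcalc :: "'a::{real_inner, perfect_space} endo \<Rightarrow> real \<Rightarrow> (real \<Rightarrow> real) \<Rightarrow> 'a endo \<Rightarrow> bool" where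
  "fcalc T M f B \<longleftrightarrow>
     (\<forall>e>0. \<exists>p. (\<forall>x\<in>{-M..M}. \<bar>poly p x - f x\<bar> < e) \<and> norm (peval p T - B) < e)"

lemma uniform_limit_inverse_Suc:
  fixes f :: "'b \<Rightarrow> real"
  assumes "\<And>n x. x \<in> A \<Longrightarrow> \<bar>g n x - f x\<bar> < inverse (real (Suc n))"
  shows "uniform_limit A g f sequentially"
proof (rule uniform_limitI)
  fix e :: real assume "e > 0"
  with LIMSEQ_inverse_real_of_nat have "\<forall>\<^sub>F n in sequentially. inverse (Suc n) < e"
    by (rule order_tendstoD)
  then show "\<forall>\<^sub>F n in sequentially. \<forall>x\<in>A. dist (g n x) (f x) < e"
    by eventually_elim (metis dist_real_def less_trans assms)
qed

lemma fcalcE: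
  assumes "fcalc T M f B"
  obtains p where "uniform_limit {-M..M} (\<lambda>n. poly (p n)) f sequentially"
    "(\<lambda>n. peval (p n) T) \<longlonglongrightarrow> B"
proof -
  have "\<forall>n. \<exists>p. (\<forall>x\<in>{-M..M}. \<bar>poly p x - f x\<bar> < inverse (Suc n)) \<and> norm (peval p T - B) < inverse (Suc n)"
    using assms by (auto simp: fcalc_def)
  then obtain p where p: "\<And>n x. x \<in> {-M..M} \<Longrightarrow> \<bar>poly (p n) x - f x\<bar> < inverse (Suc n)"
    "\<And>n. norm (peval (p n) T - B) < inverse (Suc n)"
    by metis
  have "uniform_limit {-M..M} (\<lambda>n. poly (p n)) f sequentially"
    by (rule uniform_limit_inverse_Suc[OF p(1)])
  moreover have "(\<lambda>n. peval (p n) T - B) \<longlonglongrightarrow> 0"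
    using p(2) by (intro Lim_null_comparison[OF _ LIMSEQ_inverse_real_of_nat] always_eventually)
      (simp add: less_imp_le)
  ultimately show ?thesis
    by (intro that[of p]) (simp_all add: LIM_zero_iff)
qed

lemma plus_poly_fun: "poly (p + q) = (\<lambda>x. poly p x + poly q x)"
  and times_poly_fun: "poly (p * q) = (\<lambda>x. poly p x * poly q x)"
  by (simp_all add: fun_eq_iff)

lemma fcalcI:
  assumes "uniform_limit {-M..M} (\<lambda>n. poly (p n)) f sequentially" "(\<lambda>n. peval (p n) T) \<longlonglongrightarrow> B"
  shows "fcalc T M f B"
  unfolding fcalc_def
proof (intro allI impI)
  fix e :: real assume "e > 0"
  from eventually_conj[OF uniform_limitD[OF assms(1) this] tendstoD[OF assms(2) this]]
  obtain n where "\<forall>x\<in>{-M..M}. dist (poly (p n) x) (f x) < e" "dist (peval (p n) T) B < e"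
    by (metis (no_types, lifting) eventually_sequentially order_refl)
  then show "\<exists>p. (\<forall>x\<in>{-M..M}. \<bar>poly p x - f x\<bar> < e) \<and> norm (peval p T - B) < e"
    by (auto simp: dist_norm)
qed

lemma fcalc_poly: "fcalc T M (poly p) (peval p T)"
  unfolding fcalc_def by (auto intro!: exI[of _ p])

lemma fcalc_cong: "fcalc T M f B \<Longrightarrow> (\<And>x. x \<in> {-M..M} \<Longrightarrow> f x = g x) \<Longrightarrow> fcalc T M g B"
  unfolding fcalc_def by simp

lemma fcalc_id: "fcalc T M (\<lambda>x. x) T"
  by (rule fcalc_cong[OF fcalc_poly[of T M "[:0, 1:]", simplified]]) simp

lemma fcalc_const: "fcalc T M (\<lambda>x. c) (c *\<^sub>R 1)"
  by (rule fcalc_cong[OF fcalc_poly[of T M "[:c:]", simplified]]) simp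

lemma fcalc_0: "fcalc T M (\<lambda>x. 0) 0"
  using fcalc_const[of T M 0] by simp

lemma fcalc_bounded:
  assumes "fcalc T M f B"
  shows "bounded (f ` {-M..M})"
proof -
  from assms obtain p where p: "\<forall>x\<in>{-M..M}. \<bar>poly p x - f x\<bar> < 1"
    unfolding fcalc_def using zero_less_one by blast
  have "compact (poly p ` {-M..M})"
    by (intro compact_continuous_image continuous_intros) auto
  then obtain S where "\<forall>x\<in>{-M..M}. \<bar>poly p x\<bar> \<le> S"
    by (auto dest!: compact_imp_bounded simp: bounded_iff)
  with p show ?thesis
    unfolding bounded_iff by (intro exI[of _ "S + 1"]) force
qed

lemma fcalc_add:
  assumes "fcalc T M f B" "fcalc T M g C"
  shows "fcalc T M (\<lambda>x. f x + g x) (B + C)"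
proof -
  obtain p where p: "uniform_limit {-M..M} (\<lambda>n. poly (p n)) f sequentially"
    "(\<lambda>n. peval (p n) T) \<longlonglongrightarrow> B" using assms(1) by (rule fcalcE)
  obtain q where q: "uniform_limit {-M..M} (\<lambda>n. poly (q n)) g sequentially"
    "(\<lambda>n. peval (q n) T) \<longlonglongrightarrow> C" using assms(2) by (rule fcalcE)
  show ?thesis
    by (rule fcalcI[where p = "\<lambda>n. p n + q n"])
       (use uniform_limit_add[OF p(1) q(1)] tendsto_add[OF p(2) q(2)] in \<open>simp_all add: plus_poly_fun\<close>)
qed

lemma fcalc_mult:
  assumes "fcalc T M f B" "fcalc T M g C"
  shows "fcalc T M (\<lambda>x. f x * g x) (B * C)"
proof -
  obtain p where p: "uniform_limit {-M..M} (\<lambda>n. poly (p n)) f sequentially"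
    "(\<lambda>n. peval (p n) T) \<longlonglongrightarrow> B" using assms(1) by (rule fcalcE)
  obtain q where q: "uniform_limit {-M..M} (\<lambda>n. poly (q n)) g sequentially"
    "(\<lambda>n. peval (q n) T) \<longlonglongrightarrow> C" using assms(2) by (rule fcalcE)
  have "uniform_limit {-M..M} (\<lambda>n x. poly (p n) x * poly (q n) x) (\<lambda>x. f x * g x) sequentially"
    by (intro bounded_bilinear.bounded_uniform_limit[OF bounded_bilinear_mult] p(1) q(1)
        fcalc_bounded[OF assms(1)] fcalc_bounded[OF assms(2)])
  then show ?thesis
    by (intro fcalcI[where p = "\<lambda>n. p n * q n"])
       (use tendsto_mult[OF p(2) q(2)] in \<open>simp_all add: times_poly_fun\<close>)
qed

lemma fcalc_scaleR: "fcalc T M f B \<Longrightarrow> fcalc T M (\<lambda>x. c * f x) (c *\<^sub>R B)"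
  using fcalc_mult[OF fcalc_const] by fastforce

lemma fcalc_minus: "fcalc T M f B \<Longrightarrow> fcalc T M (\<lambda>x. - f x) (- B)"
  using fcalc_scaleR[of T M f B "-1"] by simp

lemma fcalc_diff: "fcalc T M f B \<Longrightarrow> fcalc T M g C \<Longrightarrow> fcalc T M (\<lambda>x. f x - g x) (B - C)"
  using fcalc_add[OF _ fcalc_minus] by fastforce

lemma fcalc_adj:
  fixes T :: "'a::{real_inner, perfect_space} endo"
  assumes "fcalc T M f B" "adj T T"
  shows "adj B B"
  using assms by (metis fcalcE adj_limit adj_peval)

lemma fcalc_peval: "fcalc T M f B \<Longrightarrow> fcalc T M (\<lambda>x. poly p (f x)) (peval p B)"
  by (induction p) (auto intro!: fcalc_add fcalc_mult fcalc_const fcalc_0)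

lemma fcalc_norm_le:
  assumes "fcalc T M f B" and T: "adj T T" "norm T \<le> M" and S: "\<And>x. x \<in> {-M..M} \<Longrightarrow> \<bar>f x\<bar> \<le> S"
  shows "norm B \<le> S"
proof (rule field_le_epsilon)
  fix e :: real assume "e > 0"
  then obtain p where p: "\<forall>x\<in>{-M..M}. \<bar>poly p x - f x\<bar> < e / 2" "norm (peval p T - B) < e / 2"
    using assms(1) unfolding fcalc_def by (meson half_gt_zero)
  have "norm (peval p T) \<le> S + e / 2"
  proof (rule norm_peval_le[OF T])
    fix x assume x: "x \<in> {-M..M}"
    show "\<bar>poly p x\<bar> \<le> S + e / 2"
      using S[OF x] bspec[OF p(1) x] by linarith
  qed
  then show "norm B \<le> S + e"
    using p(2) norm_triangle_sub[of B "peval p T"] by (simp add: norm_minus_commute)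
qed

text \<open>The tool for operator identities: a scalar identity on \<open>[-M, M]\<close> transfers,
  because the difference of the operators is bounded in norm by the supremum
  \<open>0\<close>.\<close>

lemma fcalc_unique:
  assumes "fcalc T M f B" "fcalc T M g C" and T: "adj T T" "norm T \<le> M"
    and "\<And>x. x \<in> {-M..M} \<Longrightarrow> f x = g x"
  shows "B = C"
proof -
  have "norm (B - C) \<le> 0"
    by (rule fcalc_norm_le[OF fcalc_diff[OF assms(1,2)] T]) (use assms(5) in simp)
  then show ?thesis by simp
qed

text \<open>Weierstrass approximants of \<open>f\<close> are uniformly Cauchy on the interval, so
  \<open>norm_peval_le\<close> makes their values at \<open>T\<close> Cauchy in norm.\<close>

lemma fcalc_exists:
  fixes T :: "'a::{real_inner, banach, perfect_space} endo"
  assumes T: "adj T T" "norm T \<le> M" and f: "continuous_on {-M..M} f"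
  shows "\<exists>B. fcalc T M f B"
proof -
  have "\<exists>p. \<forall>x\<in>{-M..M}. \<bar>poly p x - f x\<bar> < inverse (Suc n)" for n
  proof -
    obtain g where g: "real_polynomial_function g" "\<And>x. x \<in> {-M..M} \<Longrightarrow> \<bar>f x - g x\<bar> < inverse (Suc n)"
      using Stone_Weierstrass_real_polynomial_function[OF _ f, of "inverse (Suc n)"] by auto
    then obtain a N where "g = (\<lambda>x. \<Sum>i\<le>N. a i * x ^ i)"
      by (auto simp: real_polynomial_function_iff_sum)
    then have "g = poly (\<Sum>i\<le>(N::nat). monom (a i) i)"
      by (simp add: fun_eq_iff poly_sum poly_monom)
    with g(2) show ?thesis
      by (metis abs_minus_commute)
  qed
  then obtain p where p: "\<And>n x. x \<in> {-M..M} \<Longrightarrow> \<bar>poly (p n) x - f x\<bar> < inverse (Suc n)"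
    by metis
  have diff: "norm (peval (p m) T - peval (p n) T) \<le> inverse (Suc m) + inverse (Suc n)" for m n
    using norm_peval_le[OF T, of "p m - p n" "inverse (Suc m) + inverse (Suc n)"] p[of _ m] p[of _ n]
    by fastforce
  have "Cauchy (\<lambda>n. peval (p n) T)"
  proof (rule metric_CauchyI)
    fix e :: real assume "e > 0"
    then obtain K where K: "inverse (real (Suc K)) < e / 2"
      using reals_Archimedean half_gt_zero by blast
    have "dist (peval (p m) T) (peval (p n) T) < e" if "m \<ge> K" "n \<ge> K" for m n
    proof -
      have "inverse (real (Suc m)) \<le> inverse (real (Suc K))" "inverse (real (Suc n)) \<le> inverse (real (Suc K))"
        using that by (auto intro: le_imp_inverse_le)
      with K diff[of m n] show ?thesis
        unfolding dist_norm by linarith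
    qed
    then show "\<exists>K. \<forall>m\<ge>K. \<forall>n\<ge>K. dist (peval (p m) T) (peval (p n) T) < e"
      by blast
  qed
  then obtain B where "(\<lambda>n. peval (p n) T) \<longlonglongrightarrow> B"
    using Cauchy_convergent_iff convergent_def by blast
  moreover have "uniform_limit {-M..M} (\<lambda>n. poly (p n)) f sequentially"
    by (rule uniform_limit_inverse_Suc[OF p])
  ultimately show ?thesis
    using fcalcI by blast
qed

text \<open>A polynomial \<open>p\<close> close to \<open>g\<close> on \<open>[-N, N]\<close> is
  applied to \<open>f\<close> by \<open>fcalc_peval\<close>; the range condition keeps
  \<open>poly p (f x)\<close> close to \<open>g (f x)\<close>.\<close>

lemma fcalc_comp:
  assumes "fcalc T M f B" "fcalc B N g C" "\<And>x. x \<in> {-M..M} \<Longrightarrow> f x \<in> {-N..N}"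
  shows "fcalc T M (\<lambda>x. g (f x)) C"
  unfolding fcalc_def
proof (intro allI impI)
  fix e :: real assume "e > 0"
  then obtain p where p: "\<forall>x\<in>{-N..N}. \<bar>poly p x - g x\<bar> < e / 2" "norm (peval p B - C) < e / 2"
    using assms(2) unfolding fcalc_def by (meson half_gt_zero)
  obtain q where q: "\<forall>x\<in>{-M..M}. \<bar>poly q x - poly p (f x)\<bar> < e / 2" "norm (peval q T - peval p B) < e / 2"
    using fcalc_peval[OF assms(1), of p] \<open>e > 0\<close> unfolding fcalc_def by (meson half_gt_zero)
  have "\<bar>poly q x - g (f x)\<bar> < e" if "x \<in> {-M..M}" for x
    using bspec[OF q(1) that] bspec[OF p(1) assms(3)[OF that]] by linarith
  moreover have "norm (peval q T - C) < e"
    using norm_triangle_ineq[of "peval q T - peval p B" "peval p B - C"] p(2) q(2) by simp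
  ultimately show "\<exists>p. (\<forall>x\<in>{-M..M}. \<bar>poly p x - g (f x)\<bar> < e) \<and> norm (peval p T - C) < e"
    by blast
qed

text \<open>The polynomials chosen for \<open>T\<close> are used at \<open>T'\<close> as well, where
  the norm bound makes them converge to \<open>B'\<close>; each of them is intertwined by
  \<open>A\<close>. The case \<open>T' = - T\<close> yields anticommutation relations.\<close>

lemma fcalc_intertwine:
  assumes "fcalc T M f B" "fcalc T' M f B'" and T': "adj T' T'" "norm T' \<le> M" and "A * T = T' * A"
  shows "A * B = B' * A"
proof -
  obtain p where p: "uniform_limit {-M..M} (\<lambda>n. poly (p n)) f sequentially"
    "(\<lambda>n. peval (p n) T) \<longlonglongrightarrow> B" using assms(1) by (rule fcalcE)
  have "(\<lambda>n. peval (p n) T') \<longlonglongrightarrow> B'"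
  proof (rule tendstoI)
    fix e :: real assume "e > 0"
    then have "\<forall>\<^sub>F n in sequentially. \<forall>x\<in>{- M..M}. dist (poly (p n) x) (f x) < e / 2"
      by (intro uniform_limitD[OF p(1)]) simp
    then show "\<forall>\<^sub>F n in sequentially. dist (peval (p n) T') B' < e"
    proof eventually_elim
      case (elim n)
      have "norm (peval (p n) T' - B') \<le> e / 2"
        by (rule fcalc_norm_le[OF fcalc_diff[OF fcalc_poly assms(2)] T'])
           (use elim in \<open>auto simp: dist_real_def less_imp_le\<close>)
      with \<open>e > 0\<close> show ?case by (simp add: dist_norm)
    qed
  qed
  then have "(\<lambda>n. peval (p n) T' * A) \<longlonglongrightarrow> B' * A"
    by (intro tendsto_intros)
  moreover have "(\<lambda>n. A * peval (p n) T) \<longlonglongrightarrow> A * B"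
    by (intro tendsto_intros p(2))
  ultimately show ?thesis
    using peval_intertwine[OF assms(5)] by (auto intro: LIMSEQ_unique)
qed

lemma fcalc_commute:
  assumes "fcalc T M f B" "A * T = T * A"
  shows "A * B = B * A"
proof -
  obtain p where p: "(\<lambda>n. peval (p n) T) \<longlonglongrightarrow> B" using assms(1) by (rule fcalcE)
  have "(\<lambda>n. peval (p n) T * A) \<longlonglongrightarrow> B * A" "(\<lambda>n. A * peval (p n) T) \<longlonglongrightarrow> A * B"
    by (intro tendsto_intros p)+
  then show ?thesis
    using peval_intertwine[OF assms(2)] by (auto intro: LIMSEQ_unique)
qed

text \<open>The partial sums converge uniformly on \<open>[-M, M]\<close> by the M-test and at
  \<open>T\<close> by assumption. This identifies \<open>cos T\<close> and \<open>sin T\<close>,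
  defined by series in the Banach algebra, as values of the calculus.\<close>

lemma fcalc_power_series:
  assumes "summable (\<lambda>n. \<bar>a n\<bar> * M ^ n)" and f: "\<And>x. (\<lambda>n. a n * x ^ n) sums f x"
    and B: "(\<lambda>n. a n *\<^sub>R T ^ n) sums B"
  shows "fcalc T M f B"
proof (rule fcalcI)
  have "uniform_limit {-M..M} (\<lambda>n x. \<Sum>i<n. a i * x ^ i) (\<lambda>x. suminf (\<lambda>i. a i * x ^ i)) sequentially"
  proof (rule Weierstrass_m_test[OF _ assms(1)])
    fix n x assume "x \<in> {-M..M}"
    then show "norm (a n * x ^ n) \<le> \<bar>a n\<bar> * M ^ n"
      by (auto simp: abs_mult power_abs intro!: mult_left_mono power_mono)
  qed
  moreover have "poly (\<Sum>i<n. monom (a i) i) = (\<lambda>x. \<Sum>i<n. a i * x ^ i)" for n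
    by (simp add: fun_eq_iff poly_sum poly_monom)
  ultimately show "uniform_limit {-M..M} (\<lambda>n. poly (\<Sum>i<n. monom (a i) i)) f sequentially"
    by (simp add: sums_unique[OF f, symmetric])
  show "(\<lambda>n. peval (\<Sum>i<n. monom (a i) i) T) \<longlonglongrightarrow> B"
    using B by (simp add: sums_def)
qed

lemma fcalc_cos: "0 \<le> M \<Longrightarrow> fcalc T M cos (cos T)"
  for T :: "'a::{real_inner, banach, perfect_space} endo"
  by (rule fcalc_power_series[where a = cos_coeff])
    (use summable_norm_cos[of M] cos_converges[where 'a = real] in \<open>simp_all add: abs_mult cos_converges\<close>)

lemma fcalc_sin: "0 \<le> M \<Longrightarrow> fcalc T M sin (sin T)"
  for T :: "'a::{real_inner, banach, perfect_space} endo"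
  by (rule fcalc_power_series[where a = sin_coeff])
    (use summable_norm_sin[of M] sin_converges[where 'a = real] in \<open>simp_all add: abs_mult sin_converges\<close>)

text \<open>Euler's formula: even powers of \<open>\<iota>\<close> are signs, odd powers are signs
  times \<open>\<iota>\<close>, and the powers of \<open>\<iota>\<close> can be collected because it
  commutes with \<open>T\<close>.\<close>

lemma exp_imaginary:
  fixes T \<iota> :: "'a::{real_normed_algebra_1, banach}"
  assumes \<iota>: "\<iota> * \<iota> = -1" and comm: "\<iota> * T = T * \<iota>"
  shows "exp (\<iota> * T) = cos T + \<iota> * sin T"
proof -
  have coeffs: "(\<iota> * T) ^ n /\<^sub>R fact n = cos_coeff n *\<^sub>R T ^ n + \<iota> * (sin_coeff n *\<^sub>R T ^ n)" for n
  proof -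
    have sq: "\<iota> ^ (2 * k) = (-1) ^ k" for k
      using \<iota> by (simp add: power_mult power2_eq_square)
    have "(\<iota> * T) ^ n = \<iota> ^ n * T ^ n"
    proof (induction n)
      case (Suc n)
      have "\<iota> * T * (\<iota> ^ n * T ^ n) = \<iota> * (T * \<iota> ^ n) * T ^ n"
        by (simp only: mult.assoc)
      also have "T * \<iota> ^ n = \<iota> ^ n * T"
        by (rule power_commuting_commutes[OF comm, symmetric])
      finally show ?case
        by (simp add: Suc mult.assoc)
    qed simp
    moreover have "\<iota> ^ n /\<^sub>R fact n = cos_coeff n *\<^sub>R 1 + sin_coeff n *\<^sub>R \<iota>"
    proof (cases "even n")
      case True
      then obtain k where k: "n = 2 * k" by blast
      have "\<iota> ^ n = (-1) ^ k *\<^sub>R 1"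
        unfolding k sq by (cases "even k") simp_all
      then show ?thesis
        by (simp add: k cos_coeff_def sin_coeff_def divide_inverse mult.commute)
    next
      case False
      then obtain k where k: "n = 2 * k + 1" by (elim oddE)
      have "\<iota> ^ n = (-1) ^ k *\<^sub>R \<iota>"
        unfolding k power_add sq by (cases "even k") simp_all
      then show ?thesis
        by (simp add: k cos_coeff_def sin_coeff_def divide_inverse mult.commute)
    qed
    ultimately show ?thesis
      by (metis (no_types, lifting) distrib_right mult_1 mult_scaleR_left mult_scaleR_right)
  qed
  have "(\<lambda>n. (\<iota> * T) ^ n /\<^sub>R fact n) sums (cos T + \<iota> * sin T)"
    unfolding coeffs
    by (intro sums_add sums_mult cos_converges sin_converges)
  then show ?thesis
    by (rule sums_unique2[OF exp_converges])
qed

section \<open>Orthogonal projection and extension of operators\<close>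

text \<open>The projection theorem: the parallelogram law makes a minimising sequence Cauchy, and
  its limit is a nearest point, from which no direction in \<open>S\<close> leads closer to
  \<open>x\<close>.\<close>

lemma orthogonal_decomposition:
  fixes S :: "'a::{real_inner, complete_space} set"
  assumes S: "subspace S" "closed S"
  shows "\<exists>p\<in>S. \<forall>s\<in>S. (x - p) \<bullet> s = 0"
proof -
  define d where "d = infdist x S"
  have ne: "S \<noteq> {}" using S subspace_0 by blast
  have d_le: "d \<le> norm (x - s)" if "s \<in> S" for s
    using infdist_le[OF that, of x] by (simp add: d_def dist_norm)
  have "d \<ge> 0" by (simp add: d_def infdist_nonneg)
  have "\<exists>s\<in>S. (norm (x - s))\<^sup>2 < d\<^sup>2 + inverse (Suc n)" for n
  proof -
    have "d < sqrt (d\<^sup>2 + inverse (Suc n))"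
      using \<open>d \<ge> 0\<close> by (intro real_less_rsqrt) simp
    then obtain s where s: "s \<in> S" "dist x s < sqrt (d\<^sup>2 + inverse (Suc n))"
      unfolding d_def infdist_def using ne by (auto simp: cINF_less_iff)
    then have "(norm (x - s))\<^sup>2 < (sqrt (d\<^sup>2 + inverse (Suc n)))\<^sup>2"
      by (intro power_strict_mono) (simp_all add: dist_norm)
    also have "\<dots> = d\<^sup>2 + inverse (Suc n)"
      by (rule real_sqrt_pow2) simp
    finally show ?thesis
      using s(1) by blast
  qed
  then obtain s where s: "\<And>n. s n \<in> S" "\<And>n. (norm (x - s n))\<^sup>2 < d\<^sup>2 + inverse (Suc n)"
    by metis
  have close: "(norm (s m - s n))\<^sup>2 \<le> 2 * (inverse (Suc m) + inverse (Suc n))" for m n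
  proof -
    have "(1 / 2) *\<^sub>R (s m + s n) \<in> S"
      using S(1) s(1) by (simp add: subspace_add subspace_scale)
    then have "d\<^sup>2 \<le> (norm (x - (1 / 2) *\<^sub>R (s m + s n)))\<^sup>2"
      using d_le \<open>d \<ge> 0\<close> by (simp add: power_mono)
    moreover have "(norm (s m - s n))\<^sup>2 + 4 * (norm (x - (1 / 2) *\<^sub>R (s m + s n)))\<^sup>2
        = 2 * (norm (x - s m))\<^sup>2 + 2 * (norm (x - s n))\<^sup>2"
      unfolding power2_norm_eq_inner
      by (simp add: inner_diff_left inner_diff_right inner_add_left inner_add_right inner_commute algebra_simps)
    ultimately show ?thesis
      using s(2)[of m] s(2)[of n] by argo
  qed
  have "Cauchy s"
  proof (rule metric_CauchyI)
    fix e :: real assume "e > 0"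
    then obtain K where K: "inverse (real (Suc K)) < e\<^sup>2 / 4"
      using reals_Archimedean[of "e\<^sup>2 / 4"] by auto
    have "dist (s m) (s n) < e" if "m \<ge> K" "n \<ge> K" for m n
    proof -
      have "inverse (real (Suc m)) \<le> inverse (real (Suc K))" "inverse (real (Suc n)) \<le> inverse (real (Suc K))"
        using that by (auto intro: le_imp_inverse_le)
      with K close[of m n] have "(norm (s m - s n))\<^sup>2 < e\<^sup>2"
        by argo
      then show ?thesis
        unfolding dist_norm using \<open>e > 0\<close> by (meson less_imp_le power_less_imp_less_base)
    qed
    then show "\<exists>K. \<forall>m\<ge>K. \<forall>n\<ge>K. dist (s m) (s n) < e" by blast
  qed
  then obtain p where p: "s \<longlonglongrightarrow> p"
    using Cauchy_convergent_iff convergent_def by blast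
  have "p \<in> S"
    using S(2) s(1) p by (rule closed_sequentially)
  have "(\<lambda>n. d\<^sup>2 + inverse (real (Suc n))) \<longlonglongrightarrow> d\<^sup>2 + 0"
    by (intro tendsto_intros LIMSEQ_inverse_real_of_nat)
  moreover have "(\<lambda>n. (norm (x - s n))\<^sup>2) \<longlonglongrightarrow> (norm (x - p))\<^sup>2"
    by (intro tendsto_intros p)
  ultimately have np: "(norm (x - p))\<^sup>2 \<le> d\<^sup>2"
    using LIMSEQ_le[of "\<lambda>n. (norm (x - s n))\<^sup>2" _ "\<lambda>n. d\<^sup>2 + inverse (real (Suc n))" "d\<^sup>2 + 0"] s(2)
    by (auto simp: less_imp_le)
  have "(x - p) \<bullet> t = 0" if t: "t \<in> S" for t
  proof (cases "t = 0")
    case False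
    \<comment> \<open>The best step along \<open>t\<close>; it would lower the squared distance by
      \<open>((x - p) \<bullet> t)\<^sup>2 / (t \<bullet> t)\<close>.\<close>
    define r where "r = ((x - p) \<bullet> t) / (t \<bullet> t)"
    have "p + r *\<^sub>R t \<in> S"
      using S(1) \<open>p \<in> S\<close> t by (simp add: subspace_add subspace_scale)
    then have "d\<^sup>2 \<le> (norm (x - (p + r *\<^sub>R t)))\<^sup>2"
      using d_le \<open>d \<ge> 0\<close> by (simp add: power_mono)
    also have "\<dots> = (norm ((x - p) - r *\<^sub>R t))\<^sup>2"
      by (simp add: algebra_simps)
    also have "\<dots> = (norm (x - p))\<^sup>2 - 2 * r * ((x - p) \<bullet> t) + r\<^sup>2 * (t \<bullet> t)"
      unfolding power2_norm_eq_inner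
      by (simp add: inner_diff_left inner_diff_right inner_commute power2_eq_square algebra_simps)
    also have "\<dots> = (norm (x - p))\<^sup>2 - ((x - p) \<bullet> t)\<^sup>2 / (t \<bullet> t)"
      using False by (simp add: r_def field_simps power2_eq_square)
    finally have "((x - p) \<bullet> t)\<^sup>2 / (t \<bullet> t) \<le> 0"
      using np by linarith
    moreover have "0 < t \<bullet> t"
      using False by simp
    ultimately have "((x - p) \<bullet> t)\<^sup>2 \<le> 0 * (t \<bullet> t)"
      using pos_divide_le_eq by blast
    then show ?thesis
      by simp
  qed simp
  with \<open>p \<in> S\<close> show ?thesis by blast
qed

lemma subspace_closure:
  fixes S :: "'a::real_normed_vector set"
  assumes "subspace S"
  shows "subspace (closure S)"
proof (rule subspaceI)
  show "0 \<in> closure S"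
    using assms closure_subset subspace_0 by blast
next
  fix x y assume "x \<in> closure S" "y \<in> closure S"
  then obtain u v where "\<And>n. u n \<in> S" "u \<longlonglongrightarrow> x" "\<And>n. v n \<in> S" "v \<longlonglongrightarrow> y"
    unfolding closure_sequential by blast
  then show "x + y \<in> closure S"
    unfolding closure_sequential using assms
    by (intro exI[of _ "\<lambda>n. u n + v n"]) (auto intro: tendsto_add subspace_add)
next
  fix c x assume "x \<in> closure S"
  then obtain u where "\<And>n. u n \<in> S" "u \<longlonglongrightarrow> x"
    unfolding closure_sequential by blast
  then show "c *\<^sub>R x \<in> closure S"
    unfolding closure_sequential using assms
    by (intro exI[of _ "\<lambda>n. c *\<^sub>R u n"]) (auto intro: tendsto_scaleR subspace_scale)
qed

text \<open>The orthogonal complement of the range of a symmetric operator is its kernel.\<close>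

lemma dense_range_symmetric:
  fixes C :: "'a::{real_inner, complete_space, perfect_space} endo"
  assumes C: "adj C C" and inj: "\<And>x. C \<cdot> x = 0 \<Longrightarrow> x = 0"
  shows "closure (range (app C)) = UNIV"
proof -
  have "linear (app C)"
    by (rule linearI) simp_all
  then have sub: "subspace (closure (range (app C)))"
    by (intro subspace_closure linear_subspace_image subspace_UNIV)
  have "x \<in> closure (range (app C))" for x
  proof -
    obtain p where p: "p \<in> closure (range (app C))"
      "\<And>s. s \<in> closure (range (app C)) \<Longrightarrow> (x - p) \<bullet> s = 0"
      using orthogonal_decomposition[OF sub closed_closure, of x] by blast
    have "(C \<cdot> (x - p)) \<bullet> y = 0" for y
    proof -
      have "C \<cdot> y \<in> closure (range (app C))"
        by (rule subsetD[OF closure_subset]) simp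
      then show ?thesis
        using p(2) C by (simp only: adj_def)
    qed
    then have "C \<cdot> (x - p) = 0"
      by (metis inner_eq_zero_iff)
    then have "x - p = 0"
      by (rule inj)
    with p(1) show ?thesis by simp
  qed
  then show ?thesis by blast
qed

lemma endo_eq_on_dense_range:
  fixes A B C :: "'a::{real_inner, complete_space, perfect_space} endo"
  assumes eq: "A * C = B * C" and dense: "closure (range (app C)) = UNIV"
  shows "A = B"
proof (rule endo_eqI)
  fix x
  obtain u where u: "\<And>n. u n \<in> range (app C)" "u \<longlonglongrightarrow> x"
    using dense closure_sequential by (metis UNIV_I)
  have "A \<cdot> y = B \<cdot> y" if "y \<in> range (app C)" for y
    using that arg_cong[OF eq, of "\<lambda>A. A \<cdot> _"] by auto
  then have "(\<lambda>n. A \<cdot> u n) = (\<lambda>n. B \<cdot> u n)"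
    using u(1) by auto
  moreover have "(\<lambda>n. A \<cdot> u n) \<longlonglongrightarrow> A \<cdot> x" "(\<lambda>n. B \<cdot> u n) \<longlonglongrightarrow> B \<cdot> x"
    by (intro tendsto_app tendsto_const u(2))+
  ultimately show "A \<cdot> x = B \<cdot> x"
    by (simp add: LIMSEQ_unique)
qed

lemma adj_on_dense_range:
  fixes A B C :: "'a::{real_inner, perfect_space} endo"
  assumes eq: "\<And>x y. (A \<cdot> C \<cdot> x) \<bullet> (C \<cdot> y) = (C \<cdot> x) \<bullet> (B \<cdot> C \<cdot> y)"
    and dense: "closure (range (app C)) = UNIV"
  shows "adj A B"
proof -
  have cont: "continuous_on UNIV (app A)" for A :: "'a endo"
    by (intro linear_continuous_on bounded_bilinear.bounded_linear_right[OF bounded_bilinear_app])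
  have *: "(A \<cdot> x) \<bullet> (C \<cdot> y) = x \<bullet> (B \<cdot> C \<cdot> y)" for x y
  proof -
    have "closed {x. (A \<cdot> x) \<bullet> (C \<cdot> y) = x \<bullet> (B \<cdot> C \<cdot> y)}"
      by (intro closed_Collect_eq continuous_intros cont)
    then have "closure (range (app C)) \<subseteq> {x. (A \<cdot> x) \<bullet> (C \<cdot> y) = x \<bullet> (B \<cdot> C \<cdot> y)}"
      using eq by (intro closure_minimal) auto
    with dense show ?thesis by auto
  qed
  have "(A \<cdot> x) \<bullet> y = x \<bullet> (B \<cdot> y)" for x y
  proof -
    have "closed {y. (A \<cdot> x) \<bullet> y = x \<bullet> (B \<cdot> y)}"
      by (intro closed_Collect_eq continuous_intros cont)
    then have "closure (range (app C)) \<subseteq> {y. (A \<cdot> x) \<bullet> y = x \<bullet> (B \<cdot> y)}"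
      using * by (intro closure_minimal) auto
    with dense show ?thesis by auto
  qed
  then show ?thesis by (simp add: adj_def)
qed

text \<open>Douglas factorisation: the bound makes the map from \<open>C \<cdot> x\<close> to
  \<open>A \<cdot> x\<close> well defined and bounded, so it extends continuously from the dense
  range of \<open>C\<close>.\<close>

lemma factor_through_dense:
  fixes A C :: "'a::{real_inner, complete_space, perfect_space} endo"
  assumes le: "\<And>x. norm (A \<cdot> x) \<le> k * norm (C \<cdot> x)" and "0 \<le> k"
    and dense: "closure (range (app C)) = UNIV"
  obtains S where "S * C = A" "norm S \<le> k"
proof -
  \<comment> \<open>The closure of the graph of the map from \<open>C \<cdot> x\<close> to
    \<open>A \<cdot> x\<close>. Density and the bound make it total, the bound alone makes it
    single-valued.\<close>
  define G where "G y z \<longleftrightarrow> (\<exists>u. (\<lambda>n. C \<cdot> u n) \<longlonglongrightarrow> y \<and> (\<lambda>n. A \<cdot> u n) \<longlonglongrightarrow> z)" for y z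
  have total: "\<exists>z. G y z" for y
  proof -
    obtain v where v: "\<And>n. v n \<in> range (app C)" "v \<longlonglongrightarrow> y"
      using dense closure_sequential by (metis UNIV_I)
    then have "\<forall>n. \<exists>x. v n = C \<cdot> x"
      by blast
    then obtain u where "\<forall>n. v n = C \<cdot> u n"
      by (rule choice[THEN exE])
    then have "v = (\<lambda>n. C \<cdot> u n)"
      by blast
    with v(2) have lim: "(\<lambda>n. C \<cdot> u n) \<longlonglongrightarrow> y"
      by simp
    have "Cauchy (\<lambda>n. A \<cdot> u n)"
    proof (rule metric_CauchyI)
      fix e :: real assume "e > 0"
      \<comment> \<open>The \<open>+ 1\<close> covers the case \<open>k = 0\<close>.\<close>
      then have "e / (k + 1) > 0"
        using \<open>0 \<le> k\<close> by simp
      from metric_CauchyD[OF LIMSEQ_imp_Cauchy[OF lim] this]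
      obtain K where K: "\<forall>m\<ge>K. \<forall>n\<ge>K. dist (C \<cdot> u m) (C \<cdot> u n) < e / (k + 1)"
        by blast
      have "dist (A \<cdot> u m) (A \<cdot> u n) < e" if "m \<ge> K" "n \<ge> K" for m n
      proof -
        have "dist (A \<cdot> u m) (A \<cdot> u n) \<le> k * dist (C \<cdot> u m) (C \<cdot> u n)"
          using le[of "u m - u n"] by (simp add: dist_norm)
        also have "\<dots> \<le> k * (e / (k + 1))"
          using K that \<open>0 \<le> k\<close> by (intro mult_left_mono) (auto simp: less_imp_le)
        also have "\<dots> < e"
          using \<open>0 \<le> k\<close> \<open>e > 0\<close> by (simp add: field_simps)
        finally show ?thesis .
      qed
      then show "\<exists>K. \<forall>m\<ge>K. \<forall>n\<ge>K. dist (A \<cdot> u m) (A \<cdot> u n) < e" by blast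
    qed
    then obtain z where "(\<lambda>n. A \<cdot> u n) \<longlonglongrightarrow> z"
      using Cauchy_convergent_iff convergent_def by blast
    with lim show ?thesis
      unfolding G_def by blast
  qed
  have bound: "norm z \<le> k * norm y" if "G y z" for y z
  proof -
    from that obtain u where "(\<lambda>n. C \<cdot> u n) \<longlonglongrightarrow> y" "(\<lambda>n. A \<cdot> u n) \<longlonglongrightarrow> z"
      unfolding G_def by blast
    then have "(\<lambda>n. k * norm (C \<cdot> u n)) \<longlonglongrightarrow> k * norm y" "(\<lambda>n. norm (A \<cdot> u n)) \<longlonglongrightarrow> norm z"
      by (auto intro!: tendsto_intros)
    then show ?thesis
      using le by (intro LIMSEQ_le) auto
  qed
  have lin: "G (a *\<^sub>R y + y') (a *\<^sub>R z + z')" if "G y z" "G y' z'" for a y z y' z'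
  proof -
    from that obtain u u' where "(\<lambda>n. C \<cdot> u n) \<longlonglongrightarrow> y" "(\<lambda>n. A \<cdot> u n) \<longlonglongrightarrow> z"
      "(\<lambda>n. C \<cdot> u' n) \<longlonglongrightarrow> y'" "(\<lambda>n. A \<cdot> u' n) \<longlonglongrightarrow> z'"
      unfolding G_def by blast
    then show ?thesis
      unfolding G_def by (intro exI[of _ "\<lambda>n. a *\<^sub>R u n + u' n"]) (auto intro!: tendsto_intros)
  qed
  have unique: "z = z'" if "G y z" "G y z'" for y z z'
    using bound[OF lin[OF that, of "-1"]] by simp
  define f where "f y = (SOME z. G y z)" for y
  have Gf: "G y (f y)" for y
    unfolding f_def using total by (rule someI_ex)
  have f_lin: "f (a *\<^sub>R y + y') = a *\<^sub>R f y + f y'" for a y y'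
    using lin[OF Gf Gf] Gf unique by blast
  have G0: "G 0 0"
    unfolding G_def by (intro exI[of _ "\<lambda>_. 0"]) simp
  then have f0: "f 0 = 0"
    using Gf unique by blast
  have "bounded_linear f"
  proof (rule bounded_linear_intro)
    show "f (x + y) = f x + f y" for x y
      using f_lin[of 1 x y] by simp
    show "f (r *\<^sub>R x) = r *\<^sub>R f x" for r x
      using f_lin[of r x 0] f0 by simp
    show "norm (f x) \<le> norm x * k" for x
      using bound[OF Gf] by (simp add: mult.commute)
  qed
  then obtain S where S: "\<And>x. S \<cdot> x = f x"
    using bounded_linear_endo by blast
  show ?thesis
  proof
    have "G (C \<cdot> x) (A \<cdot> x)" for x
      unfolding G_def by (intro exI[of _ "\<lambda>_. x"]) simp
    then have "f (C \<cdot> x) = A \<cdot> x" for x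
      using Gf unique by blast
    then show "S * C = A"
      by (intro endo_eqI) (simp add: S)
    show "norm S \<le> k"
      using \<open>0 \<le> k\<close> bound[OF Gf] by (intro norm_endo_bound) (simp_all add: S)
  qed
qed

section \<open>Pairs of symmetries\<close>

text \<open>Complex Hilbert spaces are treated as real ones with a skew-adjoint complex structure \<open>\<iota>\<close>;
  the symmetries \<open>R\<^sub>1 = 2P - 1\<close> and \<open>R\<^sub>2 = 2Q - 1\<close> encode the projections \<open>P\<close> and \<open>Q\<close>.\<close>

locale symmetry_pair =
  fixes \<iota> R1 R2 :: "'a::{real_inner, banach, perfect_space} endo"
  assumes \<iota>: "\<iota> * \<iota> = -1" "adj \<iota> (- \<iota>)"
    and R1: "R1 * R1 = 1" "adj R1 R1" "\<iota> * R1 = R1 * \<iota>"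
    and R2: "R2 * R2 = 1" "adj R2 R2" "\<iota> * R2 = R2 * \<iota>"
begin

text \<open>For a generator \<open>X\<close> as defined below, \<open>W = e\<^sup>2\<^sup>i\<^sup>X\<close> with adjoint \<open>W'\<close>, \<open>c = cos 2X\<close>, \<open>K = sin 2X\<close>,
  and later \<open>C = cos X\<close>.\<close>

definition W where "W = R2 * R1"
definition W' where "W' = R1 * R2"
definition c where "c = (1/2) *\<^sub>R (W + W')"
definition K where "K = (1/2) *\<^sub>R (\<iota> * (W' - W))"

definition generator where
  "generator X \<longleftrightarrow> adj X X \<and> \<iota> * X = X * \<iota> \<and> R1 * X = - (X * R1) \<and> norm X \<le> pi / 2 \<and>
     exp (2 *\<^sub>R (\<iota> * X)) = W"

lemma cancel: "\<iota> * (\<iota> * A) = - A" "R1 * (R1 * A) = A" "R2 * (R2 * A) = A"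
  by (simp_all add: \<iota> R1 R2 flip: mult.assoc)

lemma \<iota>_comm: "R1 * (\<iota> * A) = \<iota> * (R1 * A)" "R2 * (\<iota> * A) = \<iota> * (R2 * A)"
  by (simp_all add: R1(3) R2(3) flip: mult.assoc)

lemmas pair_simps = cancel \<iota>_comm \<iota>(1) R1(1) R2(1) R1(3)[symmetric] R2(3)[symmetric] mult.assoc
  distrib_left distrib_right left_diff_distrib right_diff_distrib

lemma WW': "W * W' = 1" "W' * W = 1"
  by (simp_all add: W_def W'_def pair_simps)

lemma adj_W: "adj W W'" "adj W' W"
  unfolding W_def W'_def by (intro adj_mult R1 R2)+

lemma norm_W: "norm W \<le> 1" "norm W' \<le> 1"
  using adj_isometry[OF adj_W(1) WW'(2)] adj_isometry[OF adj_W(2) WW'(1)]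
  by (auto intro: norm_endo_bound)

lemma adj_c: "adj c c"
  unfolding c_def using adj_scaleR[OF adj_add[OF adj_W]] by (simp add: add.commute)

lemma adj_K: "adj K K"
proof -
  have "adj (\<iota> * (W' - W)) ((W - W') * - \<iota>)"
    by (intro adj_mult adj_diff adj_W \<iota>)
  moreover have "(W - W') * - \<iota> = \<iota> * (W' - W)"
    by (simp add: W_def W'_def pair_simps)
  ultimately show ?thesis
    unfolding K_def by (auto intro: adj_scaleR)
qed

lemma norm_c: "norm c \<le> 1"
  unfolding c_def using norm_triangle_ineq[of W W'] norm_W by simp

lemma W_eq: "W = c + \<iota> * K"
proof -
  have "c + \<iota> * K = (1/2) *\<^sub>R (W + W) "
    by (simp add: c_def K_def pair_simps scaleR_right_distrib scaleR_diff_right)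
  then show ?thesis
    by (simp add: scaleR_add_left[symmetric] scaleR_right_distrib)
qed

lemma c_commute: "R1 * c = c * R1" "\<iota> * c = c * \<iota>" "K * c = c * K"
  by (simp_all add: c_def K_def W_def W'_def pair_simps scaleR_right_distrib scaleR_right_diff_distrib)

lemma K_commute: "R1 * K = - (K * R1)" "\<iota> * K = K * \<iota>"
  by (simp_all add: K_def W_def W'_def pair_simps scaleR_right_diff_distrib)

text \<open>The operator form of \<open>sin\<^sup>2 = (1 - cos) * (1 + cos)\<close>, kept factored
  because \<open>1 + c\<close> is \<open>2 *\<^sub>R (C * C)\<close>.\<close>

lemma K_squared: "K * K = (1 - c) * (1 + c)"
proof -
  have "K * K + c * c = (1/4) *\<^sub>R 1 + (1/4) *\<^sub>R 1 + ((1/4) *\<^sub>R 1 + (1/4) *\<^sub>R 1)"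
    by (simp add: K_def c_def W_def W'_def pair_simps scaleR_right_distrib scaleR_right_diff_distrib)
  also have "\<dots> = 1"
    by (simp flip: scaleR_add_left)
  finally show ?thesis
    by (simp add: algebra_simps)
qed

definition C where "C = (SOME C. fcalc c 1 (\<lambda>u. sqrt ((1 + u) / 2)) C)"

lemma C: "fcalc c 1 (\<lambda>u. sqrt ((1 + u) / 2)) C"
  unfolding C_def
  by (rule someI_ex, rule fcalc_exists[OF adj_c norm_c]) (intro continuous_intros; simp)

lemma adj_C: "adj C C"
  by (rule fcalc_adj[OF C adj_c])

lemma C_squared: "C * C = (1/2) *\<^sub>R (1 + c)"
proof (rule fcalc_unique[OF fcalc_mult[OF C C] _ adj_c norm_c])
  show "fcalc c 1 (\<lambda>u. (1/2) * (1 + u)) ((1/2) *\<^sub>R (1 + c))"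
    using fcalc_scaleR[OF fcalc_add[OF fcalc_const fcalc_id], of c 1 "1/2" 1] by simp
qed auto

lemma C_commute: "R1 * C = C * R1" "\<iota> * C = C * \<iota>" "K * C = C * K"
  using C c_commute by (auto intro: fcalc_commute)

lemma cos_double_arcsin: "\<bar>s\<bar> \<le> 1 \<Longrightarrow> cos (2 * arcsin s) = 1 - 2 * s\<^sup>2"
  and sin_double_arcsin: "\<bar>s\<bar> \<le> 1 \<Longrightarrow> sin (2 * arcsin s) = 2 * (s * sqrt (1 - s\<^sup>2))"
  by (auto simp: cos_double_sin sin_double cos_arcsin abs_le_iff minus_le_iff)

lemma exp_double: "\<iota> * X = X * \<iota> \<Longrightarrow> exp (2 *\<^sub>R (\<iota> * X)) = cos (2 *\<^sub>R X) + \<iota> * sin (2 *\<^sub>R X)"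
  by (subst exp_imaginary[OF \<iota>(1), symmetric]) simp_all

section \<open>Existence and uniqueness of the generator when \<open>-1\<close> is not an eigenvalue
  of \<open>W\<close>\<close>

context
  assumes no_fixed: "\<And>x. W \<cdot> x = - x \<Longrightarrow> x = 0"
begin

text \<open>From \<open>C \<cdot> x = 0\<close> follows \<open>c \<cdot> x = - x\<close>, so the
  inner product of \<open>W \<cdot> x\<close> with \<open>x\<close> is minus the square of
  \<open>norm x\<close>. As \<open>W\<close> is isometric, this is equality in Cauchy-Schwarz and
  forces \<open>W \<cdot> x = - x\<close>.\<close>

lemma C_injective:
  assumes "C \<cdot> x = 0"
  shows "x = 0"
proof -
  have "(C * C) \<cdot> x = 0"
    using assms by simp
  then have "x + c \<cdot> x = 0"
    unfolding C_squared by simp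
  then have "x \<bullet> x + (c \<cdot> x) \<bullet> x = 0"
    by (metis inner_add_left inner_zero_left)
  moreover have "(W' \<cdot> x) \<bullet> x = (W \<cdot> x) \<bullet> x"
    using adj_W(2) by (simp add: adj_def inner_commute)
  then have "(c \<cdot> x) \<bullet> x = (W \<cdot> x) \<bullet> x"
    by (simp add: c_def inner_add_left)
  ultimately have 1: "x \<bullet> x + (W \<cdot> x) \<bullet> x = 0"
    by simp
  have "(W \<cdot> x) \<bullet> (W \<cdot> x) = x \<bullet> x"
    using adj_isometry[OF adj_W(1) WW'(2), of x] by (metis power2_norm_eq_inner)
  with 1 have "(W \<cdot> x + x) \<bullet> (W \<cdot> x + x) = 0"
    by (simp add: inner_add_left inner_add_right inner_commute)
  then show ?thesis
    by (intro no_fixed) (simp add: eq_neg_iff_add_eq_0)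
qed

lemma C_dense: "closure (range (app C)) = UNIV"
  using dense_range_symmetric[OF adj_C C_injective] .

lemma cancel_C: "A * C = B * C \<Longrightarrow> A = B"
  using endo_eq_on_dense_range C_dense by blast

text \<open>\<open>W'\<close> is the inverse of \<open>W\<close>, hence the exponential with the
  opposite sign; the two Euler formulas for \<open>W\<close> and \<open>W'\<close> are then solved
  for cosine and sine.\<close>

lemma cos_sin_double_generator:
  assumes "generator X"
  shows "cos (2 *\<^sub>R X) = c" "sin (2 *\<^sub>R X) = K"
proof -
  have X: "\<iota> * X = X * \<iota>" "exp (2 *\<^sub>R (\<iota> * X)) = W"
    using assms by (auto simp: generator_def)
  have "exp (- (2 *\<^sub>R (\<iota> * X))) * (W * W') = W'"
    using exp_minus_inverse[of "- (2 *\<^sub>R (\<iota> * X))"] X(2) by (simp flip: mult.assoc)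
  then have W'_eq: "exp (- (2 *\<^sub>R (\<iota> * X))) = W'"
    by (simp add: WW')
  have 1: "W = cos (2 *\<^sub>R X) + \<iota> * sin (2 *\<^sub>R X)"
    using exp_double[OF X(1)] X(2) by simp
  have "W' = cos (2 *\<^sub>R X) - \<iota> * sin (2 *\<^sub>R X)"
    using exp_double[of "- X"] X(1) W'_eq by (simp add: cos_minus sin_minus)
  with 1 have "W + W' = cos (2 *\<^sub>R X) + cos (2 *\<^sub>R X)"
    by simp
  then show c: "cos (2 *\<^sub>R X) = c"
    unfolding c_def by (simp add: scaleR_right_distrib flip: scaleR_add_left)
  with 1 have "\<iota> * (\<iota> * sin (2 *\<^sub>R X)) = \<iota> * (\<iota> * K)"
    by (simp add: W_eq)
  then show "sin (2 *\<^sub>R X) = K"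
    by (simp add: cancel)
qed

text \<open>All operators are read in the calculus of \<open>X\<close> on
  \<open>[-pi/2, pi/2]\<close>. There \<open>cos\<close> is nonnegative, so the positive root
  \<open>C\<close> is \<open>cos X\<close>, and the claim is the double angle formula for
  \<open>sin\<close>.\<close>

lemma sin_generator:
  assumes "generator X"
  shows "sin X * C = (1/2) *\<^sub>R K"
proof -
  have adj_X: "adj X X" "norm X \<le> pi / 2"
    using assms by (auto simp: generator_def)
  have double: "fcalc X (pi / 2) (\<lambda>x. 2 * x) (2 *\<^sub>R X)"
    by (intro fcalc_scaleR fcalc_id)
  have fc: "fcalc X (pi / 2) (\<lambda>x. cos (2 * x)) c"
    using fcalc_comp[OF double fcalc_cos, of pi] cos_sin_double_generator[OF assms] by auto
  have fK: "fcalc X (pi / 2) (\<lambda>x. sin (2 * x)) K"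
    using fcalc_comp[OF double fcalc_sin, of pi] cos_sin_double_generator[OF assms] by auto
  have "fcalc X (pi / 2) (\<lambda>x. sqrt ((1 + cos (2 * x)) / 2)) C"
    by (rule fcalc_comp[OF fc C]) auto
  then have fC: "fcalc X (pi / 2) cos C"
  proof (rule fcalc_cong)
    fix x assume "x \<in> {- (pi / 2)..pi / 2}"
    then show "sqrt ((1 + cos (2 * x)) / 2) = cos x"
      by (simp add: cos_double_cos cos_ge_zero)
  qed
  have fS: "fcalc X (pi / 2) sin (sin X)"
    by (rule fcalc_sin) simp
  show ?thesis
    by (rule fcalc_unique[OF fcalc_mult[OF fS fC] fcalc_scaleR[OF fK] adj_X])
      (simp add: sin_double)
qed

text \<open>Here the bound \<open>pi / 2\<close> on the norm enters: it is the range on which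
  \<open>arcsin\<close> inverts \<open>sin\<close>.\<close>

lemma generator_eq_arcsin:
  assumes X: "generator X" and Z: "fcalc (sin X) 1 arcsin Z"
  shows "Z = X"
proof -
  have adj_X: "adj X X" "norm X \<le> pi / 2"
    using X by (auto simp: generator_def)
  have fS: "fcalc X (pi / 2) sin (sin X)"
    by (rule fcalc_sin) simp
  have "fcalc X (pi / 2) (\<lambda>x. arcsin (sin x)) Z"
    using fcalc_comp[OF fS Z] by simp
  then show ?thesis
    by (rule fcalc_unique[OF _ fcalc_id adj_X]) (simp add: arcsin_sin)
qed

text \<open>By \<open>sin_generator\<close> the product \<open>sin X * C\<close> is the same for all
  generators, and \<open>C\<close> cancels on the right because its range is dense.\<close>

lemma generator_unique:
  assumes X: "generator X" and Y: "generator Y"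
  shows "X = Y"
proof -
  have adj_X: "adj X X" "norm X \<le> pi / 2"
    using X by (auto simp: generator_def)
  have fS: "fcalc X (pi / 2) sin (sin X)"
    by (rule fcalc_sin) simp
  have "sin X = sin Y"
    by (rule cancel_C) (simp add: sin_generator X Y)
  moreover have "adj (sin X) (sin X)" "norm (sin X) \<le> 1"
    using fcalc_adj[OF fS adj_X(1)] fcalc_norm_le[OF fS adj_X] by auto
  then obtain Z where "fcalc (sin X) 1 arcsin Z"
    using fcalc_exists[of "sin X" 1 arcsin] continuous_on_arcsin' by auto
  ultimately show ?thesis
    using generator_eq_arcsin[OF X] generator_eq_arcsin[OF Y] by metis
qed

text \<open>The uniqueness computation run backwards: \<open>S\<close> with
  \<open>S * C = (1/2) *\<^sub>R K\<close> is the future \<open>sin X\<close>, and \<open>X\<close>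
  is \<open>arcsin\<close> of it.\<close>

lemma generator_exists: "\<exists>X. generator X"
proof -
  \<comment> \<open>The operator \<open>4 *\<^sub>R (C * C) - K * K\<close> is the square of
    \<open>1 + c\<close>, hence has a nonnegative form. The resulting bound \<open>1\<close> for
    \<open>norm S\<close> is the domain of \<open>arcsin\<close>.\<close>
  have "norm (((1/2) *\<^sub>R K) \<cdot> x) \<le> 1 * norm (C \<cdot> x)" for x
  proof -
    have K2: "(K \<cdot> x) \<bullet> (K \<cdot> x) = x \<bullet> ((K * K) \<cdot> x)"
      using adj_K by (simp add: adj_def)
    have C2: "(C \<cdot> x) \<bullet> (C \<cdot> x) = x \<bullet> ((C * C) \<cdot> x)"
      using adj_C by (simp add: adj_def)
    have c2: "(c \<cdot> x) \<bullet> (c \<cdot> x) = x \<bullet> (c \<cdot> c \<cdot> x)"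
      using adj_c by (simp add: adj_def)
    have "4 * ((C \<cdot> x) \<bullet> (C \<cdot> x)) - (K \<cdot> x) \<bullet> (K \<cdot> x) = (x + c \<cdot> x) \<bullet> (x + c \<cdot> x)"
      unfolding K2 C2 C_squared K_squared
      by (simp add: inner_simps c2 inner_commute[of "c \<cdot> x" x] algebra_simps)
    then have "(K \<cdot> x) \<bullet> (K \<cdot> x) \<le> 4 * ((C \<cdot> x) \<bullet> (C \<cdot> x))"
      using inner_ge_zero[of "x + c \<cdot> x"] by linarith
    then have "(norm (K \<cdot> x))\<^sup>2 \<le> (2 * norm (C \<cdot> x))\<^sup>2"
      by (simp add: power2_norm_eq_inner power_mult_distrib)
    then have "norm (K \<cdot> x) \<le> 2 * norm (C \<cdot> x)"
      by (rule power2_le_imp_le) simp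
    then show ?thesis by simp
  qed
  then obtain S where S: "S * C = (1/2) *\<^sub>R K" and norm_S: "norm S \<le> 1"
    using factor_through_dense[OF _ _ C_dense, of "(1/2) *\<^sub>R K" 1] by auto
  \<comment> \<open>\<open>S\<close> is explicit only on the range of \<open>C\<close>. Each
    algebraic identity for it is therefore shown after right multiplication by \<open>C\<close>,
    where it becomes one about \<open>K\<close> and \<open>C\<close>, and \<open>C\<close> is then
    cancelled.\<close>
  have SC: "S * C = C * S"
    by (rule cancel_C) (simp add: S C_commute mult.assoc)
  have S_apply: "S \<cdot> C \<cdot> x = (1/2) *\<^sub>R (K \<cdot> x)" for x
    using arg_cong[OF S, of "\<lambda>A. A \<cdot> x"] by simp
  have adj_S: "adj S S"
  proof (rule adj_on_dense_range[OF _ C_dense])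
    fix x y
    have "(K \<cdot> x) \<bullet> (C \<cdot> y) = x \<bullet> ((K * C) \<cdot> y)"
      using adj_K by (simp add: adj_def)
    also have "\<dots> = (C \<cdot> x) \<bullet> (K \<cdot> y)"
      using adj_C by (simp add: adj_def C_commute)
    finally show "(S \<cdot> C \<cdot> x) \<bullet> (C \<cdot> y) = (C \<cdot> x) \<bullet> (S \<cdot> C \<cdot> y)"
      by (simp add: S_apply)
  qed
  have S2: "S * S = (1/2) *\<^sub>R (1 - c)"
  proof -
    have "S * S * C * C = S * (S * C) * C"
      by (simp add: mult.assoc)
    also have "\<dots> = S * (C * S) * C"
      by (simp only: SC)
    also have "\<dots> = (S * C) * (S * C)"
      by (simp only: mult.assoc)
    also have "\<dots> = (1/2) *\<^sub>R (1 - c) * ((1/2) *\<^sub>R (1 + c))"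
      unfolding S using K_squared by simp
    also have "\<dots> = (1/2) *\<^sub>R (1 - c) * C * C"
      by (simp add: C_squared mult.assoc)
    finally show ?thesis
      by (rule cancel_C[OF cancel_C])
  qed
  have R1_S: "R1 * S = (- S) * R1"
  proof (rule cancel_C)
    have "R1 * S * C = (1/2) *\<^sub>R (R1 * K)"
      by (simp add: S mult.assoc)
    also have "\<dots> = - (S * C * R1)"
      by (simp add: S K_commute)
    finally show "R1 * S * C = (- S) * R1 * C"
      by (simp add: C_commute mult.assoc)
  qed
  have \<iota>_S: "\<iota> * S = S * \<iota>"
  proof (rule cancel_C)
    have "\<iota> * S * C = (1/2) *\<^sub>R (\<iota> * K)"
      by (simp add: S mult.assoc)
    also have "\<dots> = S * C * \<iota>"
      by (simp add: S K_commute)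
    finally show "\<iota> * S * C = S * \<iota> * C"
      by (simp add: C_commute mult.assoc)
  qed
  obtain X where X: "fcalc S 1 arcsin X"
    using fcalc_exists[OF adj_S norm_S, of arcsin] continuous_on_arcsin' by auto
  \<comment> \<open>Since \<open>R1\<close> intertwines \<open>S\<close> with \<open>- S\<close>, it
    intertwines \<open>X\<close> with \<open>arcsin\<close> of \<open>- S\<close>, which is
    \<open>- X\<close> because \<open>arcsin\<close> is odd.\<close>
  obtain Z where Z: "fcalc (- S) 1 arcsin Z"
    using fcalc_exists[of "- S" 1 arcsin] adj_minus[OF adj_S] norm_S continuous_on_arcsin' by auto
  have "fcalc S 1 (\<lambda>x. arcsin (- x)) Z"
    by (rule fcalc_comp[OF fcalc_minus[OF fcalc_id] Z]) auto
  then have "Z = - X"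
    by (rule fcalc_unique[OF _ fcalc_minus[OF X] adj_S norm_S]) (simp add: arcsin_minus)
  then have R1_X: "R1 * X = - (X * R1)"
    using fcalc_intertwine[OF X Z adj_minus[OF adj_S] _ R1_S] norm_S by simp
  have double: "fcalc S 1 (\<lambda>s. 2 * arcsin s) (2 *\<^sub>R X)"
    by (intro fcalc_scaleR X)
  have range: "2 * arcsin s \<in> {-pi..pi}" if "s \<in> {-1..1}" for s
    using arcsin_bounded[of s] that by auto
  have fc: "fcalc S 1 (\<lambda>s. 1 - 2 * (s * s)) c"
  proof -
    have "fcalc S 1 (\<lambda>s. 1 - 2 * (s * s)) (1 *\<^sub>R 1 - 2 *\<^sub>R (S * S))"
      by (intro fcalc_diff fcalc_const fcalc_scaleR fcalc_mult fcalc_id)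
    then show ?thesis by (simp add: S2)
  qed
  have "fcalc S 1 (\<lambda>s. cos (2 * arcsin s)) (cos (2 *\<^sub>R X))"
    by (rule fcalc_comp[OF double fcalc_cos[of pi]]) (use range in auto)
  then have cosX: "cos (2 *\<^sub>R X) = c"
    by (rule fcalc_unique[OF _ fc adj_S norm_S]) (simp add: cos_double_arcsin power2_eq_square abs_le_iff)
  \<comment> \<open>For the evaluation of \<open>sin 2X\<close>, \<open>C\<close> has to be a
    function of \<open>S\<close>: as \<open>c\<close> is \<open>1 - 2 *\<^sub>R (S * S)\<close>, the
    root becomes \<open>sqrt (1 - s\<^sup>2)\<close>, the cosine of \<open>arcsin s\<close>.\<close>
  have fC: "fcalc S 1 (\<lambda>s. sqrt ((1 + (1 - 2 * (s * s))) / 2)) C"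
    by (rule fcalc_comp[OF fc C])
      (use abs_square_le_1 in \<open>auto simp: abs_le_iff power2_eq_square\<close>)
  have "fcalc S 1 (\<lambda>s. sqrt (1 - s\<^sup>2)) C"
  proof (rule fcalc_cong[OF fC])
    fix s :: real
    have "(1 + (1 - 2 * (s * s))) / 2 = 1 - s\<^sup>2"
      by (simp add: power2_eq_square)
    then show "sqrt ((1 + (1 - 2 * (s * s))) / 2) = sqrt (1 - s\<^sup>2)"
      by (rule arg_cong)
  qed
  note fC' = fcalc_scaleR[OF fcalc_mult[OF fcalc_id this], of 2]
  have "fcalc S 1 (\<lambda>s. sin (2 * arcsin s)) (sin (2 *\<^sub>R X))"
    by (rule fcalc_comp[OF double fcalc_sin[of pi]]) (use range in auto)
  then have "sin (2 *\<^sub>R X) = 2 *\<^sub>R (S * C)"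
    by (rule fcalc_unique[OF _ fC' adj_S norm_S]) (simp add: sin_double_arcsin abs_le_iff)
  then have sinX: "sin (2 *\<^sub>R X) = K"
    by (simp add: S)
  have \<iota>_X: "\<iota> * X = X * \<iota>"
    by (rule fcalc_commute[OF X \<iota>_S])
  have "norm X \<le> pi / 2"
  proof (rule fcalc_norm_le[OF X adj_S norm_S])
    fix x :: real assume "x \<in> {-1..1}"
    then show "\<bar>arcsin x\<bar> \<le> pi / 2"
      using arcsin_bounded[of x] by (intro abs_leI) auto
  qed
  then have "generator X"
    unfolding generator_def
    using fcalc_adj[OF X adj_S] R1_X \<iota>_X exp_double[OF \<iota>_X] cosX sinX W_eq by simp
  then show ?thesis by blast
qed

end

end

section \<open>Curves of projections\<close>

lemma exp_intertwine:
  fixes A T T' :: "'a::{real_normed_algebra_1, banach}"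
  assumes "A * T = T' * A"
  shows "A * exp T = exp T' * A"
proof -
  have "A * T ^ n = T' ^ n * A" for n
    by (induction n) (simp_all add: assms flip: mult.assoc, simp add: assms mult.assoc)
  then have "(\<lambda>n. A * (T ^ n /\<^sub>R fact n)) = (\<lambda>n. (T' ^ n /\<^sub>R fact n) * A)"
    by simp
  moreover have "(\<lambda>n. A * (T ^ n /\<^sub>R fact n)) sums (A * exp T)"
    by (intro sums_mult exp_converges)
  moreover have "(\<lambda>n. (T' ^ n /\<^sub>R fact n) * A) sums (exp T' * A)"
    by (intro sums_mult2 exp_converges)
  ultimately show ?thesis
    using sums_unique2 by metis
qed

lemma norm_isometry_mult:
  fixes U U' B :: "'a::{real_inner, perfect_space} endo"
  assumes "adj U U'" "U' * U = 1"
  shows "norm (U * B) = norm B"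
proof (rule antisym)
  show "norm (U * B) \<le> norm B"
    by (rule norm_endo_bound) (simp_all add: adj_isometry[OF assms] norm_app)
  show "norm B \<le> norm (U * B)"
    using norm_app[of "U * B"] by (intro norm_endo_bound) (simp_all add: adj_isometry[OF assms])
qed

lemma norm_mult_involution:
  fixes R B :: "'a::{real_inner, perfect_space} endo"
  assumes "adj R R" "R * R = 1"
  shows "norm (B * R) = norm B"
proof (rule antisym)
  have R: "norm R \<le> 1"
    using norm_isometry_mult[OF assms, of 1] by simp
  show le: "norm (B * R) \<le> norm B" for B
    using norm_mult_ineq[of B R] mult_left_mono[OF R norm_ge_zero[of B]] by simp
  show "norm B \<le> norm (B * R)"
    using le[of "B * R"] by (simp add: mult.assoc assms)
qed

text \<open>Scaling by \<open>r < 1\<close> keeps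
  \<open>arcsin\<close> differentiable along the curve, and \<open>r \<rightarrow> 1\<close> at the end.\<close>

lemma sphere_curve_length:
  fixes y y' :: "real \<Rightarrow> 'a::real_inner"
  assumes S: "finite S" and cont: "continuous_on {0..1} y"
    and deriv: "\<And>t. t \<in> {0<..<1} - S \<Longrightarrow> (y has_vector_derivative y' t) (at t)"
    and unit: "\<And>t. t \<in> {0..1} \<Longrightarrow> norm (y t) = 1"
    and g: "g integrable_on {0..1}" "\<And>t. t \<in> {0..1} \<Longrightarrow> 0 \<le> g t"
      "\<And>t. t \<in> {0<..<1} - S \<Longrightarrow> norm (y' t) \<le> g t"
  shows "pi / 2 - integral {0..1} g \<le> arcsin (y 1 \<bullet> y 0)"
proof -
  define c where "c t = y t \<bullet> y 0" for t
  have c_le: "\<bar>c t\<bar> \<le> 1" if "t \<in> {0..1}" for t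
    using Cauchy_Schwarz_ineq2[of "y t" "y 0"] unit that by (simp add: c_def)
  have c_cont: "continuous_on {0..1} c"
    unfolding c_def by (intro continuous_intros cont)
  \<comment> \<open>The velocity is orthogonal to \<open>y t\<close>, so only the component of
    \<open>y 0\<close> orthogonal to \<open>y t\<close> counts, and its length is
    \<open>sqrt (1 - (c t)\<^sup>2)\<close>.\<close>
  have c': "\<bar>y' t \<bullet> y 0\<bar> \<le> g t * sqrt (1 - (c t)\<^sup>2)" if t: "t \<in> {0<..<1} - S" for t
  proof -
    have 1: "((\<lambda>t. y t \<bullet> y t) has_vector_derivative (y t \<bullet> y' t + y' t \<bullet> y t)) (at t)"
      by (rule bounded_bilinear.has_vector_derivative[OF bounded_bilinear_inner deriv[OF t] deriv[OF t]])
    have "((\<lambda>t. 1 :: real) has_vector_derivative 0) (at t)"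
      by simp
    then have "((\<lambda>t. y t \<bullet> y t) has_vector_derivative 0) (at t)"
      by (rule has_vector_derivative_transform_within_open[where S = "{0<..<1}"])
        (use t unit in \<open>auto simp: norm_eq_1\<close>)
    with 1 have orth: "y' t \<bullet> y t = 0"
      using vector_derivative_unique_at by (fastforce simp: inner_commute)
    have "(norm (y 0 - c t *\<^sub>R y t))\<^sup>2 = 1 - (c t)\<^sup>2"
      using unit[of 0] unit[of t] t unfolding power2_norm_eq_inner norm_eq_1
      by (simp add: inner_diff_left inner_diff_right inner_commute c_def power2_eq_square)
    then have n: "norm (y 0 - c t *\<^sub>R y t) = sqrt (1 - (c t)\<^sup>2)"
      by (metis norm_ge_zero real_sqrt_unique)
    have "y' t \<bullet> y 0 = y' t \<bullet> (y 0 - c t *\<^sub>R y t)"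
      using orth by (simp add: inner_diff_right)
    also have "\<bar>\<dots>\<bar> \<le> norm (y' t) * sqrt (1 - (c t)\<^sup>2)"
      using Cauchy_Schwarz_ineq2 n by metis
    also have "\<dots> \<le> g t * sqrt (1 - (c t)\<^sup>2)"
      using g(3)[OF t] c_le[of t] t by (intro mult_right_mono) (auto simp: abs_square_le_1)
    finally show ?thesis .
  qed
  have le_r: "arcsin r - arcsin (r * c 1) \<le> integral {0..1} g" if r: "r \<in> {0<..<1}" for r
  proof -
    \<comment> \<open>The derivative of \<open>arcsin (r * c t)\<close>, with the value
      \<open>0\<close> at the exceptional points.\<close>
    define h' where "h' t = (if t \<in> {0<..<1} - S then r * (y' t \<bullet> y 0) / sqrt (1 - (r * c t)\<^sup>2) else 0)" for t
    have rc: "\<bar>r * c t\<bar> < 1" if "t \<in> {0..1}" for t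
    proof -
      have "\<bar>r\<bar> * \<bar>c t\<bar> \<le> \<bar>r\<bar> * 1"
        using c_le[OF that] by (intro mult_left_mono) auto
      also have "\<dots> < 1"
        using r by simp
      finally show ?thesis by (simp only: abs_mult)
    qed
    have "(h' has_integral (arcsin (r * c 1) - arcsin (r * c 0))) {0..1}"
    proof (rule fundamental_theorem_of_calculus_interior_strong[OF S])
      show "continuous_on {0..1} (\<lambda>t. arcsin (r * c t))"
        using rc by (intro continuous_intros c_cont) (force simp: abs_less_iff)
      fix t assume t: "t \<in> {0<..<1} - S"
      then have "(c has_real_derivative (y' t \<bullet> y 0)) (at t)"
        unfolding c_def has_real_derivative_iff_has_vector_derivative
        by (intro bounded_linear.has_vector_derivative[OF bounded_linear_inner_left] deriv)
      then have "((\<lambda>t. arcsin (r * c t)) has_real_derivative h' t) (at t)"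
        using rc[of t] t
        by (auto intro!: derivative_eq_intros simp: h'_def abs_less_iff divide_inverse)
      then show "((\<lambda>t. arcsin (r * c t)) has_vector_derivative h' t) (at t)"
        by (simp add: has_real_derivative_iff_has_vector_derivative)
    qed simp
    moreover have "- h' t \<le> g t" if t: "t \<in> {0..1}" for t
    proof (cases "t \<in> {0<..<1} - S")
      case True
      \<comment> \<open>Because of \<open>r \<le> 1\<close> the factor
        \<open>r * sqrt (1 - (c t)\<^sup>2)\<close> is absorbed by the denominator of
        \<open>h' t\<close>, which leaves \<open>g t\<close>.\<close>
      have "r\<^sup>2 \<le> 1"
        using r by (simp add: power_le_one)
      then have "r\<^sup>2 * (1 - (c t)\<^sup>2) \<le> 1 - (r * c t)\<^sup>2"
        by (simp add: algebra_simps power_mult_distrib)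
      then have "sqrt (r\<^sup>2 * (1 - (c t)\<^sup>2)) \<le> sqrt (1 - (r * c t)\<^sup>2)"
        by simp
      then have sq: "r * sqrt (1 - (c t)\<^sup>2) \<le> sqrt (1 - (r * c t)\<^sup>2)"
        using r by (simp add: real_sqrt_mult)
      have pos: "0 < sqrt (1 - (r * c t)\<^sup>2)"
        using rc[OF t] by (simp add: abs_square_less_1)
      have "\<bar>r * (y' t \<bullet> y 0)\<bar> \<le> r * (g t * sqrt (1 - (c t)\<^sup>2))"
        using c'[OF True] r by (simp add: abs_mult mult_left_mono)
      also have "\<dots> \<le> g t * sqrt (1 - (r * c t)\<^sup>2)"
        using mult_left_mono[OF sq g(2)[OF t]] by (simp add: mult_ac)
      finally have "\<bar>r * (y' t \<bullet> y 0)\<bar> / sqrt (1 - (r * c t)\<^sup>2) \<le> g t"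
        using pos by (simp add: pos_divide_le_eq)
      moreover have "\<bar>h' t\<bar> = \<bar>r * (y' t \<bullet> y 0)\<bar> / sqrt (1 - (r * c t)\<^sup>2)"
        using True pos by (simp add: h'_def)
      ultimately have "\<bar>h' t\<bar> \<le> g t"
        by (simp only:)
      then show ?thesis
        using abs_ge_minus_self order_trans by blast
    next
      case False
      then have "h' t = 0"
        unfolding h'_def by (rule if_not_P)
      then show ?thesis
        using g(2)[OF t] by simp
    qed
    ultimately have "- (arcsin (r * c 1) - arcsin (r * c 0)) \<le> integral {0..1} g"
      by (intro has_integral_le[OF has_integral_neg integrable_integral[OF g(1)]]) auto
    moreover have "c 0 = 1"
      using unit[of 0] by (simp add: c_def norm_eq_1)
    ultimately show ?thesis by simp
  qed
  have "continuous_on (closure {0<..<1}) (\<lambda>r. arcsin r - arcsin (r * c 1))"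
  proof (intro continuous_intros ballI)
    fix r :: real assume "r \<in> closure {0<..<1}"
    then have r: "\<bar>r\<bar> \<le> 1" "-1 \<le> r" "r \<le> 1" by auto
    then have "\<bar>r * c 1\<bar> \<le> 1"
      using c_le[of 1] by (simp add: abs_mult mult_le_one)
    then show "-1 \<le> r * c 1 \<and> r * c 1 \<le> 1"
      by (auto simp: abs_le_iff)
    show "-1 \<le> r \<and> r \<le> 1" using r by simp
  qed
  then have "arcsin 1 - arcsin (1 * c 1) \<le> integral {0..1} g"
    by (rule continuous_le_on_closure) (use le_r in auto)
  then show ?thesis
    by (simp add: c_def)
qed

text \<open>For a polynomial \<open>p\<close>, division by \<open>X - l\<close> shows that
  \<open>peval p T\<close> acts on \<open>u n\<close> as \<open>poly p l\<close> up to a term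
  tending to \<open>0\<close>; a general \<open>f\<close> is within \<open>e / 3\<close> of such a
  polynomial, both at \<open>l\<close> and as an operator.\<close>

lemma fcalc_approximate_eigenvector:
  fixes T :: "'a::{real_inner, perfect_space} endo"
  assumes f: "fcalc T M f B" and l: "l \<in> {-M..M}"
    and u: "\<And>n. norm (u n) = 1" "(\<lambda>n. (T - l *\<^sub>R 1) \<cdot> u n) \<longlonglongrightarrow> 0"
  shows "(\<lambda>n. (B \<cdot> u n) \<bullet> u n) \<longlonglongrightarrow> f l"
proof (rule tendstoI)
  fix e :: real assume "e > 0"
  then obtain p where p: "\<forall>x\<in>{-M..M}. \<bar>poly p x - f x\<bar> < e / 3" "norm (peval p T - B) < e / 3"
    using f unfolding fcalc_def by (meson divide_pos_pos zero_less_numeral)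
  define q where "q = synthetic_div p l"
  have "peval p T = peval ([:-l, 1:] * q + [:poly p l:]) T"
    unfolding q_def synthetic_div_correct' ..
  then have pT: "peval p T = peval q T * (T - l *\<^sub>R 1) + poly p l *\<^sub>R 1"
    by (simp add: algebra_simps peval_commute_arg)
  have "(\<lambda>n. (peval q T \<cdot> ((T - l *\<^sub>R 1) \<cdot> u n))) \<longlonglongrightarrow> peval q T \<cdot> 0"
    by (intro tendsto_app tendsto_const u(2))
  then have "(\<lambda>n. norm (peval q T \<cdot> ((T - l *\<^sub>R 1) \<cdot> u n))) \<longlonglongrightarrow> 0"
    using tendsto_norm_zero by simp
  then have "\<forall>\<^sub>F n in sequentially. norm (peval q T \<cdot> ((T - l *\<^sub>R 1) \<cdot> u n)) < e / 3"
    using \<open>e > 0\<close> by (intro order_tendstoD) auto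
  then show "\<forall>\<^sub>F n in sequentially. dist ((B \<cdot> u n) \<bullet> u n) (f l) < e"
  proof eventually_elim
    case (elim n)
    have *: "\<bar>(A \<cdot> u n) \<bullet> u n\<bar> \<le> norm (A \<cdot> u n)" for A :: "'a endo"
      using Cauchy_Schwarz_ineq2[of "A \<cdot> u n" "u n"] u(1) by simp
    have uu: "u n \<bullet> u n = 1"
      using u(1) norm_eq_1 by blast
    have eq: "(B \<cdot> u n) \<bullet> u n - f l = - (((peval p T - B) \<cdot> u n) \<bullet> u n)
        + ((peval q T * (T - l *\<^sub>R 1)) \<cdot> u n) \<bullet> u n + (poly p l - f l)"
      unfolding pT by (simp add: inner_add_left inner_diff_left uu)
    have "\<bar>((peval p T - B) \<cdot> u n) \<bullet> u n\<bar> < e / 3"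
      using *[of "peval p T - B"] norm_app[of "peval p T - B" "u n"] p(2) u(1) by simp
    moreover have "\<bar>((peval q T * (T - l *\<^sub>R 1)) \<cdot> u n) \<bullet> u n\<bar> < e / 3"
      using *[of "peval q T * (T - l *\<^sub>R 1)"] elim by simp
    moreover have "\<bar>poly p l - f l\<bar> < e / 3"
      using p(1) l by blast
    ultimately show ?case
      unfolding dist_real_def eq by linarith
  qed
qed

lemma approximate_eigenvector_sequence:
  fixes T :: "'a::{real_inner, perfect_space} endo"
  assumes "adj T T"
  obtains l u where "\<bar>l\<bar> = norm T" "\<And>n::nat. norm (u n) = 1" "(\<lambda>n. (T - l *\<^sub>R 1) \<cdot> u n) \<longlonglongrightarrow> 0"
proof -
  from symmetric_norm_approximate_eigenvalue[OF assms]
  obtain l where l: "\<bar>l\<bar> = norm T" "\<not> bounded_below (T - l *\<^sub>R 1)"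
  proof
    assume "\<not> bounded_below (T + norm T *\<^sub>R 1)"
    then show ?thesis by (intro that[of "- norm T"]) simp_all
  qed (use that[of "norm T"] in simp)
  have "\<exists>v. norm v = 1 \<and> norm ((T - l *\<^sub>R 1) \<cdot> v) \<le> inverse (Suc n)" for n
  proof -
    obtain x where x: "norm ((T - l *\<^sub>R 1) \<cdot> x) < inverse (Suc n) * norm x"
      using l(2) unfolding bounded_below_def
      by (metis inverse_positive_iff_positive not_le of_nat_0_less_iff zero_less_Suc)
    then have "x \<noteq> 0" by auto
    have "norm ((T - l *\<^sub>R 1) \<cdot> sgn x) = norm ((T - l *\<^sub>R 1) \<cdot> x) / norm x"
      unfolding sgn_div_norm app_simps(11) by (simp add: divide_inverse mult.commute del: app_simps)
    also have "\<dots> \<le> inverse (Suc n)"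
      using x \<open>x \<noteq> 0\<close> by (simp add: pos_divide_le_eq less_imp_le)
    finally show ?thesis
      using \<open>x \<noteq> 0\<close> by (intro exI[of _ "sgn x"]) (simp add: norm_sgn)
  qed
  then obtain u where u: "\<And>n::nat. norm (u n) = 1" "\<And>n. norm ((T - l *\<^sub>R 1) \<cdot> u n) \<le> inverse (Suc n)"
    by metis
  have "(\<lambda>n. (T - l *\<^sub>R 1) \<cdot> u n) \<longlonglongrightarrow> 0"
    by (rule Lim_null_comparison[OF _ LIMSEQ_inverse_real_of_nat]) (use u(2) in auto)
  with l(1) u(1) show ?thesis by (rule that)
qed

section \<open>Exponentials of generators, the lower bound for lengths, and geodesic arcs\<close>

context symmetry_pair
begin

lemma R1_exp:
  assumes "R1 * X = - (X * R1)"
  shows "R1 * exp (r *\<^sub>R (\<iota> * X)) = exp (- (r *\<^sub>R (\<iota> * X))) * R1"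
proof (rule exp_intertwine)
  have "R1 * (\<iota> * X) = \<iota> * (R1 * X)"
    by (rule \<iota>_comm)
  then show "R1 * (r *\<^sub>R (\<iota> * X)) = - (r *\<^sub>R (\<iota> * X)) * R1"
    using assms by (simp add: mult.assoc)
qed

lemma adj_\<iota>_mult:
  assumes "adj X X" "\<iota> * X = X * \<iota>"
  shows "adj (r *\<^sub>R (\<iota> * X)) (- (r *\<^sub>R (\<iota> * X)))"
  using adj_scaleR[OF adj_mult[OF \<iota>(2) assms(1)], of r] assms(2) by simp

lemma exp_\<iota>_isometry:
  assumes "adj X X" "\<iota> * X = X * \<iota>"
  shows "adj (exp (r *\<^sub>R (\<iota> * X))) (exp (- (r *\<^sub>R (\<iota> * X))))"
    and "exp (- (r *\<^sub>R (\<iota> * X))) * exp (r *\<^sub>R (\<iota> * X)) = 1"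
  using adj_exp[OF adj_\<iota>_mult[OF assms]] exp_minus_inverse[of "- (r *\<^sub>R (\<iota> * X))"] by auto

lemma exp_double_square: "exp (2 *\<^sub>R A) = exp A * exp (A :: 'a endo)"
  using exp_add_commuting[of A A] by (simp only: scaleR_2)

text \<open>\<open>e\<^sup>i\<^sup>X\<close> squares to \<open>-1\<close> on the eigenspace, so it anticommutes with \<open>R\<^sub>1\<close> there.\<close>

lemma exp_swaps_eigenvectors:
  assumes X: "R1 * X = - (X * R1)" "exp (2 *\<^sub>R (\<iota> * X)) = W"
    and x: "x \<noteq> 0" "W \<cdot> x = - x" "R1 \<cdot> x = s *\<^sub>R x"
  obtains y where "y \<noteq> 0" "W \<cdot> y = - y" "R1 \<cdot> y = - s *\<^sub>R y"
proof
  define E E' where "E = exp (\<iota> * X)" and "E' = exp (- (\<iota> * X))"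
  have W: "W = E * E"
    using X(2) exp_double_square[of "\<iota> * X"] by (simp add: E_def)
  have E'E: "E' * E = 1"
    using exp_minus_inverse[of "- (\<iota> * X)"] by (simp add: E_def E'_def)
  have R1E: "R1 * E = E' * R1"
    using R1_exp[OF X(1), of 1] by (simp add: E_def E'_def)
  have E'E_app: "E' \<cdot> E \<cdot> v = v" for v
    using arg_cong[OF E'E, of "\<lambda>A. A \<cdot> v"] by simp
  show "E \<cdot> x \<noteq> 0"
    using E'E_app[of x] x(1) by auto
  have EE: "E \<cdot> E \<cdot> x = - x"
    using x(2) by (simp add: W)
  then have "E' \<cdot> x = - (E \<cdot> x)"
    using E'E_app[of "E \<cdot> x"] by (metis app_simps(10) minus_minus)
  moreover have "R1 \<cdot> E \<cdot> x = E' \<cdot> R1 \<cdot> x"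
    using arg_cong[OF R1E, of "\<lambda>A. A \<cdot> x"] by simp
  ultimately show "R1 \<cdot> E \<cdot> x = - s *\<^sub>R (E \<cdot> x)"
    by (simp add: x(3))
  show "W \<cdot> E \<cdot> x = - (E \<cdot> x)"
    by (simp add: W EE)
qed

text \<open>For a unit vector \<open>z\<close> the curve \<open>R t \<cdot> R1 \<cdot> z\<close> on
  the sphere runs from \<open>z\<close> to \<open>W \<cdot> z\<close>, and the cosine of the angle
  between them is the quadratic form of \<open>cos (2 *\<^sub>R X)\<close> at \<open>z\<close>, as
  the skew part of \<open>W\<close> contributes nothing. Along approximate eigenvectors it tends to
  \<open>cos (2 * norm X)\<close>.\<close>

lemma generator_norm_le:
  assumes gen: "adj X X" "\<iota> * X = X * \<iota>" "norm X \<le> pi / 2" "exp (2 *\<^sub>R (\<iota> * X)) = W"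
    and S: "finite S" and cont: "continuous_on {0..1} R"
    and deriv: "\<And>t. t \<in> {0<..<1} - S \<Longrightarrow> (R has_vector_derivative R' t) (at t)"
    and isom: "\<And>t x. t \<in> {0..1} \<Longrightarrow> norm (R t \<cdot> x) = norm x"
    and ends: "R 0 = R1" "R 1 = R2"
    and g: "g integrable_on {0..1}" "\<And>t. t \<in> {0..1} \<Longrightarrow> 0 \<le> g t"
      "\<And>t. t \<in> {0<..<1} - S \<Longrightarrow> norm (R' t) \<le> g t"
  shows "2 * norm X \<le> integral {0..1} g"
proof -
  let ?M = "norm X"
  have cosX: "fcalc X ?M (\<lambda>x. cos (2 * x)) (cos (2 *\<^sub>R X))"
    by (rule fcalc_comp[OF fcalc_scaleR[OF fcalc_id] fcalc_cos[of "2 * ?M"]]) auto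
  \<comment> \<open>The interval \<open>[0, 0]\<close> serves here, because only the convergence of
    the approximating polynomials at the operator is used.\<close>
  have "adj (sin (2 *\<^sub>R X)) (sin (2 *\<^sub>R X))"
    using fcalc_adj[OF fcalc_sin[of 0] adj_scaleR[OF gen(1)]] by simp
  then have skew: "adj (\<iota> * sin (2 *\<^sub>R X)) (sin (2 *\<^sub>R X) * - \<iota>)"
    by (rule adj_mult[OF \<iota>(2)])
  have "\<iota> * sin (2 *\<^sub>R X) = sin (2 *\<^sub>R X) * \<iota>"
    by (rule fcalc_commute[OF fcalc_sin[of 0]]) (simp_all add: gen(2))
  with skew have skew: "adj (\<iota> * sin (2 *\<^sub>R X)) (- (\<iota> * sin (2 *\<^sub>R X)))"
    by simp
  have W_app: "(W \<cdot> z) \<bullet> z = (cos (2 *\<^sub>R X) \<cdot> z) \<bullet> z" for z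
  proof -
    have "((\<iota> * sin (2 *\<^sub>R X)) \<cdot> z) \<bullet> z = 0"
      using skew[unfolded adj_def, rule_format, of z z] by (simp add: inner_commute)
    then show ?thesis
      unfolding gen(4)[symmetric] exp_double[OF gen(2)] by (simp add: inner_add_left)
  qed
  have bound: "pi / 2 - integral {0..1} g \<le> arcsin ((cos (2 *\<^sub>R X) \<cdot> z) \<bullet> z)" if z: "norm z = 1" for z
  proof -
    have R1z: "norm (R1 \<cdot> z) = 1"
      using adj_isometry[OF R1(2,1)] z by simp
    have bl: "bounded_linear (\<lambda>A. A \<cdot> (R1 \<cdot> z))"
      by (rule bounded_bilinear.bounded_linear_left[OF bounded_bilinear_app])
    have "pi / 2 - integral {0..1} g \<le> arcsin ((R 1 \<cdot> R1 \<cdot> z) \<bullet> (R 0 \<cdot> R1 \<cdot> z))"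
    proof (rule sphere_curve_length[OF S])
      show "continuous_on {0..1} (\<lambda>t. R t \<cdot> R1 \<cdot> z)"
        by (rule bounded_linear.continuous_on[OF bl cont])
      show "((\<lambda>t. R t \<cdot> R1 \<cdot> z) has_vector_derivative R' t \<cdot> R1 \<cdot> z) (at t)" if "t \<in> {0<..<1} - S" for t
        by (rule bounded_linear.has_vector_derivative[OF bl deriv[OF that]])
      show "norm (R' t \<cdot> R1 \<cdot> z) \<le> g t" if "t \<in> {0<..<1} - S" for t
        using norm_app[of "R' t" "R1 \<cdot> z"] g(3)[OF that] R1z by simp
    qed (use isom R1z g in auto)
    also have "(R 1 \<cdot> R1 \<cdot> z) \<bullet> (R 0 \<cdot> R1 \<cdot> z) = (W \<cdot> z) \<bullet> ((R1 * R1) \<cdot> z)"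
      by (simp add: ends W_def)
    finally show ?thesis
      by (simp add: R1(1) W_app)
  qed
  obtain l u where l: "\<bar>l\<bar> = norm X" and u: "\<And>n::nat. norm (u n) = 1"
    "(\<lambda>n. (X - l *\<^sub>R 1) \<cdot> u n) \<longlonglongrightarrow> 0"
    using approximate_eigenvector_sequence[OF gen(1)] by metis
  define d where "d n = (cos (2 *\<^sub>R X) \<cdot> u n) \<bullet> u n" for n
  have d: "d \<longlonglongrightarrow> cos (2 * l)"
    unfolding d_def by (rule fcalc_approximate_eigenvector[OF cosX _ u]) (use l in auto)
  have d_le: "d n \<in> {-1..1}" for n
  proof -
    have "norm (cos (2 *\<^sub>R X)) \<le> 1"
      by (rule fcalc_norm_le[OF cosX gen(1)]) auto
    then have "norm (cos (2 *\<^sub>R X) \<cdot> u n) \<le> 1"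
      using norm_app[of "cos (2 *\<^sub>R X)" "u n"] u(1)[of n] by simp
    then have "\<bar>d n\<bar> \<le> 1"
      using Cauchy_Schwarz_ineq2[of "cos (2 *\<^sub>R X) \<cdot> u n" "u n"] u(1)[of n] by (simp add: d_def)
    then show ?thesis by (simp add: abs_le_iff minus_le_iff)
  qed
  have "continuous_on {-1..1} arcsin"
    by (rule continuous_on_arcsin')
  then have "(\<lambda>n. arcsin (d n)) \<longlonglongrightarrow> arcsin (cos (2 * l))"
    by (rule continuous_on_tendsto_compose[OF _ d]) (use d_le in auto)
  then have "pi / 2 - integral {0..1} g \<le> arcsin (cos (2 * l))"
    using bound u(1) unfolding d_def by (intro LIMSEQ_le_const) auto
  also have "cos (2 * l) = cos (2 * norm X)"
    using l by (metis abs_mult abs_numeral cos_abs_real)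
  \<comment> \<open>The argument lies in \<open>[-pi/2, pi/2]\<close> by the bound on
    \<open>norm X\<close>, so \<open>arcsin\<close> recovers it; larger angles could not be read off
    from their cosine.\<close>
  also have "\<dots> = sin (pi / 2 - 2 * norm X)"
    by (simp add: cos_sin_eq)
  also have "arcsin \<dots> = pi / 2 - 2 * norm X"
    using gen(3) by (intro arcsin_sin) auto
  finally show ?thesis by simp
qed

text \<open>The geodesic written with symmetries. Moving the right exponential past
  \<open>R1\<close> inverts it and doubles the left one, so that a single factor depends on
  \<open>t\<close>.\<close>

definition arc where "arc X t = (1/2) *\<^sub>R (1 + exp ((2 * t) *\<^sub>R (\<iota> * X)) * R1)"

lemma arc_eq:
  assumes "R1 * X = - (X * R1)"
  shows "exp (t *\<^sub>R (\<iota> * X)) * ((1/2) *\<^sub>R (1 + R1)) * exp (- (t *\<^sub>R (\<iota> * X))) = arc X t"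
proof -
  let ?A = "t *\<^sub>R (\<iota> * X)"
  have "R1 * exp (- ?A) = exp ?A * R1"
    using R1_exp[OF assms, of "- t"] by simp
  then have "exp ?A * (1 + R1) * exp (- ?A) = 1 + exp ?A * exp ?A * R1"
    by (simp add: distrib_left distrib_right exp_minus_inverse mult.assoc)
  also have "exp ?A * exp ?A = exp ((2 * t) *\<^sub>R (\<iota> * X))"
    using exp_double_square[of ?A] by simp
  finally show ?thesis
    by (simp add: arc_def)
qed

lemma arc_deriv:
  "(arc X has_vector_derivative exp ((2 * t) *\<^sub>R (\<iota> * X)) * (\<iota> * X) * R1) (at t within T)"
proof -
  have "((\<lambda>t. exp (t *\<^sub>R (2 *\<^sub>R (\<iota> * X)))) has_vector_derivative
      exp (t *\<^sub>R (2 *\<^sub>R (\<iota> * X))) * (2 *\<^sub>R (\<iota> * X))) (at t within T)"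
    by (rule exp_scaleR_has_vector_derivative_right)
  then have "((\<lambda>t. (1/2) *\<^sub>R (1 + exp (t *\<^sub>R (2 *\<^sub>R (\<iota> * X))) * R1)) has_vector_derivative
      (1/2) *\<^sub>R (0 + exp (t *\<^sub>R (2 *\<^sub>R (\<iota> * X))) * (2 *\<^sub>R (\<iota> * X)) * R1)) (at t within T)"
    by (intro bounded_linear.has_vector_derivative[OF bounded_linear_scaleR_right]
        bounded_linear.has_vector_derivative[OF bounded_linear_mult_left]
        has_vector_derivative_add has_vector_derivative_const)
  then show ?thesis
    by (simp add: arc_def[abs_def] mult.commute[of 2])
qed

text \<open>The exponential and \<open>\<iota>\<close> are isometries and \<open>R1\<close> is an
  isometric involution, so none of them changes the norm: geodesics have constant speed
  \<open>norm X\<close>.\<close>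

lemma norm_arc_deriv:
  assumes "adj X X" "\<iota> * X = X * \<iota>"
  shows "norm (exp (r *\<^sub>R (\<iota> * X)) * (\<iota> * X) * R1) = norm X"
proof -
  have "norm (exp (r *\<^sub>R (\<iota> * X)) * (\<iota> * X) * R1) = norm (\<iota> * X)"
    using norm_mult_involution[OF R1(2,1)] norm_isometry_mult[OF exp_\<iota>_isometry(1,2)[OF assms]] by simp
  also have "\<dots> = norm X"
    by (rule norm_isometry_mult[OF \<iota>(2)]) (simp add: \<iota>(1))
  finally show ?thesis .
qed

end

section \<open>The circle and its square-integrable functions\<close>

lemma space_circle: "space circle_measure = sphere 0 1"
  by (simp add: circle_measure_def space_restrict_space)

lemma sets_circle: "sets circle_measure = sets (restrict_space borel (sphere 0 1))"
  by (simp add: circle_measure_def)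

lemma cis_measurable_circle: "cis \<in> uniform_measure lborel A \<rightarrow>\<^sub>M restrict_space borel (sphere 0 1)"
proof -
  have "cis \<in> borel_measurable borel"
    by (intro borel_measurable_continuous_onI continuous_intros)
  then show ?thesis
    by (intro measurable_restrict_space2) auto
qed

lemma prob_circle: "emeasure circle_measure (space circle_measure) = 1"
  unfolding circle_measure_def
  using emeasure_uniform_measure_1[of lborel "{0..<2 * pi}"] cis_measurable_circle[of "{0..<2 * pi}"]
    sets.top[of "restrict_space borel (sphere 0 1 :: complex set)"]
  by (subst space_distr, subst emeasure_distr)
    (auto simp: space_restrict_space measurable_space[OF cis_measurable_circle] vimage_def)

lemma finite_measure_circle: "finite_measure circle_measure"
  by (rule finite_measureI) (simp add: prob_circle)

interpretation circle: finite_measure circle_measure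
  by (rule finite_measure_circle)

lemma measure_circle: "measure circle_measure (space circle_measure) = 1"
  by (simp add: measure_def prob_circle)

lemma measurable_circle: "f \<in> borel_measurable borel \<Longrightarrow> f \<in> borel_measurable circle_measure"
  by (simp add: circle_measure_def measurable_restrict_space1)

lemma measurable_id_circle [measurable]: "(\<lambda>z. z) \<in> borel_measurable circle_measure"
  by (rule measurable_circle) simp

lemma measurable_powi [measurable]: "(\<lambda>z. z powi n) \<in> borel_measurable circle_measure"
  unfolding power_int_def by (cases "n \<ge> 0") simp_all

lemma norm_circle: "z \<in> space circle_measure \<Longrightarrow> cmod z = 1"
  by (simp add: space_circle)

lemma cnj_circle: "z \<in> space circle_measure \<Longrightarrow> cnj z = inverse z"
  by (simp add: norm_circle complex_div_cnj[of 1 z] inverse_eq_divide)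

lemma cnj_powi_circle: "z \<in> space circle_measure \<Longrightarrow> cnj (z powi n) = z powi (- n)"
  by (simp add: cnj_circle power_int_minus power_int_inverse)

lemma powi_add_circle: "z \<in> space circle_measure \<Longrightarrow> z powi (m + n) = z powi m * z powi n"
  by (rule power_int_add) (use norm_circle in force)

lemma integral_powi_circle: "(\<integral>z. z powi k \<partial>circle_measure) = (if k = 0 then 1 else 0)"
proof (cases "k = 0")
  case True
  then show ?thesis
    by (simp add: measure_circle)
next
  case False
  have "(\<integral>z. z powi k \<partial>circle_measure) = (\<integral>t. cis t powi k \<partial>uniform_measure lborel {0..<2 * pi})"
    unfolding circle_measure_def
    by (rule integral_distr[OF cis_measurable_circle])
      (use measurable_powi[of k] in \<open>simp add: measurable_cong_sets[OF sets_circle refl]\<close>)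
  also have "uniform_measure lborel {0..<2 * pi}
      = density lborel (\<lambda>t. ennreal (indicator {0..<2 * pi} t / (2 * pi)))"
    unfolding uniform_measure_def
    by (intro density_cong) (auto simp: divide_ennreal[symmetric] split: split_indicator)
  also have "(\<integral>t. cis t powi k \<partial>\<dots>) = (\<integral>t. (indicator {0..<2 * pi} t / (2 * pi)) *\<^sub>R cis t powi k \<partial>lborel)"
  proof (rule integral_density)
    have "continuous_on UNIV (\<lambda>t. cis (of_int k * t))"
      by (intro continuous_intros)
    then show "(\<lambda>t. cis t powi k) \<in> borel_measurable lborel"
      by (simp add: Complex.cis_power_int borel_measurable_continuous_onI)
  qed auto
  \<comment> \<open>Adding the right end point, a null set, gives the closed interval on which the
    fundamental theorem of calculus is applied.\<close>
  also have "\<dots> = (\<integral>t. (1 / (2 * pi)) *\<^sub>R (indicator {0..2 * pi} t *\<^sub>R cis (of_int k * t)) \<partial>lborel)"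
  proof (rule integral_cong_AE)
    have "continuous_on UNIV (\<lambda>t. cis (of_int k * t))"
      by (intro continuous_intros)
    then have [measurable]: "(\<lambda>t. cis (of_int k * t)) \<in> borel_measurable borel"
      by (rule borel_measurable_continuous_onI)
    show "(\<lambda>t. (indicator {0..<2 * pi} t / (2 * pi)) *\<^sub>R cis t powi k) \<in> borel_measurable lborel"
      "(\<lambda>t. (1 / (2 * pi)) *\<^sub>R (indicator {0..2 * pi} t *\<^sub>R cis (of_int k * t))) \<in> borel_measurable lborel"
      unfolding Complex.cis_power_int by measurable
    show "AE t in lborel. (indicator {0..<2 * pi} t / (2 * pi)) *\<^sub>R cis t powi k
        = (1 / (2 * pi)) *\<^sub>R (indicator {0..2 * pi} t *\<^sub>R cis (of_int k * t))"
      using AE_lborel_singleton[of "2 * pi"]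
      by eventually_elim (auto simp: Complex.cis_power_int split: split_indicator)
  qed
  also have "\<dots> = (1 / (2 * pi)) *\<^sub>R (\<integral>t. indicator {0..2 * pi} t *\<^sub>R cis (of_int k * t) \<partial>lborel)"
    by (rule integral_scaleR_right)
  also have "(\<integral>t. indicator {0..2 * pi} t *\<^sub>R cis (of_int k * t) \<partial>lborel)
      = cis (of_int k * (2 * pi)) / (\<i> * of_int k) - cis (of_int k * 0) / (\<i> * of_int k)"
  proof (rule integral_FTC_Icc)
    show "((\<lambda>t. cis (of_int k * t) / (\<i> * of_int k)) has_vector_derivative cis (of_int k * t)) (at t within {0..2 * pi})"
      for t
    proof -
      have "((\<lambda>w. exp (\<i> * of_int k * w) / (\<i> * of_int k)) has_field_derivative exp (\<i> * of_int k * of_real t))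
          (at (complex_of_real t))"
        using False by (auto intro!: derivative_eq_intros)
      from has_vector_derivative_real_field[OF this] show ?thesis
        by (simp add: cis_conv_exp mult.assoc)
    qed
  qed (auto intro!: continuous_intros)
  also have "cis (of_int k * (2 * pi)) = 1"
    using cis_multiple_2pi[of "of_int k"] by (simp add: mult_ac)
  finally show ?thesis
    using False by simp
qed

lemma square_integrable_rep: "square_integrable (rep_L2 f)"
  using Quotient3_rep_reflp[OF Quotient3_L2] by blast

lemma measurable_rep [measurable]: "rep_L2 f \<in> borel_measurable circle_measure"
  using square_integrable_rep by (rule square_integrable_measurable)

lemma L2_eq_iff: "f = g \<longleftrightarrow> (AE z in circle_measure. rep_L2 f z = rep_L2 g z)"
  using Quotient3_rel_rep[OF Quotient3_L2, of f g] square_integrable_rep by auto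

lemma rep_abs_L2: "square_integrable f \<Longrightarrow> AE z in circle_measure. rep_L2 (abs_L2 f) z = f z"
  using Quotient3_rep_abs[OF Quotient3_L2, of f] by auto

lemma rep_zero: "AE z in circle_measure. rep_L2 0 z = 0"
  unfolding zero_L2_def by (rule rep_abs_L2[OF square_integrable_zero])

lemma rep_add: "AE z in circle_measure. rep_L2 (f + g) z = rep_L2 f z + rep_L2 g z"
  unfolding plus_L2_def by (simp add: rep_abs_L2 square_integrable_add square_integrable_rep)

lemma rep_scaleC: "AE z in circle_measure. rep_L2 (c *\<^sub>C f) z = c * rep_L2 f z"
  unfolding scaleC_def by (simp add: rep_abs_L2 square_integrable_cmult square_integrable_rep)

lemma rep_diff: "AE z in circle_measure. rep_L2 (f - g) z = rep_L2 f z - rep_L2 g z"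
  unfolding minus_L2_def uminus_L2_def
  using rep_add[of f "(- 1) *\<^sub>C g"] rep_scaleC[of "-1" g] by eventually_elim simp

lemma cinner_rep: "cinner f g = (\<integral>z. rep_L2 f z * cnj (rep_L2 g z) \<partial>circle_measure)"
  by (simp add: cinner_def)

lemma fourier_coeff_rep: "fourier_coeff f n = (\<integral>z. rep_L2 f z * cnj (z powi n) \<partial>circle_measure)"
  by (simp add: fourier_coeff_def)

lemma square_integrable_L2: "integrable circle_measure (\<lambda>z. (cmod (rep_L2 f z))\<^sup>2)"
  using square_integrable_rep by (simp add: square_integrable_def)

lemma cinner_integrable: "integrable circle_measure (\<lambda>z. rep_L2 f z * cnj (rep_L2 g z))"
  by (intro square_integrable_product square_integrable_rep)

lemma norm_L2_integral: "(norm f)\<^sup>2 = (\<integral>z. (cmod (rep_L2 f z))\<^sup>2 \<partial>circle_measure)"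
  and cinner_self_eq_norm: "cinner f f = of_real ((norm f)\<^sup>2)"
proof -
  have eq: "cinner f f = of_real (\<integral>z. (cmod (rep_L2 f z))\<^sup>2 \<partial>circle_measure)"
    by (simp add: cinner_rep complex_norm_square[symmetric] flip: integral_complex_of_real)
  then show norm: "(norm f)\<^sup>2 = (\<integral>z. (cmod (rep_L2 f z))\<^sup>2 \<partial>circle_measure)"
    by (simp add: norm_L2_def inner_L2_def)
  show "cinner f f = of_real ((norm f)\<^sup>2)"
    unfolding norm by (rule eq)
qed

lemma norm_L2_nn: "(\<integral>\<^sup>+z. ennreal ((cmod (rep_L2 f z))\<^sup>2) \<partial>circle_measure) = ennreal ((norm f)\<^sup>2)"
  unfolding norm_L2_integral by (intro nn_integral_eq_integral square_integrable_L2) simp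

lemma cinner_commute: "cinner g f = cnj (cinner f g)"
  unfolding cinner_rep Bochner_Integration.integral_cnj[symmetric] by (simp add: mult.commute)

lemma cinner_add_left: "cinner (f + g) h = cinner f h + cinner g h"
proof -
  have "cinner (f + g) h = (\<integral>z. rep_L2 f z * cnj (rep_L2 h z) + rep_L2 g z * cnj (rep_L2 h z) \<partial>circle_measure)"
    unfolding cinner_rep
  proof (rule integral_cong_AE)
    show "AE z in circle_measure. rep_L2 (f + g) z * cnj (rep_L2 h z)
        = rep_L2 f z * cnj (rep_L2 h z) + rep_L2 g z * cnj (rep_L2 h z)"
      using rep_add[of f g] by eventually_elim (simp add: distrib_right)
  qed measurable
  then show ?thesis
    by (simp add: cinner_rep Bochner_Integration.integral_add cinner_integrable)
qed

lemma cinner_scaleC_left: "cinner (c *\<^sub>C f) g = c * cinner f g"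
proof -
  have "cinner (c *\<^sub>C f) g = (\<integral>z. c * (rep_L2 f z * cnj (rep_L2 g z)) \<partial>circle_measure)"
    unfolding cinner_rep
  proof (rule integral_cong_AE)
    show "AE z in circle_measure. rep_L2 (c *\<^sub>C f) z * cnj (rep_L2 g z) = c * (rep_L2 f z * cnj (rep_L2 g z))"
      using rep_scaleC[of c f] by eventually_elim simp
  qed measurable
  then show ?thesis by (simp add: cinner_rep)
qed

lemma scaleR_scaleC: "r *\<^sub>R f = complex_of_real r *\<^sub>C f" for f :: L2
  by (rule scaleR_L2_def)

lemma scaleC_scaleC: "a *\<^sub>C b *\<^sub>C f = (a * b) *\<^sub>C f"
  unfolding L2_eq_iff
  using rep_scaleC[of a "b *\<^sub>C f"] rep_scaleC[of b f] rep_scaleC[of "a * b" f]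
  by eventually_elim simp

lemma scaleC_add_left: "(a + b) *\<^sub>C f = a *\<^sub>C f + b *\<^sub>C f"
  unfolding L2_eq_iff
  using rep_scaleC[of a f] rep_scaleC[of b f] rep_scaleC[of "a + b" f] rep_add[of "a *\<^sub>C f" "b *\<^sub>C f"]
  by eventually_elim (simp add: distrib_right)

lemma cinner_minus_left: "cinner (- f) g = - cinner f g"
  unfolding uminus_L2_def cinner_scaleC_left by simp

lemma cinner_diff_left: "cinner (f - g) h = cinner f h - cinner g h"
  using cinner_add_left[of f "- g" h] by (simp add: cinner_minus_left)

lemma cinner_zero_left [simp]: "cinner 0 g = 0"
  using cinner_diff_left[of g g g] by simp

lemma cinner_zero_right [simp]: "cinner g 0 = 0"
  by (metis cinner_commute cinner_zero_left complex_cnj_zero)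

lemma cinner_diff_right: "cinner h (f - g) = cinner h f - cinner h g"
  by (metis cinner_commute cinner_diff_left complex_cnj_diff)

lemma cinner_scaleC_right: "cinner f (c *\<^sub>C g) = cnj c * cinner f g"
  by (metis cinner_commute cinner_scaleC_left complex_cnj_mult)

text \<open>Recovers the complex inner product from the real one; thereby orthogonality to complex
  subspaces and symmetry of complex-linear operators pass from the real to the complex
  setting.\<close>

lemma cinner_inner: "cinner f g = of_real (f \<bullet> g) + \<i> * of_real (f \<bullet> (\<i> *\<^sub>C g))"
  by (simp add: inner_L2_def cinner_scaleC_right complex_eq_iff)

lemma cinner_cauchy_schwarz: "cmod (cinner f g) \<le> norm f * norm g"
proof (cases "cinner f g = 0")
  case False
  define c where "c = cnj (sgn (cinner f g))"
  have "cinner (c *\<^sub>C f) g = cmod (cinner f g)"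
    using False by (simp add: c_def cinner_scaleC_left sgn_eq complex_norm_square[symmetric] power2_eq_square
        mult.commute[of "cnj _"])
  then have "cmod (cinner f g) = (c *\<^sub>C f) \<bullet> g"
    by (simp add: inner_L2_def)
  also have "\<dots> \<le> norm (c *\<^sub>C f) * norm g"
    by (rule norm_cauchy_schwarz)
  also have "norm (c *\<^sub>C f) = norm f"
    using False by (simp add: c_def norm_scaleC norm_sgn)
  finally show ?thesis .
qed simp

definition monomial :: "int \<Rightarrow> L2" where
  "monomial n = abs_L2 (\<lambda>z. z powi n)"

lemma square_integrable_bounded:
  assumes [measurable]: "\<phi> \<in> borel_measurable circle_measure"
    and bd: "AE z in circle_measure. cmod (\<phi> z) \<le> C"
  shows "square_integrable \<phi>"
proof -
  have "square_integrable (\<lambda>_. 1)"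
    by (simp add: square_integrable_def)
  from square_integrable_bounded_mult[OF this assms] show ?thesis by simp
qed

lemma square_integrable_powi: "square_integrable (\<lambda>z. z powi n)"
  by (rule square_integrable_bounded[OF measurable_powi, of _ 1])
    (rule AE_I2, simp add: norm_power_int norm_circle)

lemma rep_monomial: "AE z in circle_measure. rep_L2 (monomial n) z = z powi n"
  unfolding monomial_def by (rule rep_abs_L2[OF square_integrable_powi])

lemma fourier_coeff_cinner: "fourier_coeff f n = cinner f (monomial n)"
  unfolding fourier_coeff_rep cinner_rep
proof (rule integral_cong_AE)
  show "AE z in circle_measure. rep_L2 f z * cnj (z powi n) = rep_L2 f z * cnj (rep_L2 (monomial n) z)"
    using rep_monomial[of n] by eventually_elim simp
qed measurable

lemma fourier_coeff_monomial: "fourier_coeff (monomial m) n = (if m = n then 1 else 0)"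
proof -
  have "fourier_coeff (monomial m) n = (\<integral>z. z powi (m - n) \<partial>circle_measure)"
    unfolding fourier_coeff_rep
  proof (rule integral_cong_AE)
    show "AE z in circle_measure. rep_L2 (monomial m) z * cnj (z powi n) = z powi (m - n)"
      using rep_monomial[of m] AE_space
    proof eventually_elim
      case (elim z)
      then show ?case
        using powi_add_circle[of z m "- n"] by (simp only: cnj_powi_circle) simp
    qed
  qed measurable
  then show ?thesis
    by (simp add: integral_powi_circle)
qed

lemma norm_monomial [simp]: "norm (monomial n) = 1"
proof -
  have "complex_of_real ((norm (monomial n))\<^sup>2) = 1"
    unfolding cinner_self_eq_norm[symmetric] fourier_coeff_cinner[symmetric] fourier_coeff_monomial by simp
  then show ?thesis
    by (simp only: of_real_eq_1_iff power2_eq_1_iff) (use norm_ge_zero[of "monomial n"] in linarith)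
qed

text \<open>Cauchy-Schwarz against the constant \<open>1\<close>, whose norm is \<open>1\<close> for
  the normalised measure.\<close>

lemma integral_norm_le_norm:
  "(\<integral>\<^sup>+z. ennreal (cmod (rep_L2 f z)) \<partial>circle_measure) \<le> ennreal (norm f)"
proof -
  have sq: "square_integrable (\<lambda>z. complex_of_real (cmod (rep_L2 f z)))"
    using square_integrable_L2 by (simp add: square_integrable_def)
  define g where "g = abs_L2 (\<lambda>z. complex_of_real (cmod (rep_L2 f z)))"
  have rep: "AE z in circle_measure. rep_L2 g z = complex_of_real (cmod (rep_L2 f z))"
    unfolding g_def by (rule rep_abs_L2[OF sq])
  have "(norm g)\<^sup>2 = (norm f)\<^sup>2"
    unfolding norm_L2_integral
    by (rule integral_cong_AE) (use rep in \<open>auto elim: eventually_mono\<close>)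
  then have norm_g: "norm g = norm f"
    by (simp add: power2_eq_iff_nonneg)
  have int: "integrable circle_measure (\<lambda>z. cmod (rep_L2 f z))"
    using integrable_Re[OF square_integrable_product[OF sq square_integrable_powi[of 0]]] by simp
  have "complex_of_real (\<integral>z. cmod (rep_L2 f z) \<partial>circle_measure) = fourier_coeff g 0"
    unfolding fourier_coeff_rep integral_complex_of_real[symmetric]
    by (rule integral_cong_AE) (use rep in \<open>auto elim: eventually_mono\<close>)
  also have "cmod \<dots> \<le> norm f"
    using cinner_cauchy_schwarz[of g "monomial 0"] by (simp add: fourier_coeff_cinner norm_g)
  finally have "(\<integral>z. cmod (rep_L2 f z) \<partial>circle_measure) \<le> norm f"
    by (simp add: integral_nonneg_AE)
  then show ?thesis
    by (subst nn_integral_eq_integral[OF int]) (simp_all add: ennreal_leI)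
qed

instance L2 :: perfect_space
proof
  fix x :: L2
  show "\<not> open {x}"
  proof
    assume "open {x}"
    then obtain e where e: "e > 0" "ball x e \<subseteq> {x}"
      by (meson insertI1 open_contains_ball)
    have "x + (e / 2) *\<^sub>R monomial 0 \<in> ball x e"
      using e(1) by (simp add: dist_norm)
    with e(2) have "x + (e / 2) *\<^sub>R monomial 0 = x"
      by blast
    then have "norm ((e / 2) *\<^sub>R monomial 0) = 0"
      by (metis add.right_neutral add_left_cancel norm_zero)
    with e(1) show False
      by (simp only: norm_scaleR norm_monomial)
  qed
qed

text \<open>Riesz-Fischer: along a subsequence with increments below \<open>(1/2) ^ n\<close> the
  absolute increments have an integrable sum, so it converges almost everywhere, and the pointwise
  limit is also the limit in norm.\<close>

instance L2 :: banach
proof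
  fix X :: "nat \<Rightarrow> L2"
  assume X: "Cauchy X"
  have "\<forall>n. \<exists>N. \<forall>i\<ge>N. \<forall>j\<ge>N. norm (X i - X j) < (1/2) ^ n"
    using CauchyD[OF X] by simp
  then obtain N where N: "\<And>n i j. i \<ge> N n \<Longrightarrow> j \<ge> N n \<Longrightarrow> norm (X i - X j) < (1/2) ^ n"
    by metis
  \<comment> \<open>The two arguments of \<open>max\<close> place \<open>r n\<close> beyond
    \<open>N n\<close> and make \<open>r\<close> strictly increasing.\<close>
  define r where "r = rec_nat (N 0) (\<lambda>n k. max (N (Suc n)) (Suc k))"
  have r_Suc: "r (Suc n) = max (N (Suc n)) (Suc (r n))" for n
    by (simp add: r_def)
  have mono: "strict_mono r"
    by (rule strict_mono_Suc_iff[THEN iffD2]) (simp add: r_Suc less_max_iff_disj)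
  have r_ge: "r n \<ge> N n" for n
    by (cases n) (simp_all add: r_Suc, simp add: r_def)
  have close: "norm (X (r m) - X (r k)) < (1/2) ^ k" if "m \<ge> k" for m k
  proof -
    have "r m \<ge> r k"
      using mono that by (simp add: strict_mono_less_eq)
    then show ?thesis
      using N r_ge order_trans by blast
  qed
  define u where "u n = rep_L2 (X (r n))" for n
  have [measurable]: "u n \<in> borel_measurable circle_measure" for n
    by (simp add: u_def)
  have diff: "AE z in circle_measure. rep_L2 (X (r m) - X (r k)) z = u m z - u k z" for m k
    unfolding u_def by (rule rep_diff)
  have "(\<integral>\<^sup>+z. (\<Sum>n. ennreal (cmod (u (Suc n) z - u n z))) \<partial>circle_measure)
      = (\<Sum>n. \<integral>\<^sup>+z. ennreal (cmod (u (Suc n) z - u n z)) \<partial>circle_measure)"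
    by (rule nn_integral_suminf) measurable
  also have "\<dots> \<le> (\<Sum>n. ennreal ((1/2) ^ n))"
  proof (rule suminf_le)
    fix n
    have "(\<integral>\<^sup>+z. ennreal (cmod (u (Suc n) z - u n z)) \<partial>circle_measure)
        = (\<integral>\<^sup>+z. ennreal (cmod (rep_L2 (X (r (Suc n)) - X (r n)) z)) \<partial>circle_measure)"
      by (rule nn_integral_cong_AE) (use diff[of "Suc n" n] in \<open>auto elim: eventually_mono\<close>)
    also have "\<dots> \<le> ennreal ((1/2) ^ n)"
      using integral_norm_le_norm close[of n "Suc n"] by (meson ennreal_leI le_SucI less_imp_le order_refl order_trans)
    finally show "(\<integral>\<^sup>+z. ennreal (cmod (u (Suc n) z - u n z)) \<partial>circle_measure) \<le> ennreal ((1/2) ^ n)" .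
  qed auto
  also have "\<dots> = ennreal 2"
    by (subst suminf_ennreal_eq[OF _ power_half_series[THEN sums_mult[of _ _ 2], simplified]]) simp_all
  finally have "(\<integral>\<^sup>+z. (\<Sum>n. ennreal (cmod (u (Suc n) z - u n z))) \<partial>circle_measure) \<noteq> \<infinity>"
    by (auto simp: top_unique)
  then have "AE z in circle_measure. (\<Sum>n. ennreal (cmod (u (Suc n) z - u n z))) \<noteq> \<infinity>"
    by (intro nn_integral_PInf_AE) measurable
  then have conv: "AE z in circle_measure. convergent (\<lambda>n. u n z)"
  proof eventually_elim
    case (elim z)
    then have "summable (\<lambda>n. cmod (u (Suc n) z - u n z))"
      by (intro summable_suminf_not_top) auto
    then have "summable (\<lambda>n. u (Suc n) z - u n z)"
      by (rule summable_norm_cancel)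
    then have "(\<lambda>n. u n z - u 0 z) \<longlonglongrightarrow> (\<Sum>n. u (Suc n) z - u n z)"
      using sum_lessThan_telescope[of "\<lambda>n. u n z"] summable_LIMSEQ[of "\<lambda>n. u (Suc n) z - u n z"]
      by simp
    then show ?case
      using convergent_diff_const_right_iff convergentI by blast
  qed
  define f where "f z = lim (\<lambda>n. u n z)" for z
  have [measurable]: "f \<in> borel_measurable circle_measure"
    unfolding f_def by measurable
  have lim: "AE z in circle_measure. (\<lambda>n. u n z) \<longlonglongrightarrow> f z"
    using conv unfolding f_def by eventually_elim (simp add: convergent_LIMSEQ_iff)
  \<comment> \<open>Fatou's lemma, applied to \<open>m\<close> tending to infinity in the Cauchy
    estimate for \<open>u m - u k\<close>.\<close>
  have bound: "(\<integral>\<^sup>+z. ennreal ((cmod (f z - u k z))\<^sup>2) \<partial>circle_measure) \<le> ennreal (((1/2) ^ k)\<^sup>2)" for k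
  proof -
    have "(\<integral>\<^sup>+z. ennreal ((cmod (f z - u k z))\<^sup>2) \<partial>circle_measure)
        = (\<integral>\<^sup>+z. liminf (\<lambda>m. ennreal ((cmod (u m z - u k z))\<^sup>2)) \<partial>circle_measure)"
    proof (rule nn_integral_cong_AE)
      show "AE z in circle_measure. ennreal ((cmod (f z - u k z))\<^sup>2)
          = liminf (\<lambda>m. ennreal ((cmod (u m z - u k z))\<^sup>2))"
        using lim
      proof eventually_elim
        case (elim z)
        then have "(\<lambda>m. ennreal ((cmod (u m z - u k z))\<^sup>2)) \<longlonglongrightarrow> ennreal ((cmod (f z - u k z))\<^sup>2)"
          by (intro tendsto_intros)
        then show ?case
          by (rule lim_imp_Liminf[OF trivial_limit_sequentially, symmetric])
      qed
    qed
    also have "\<dots> \<le> liminf (\<lambda>m. \<integral>\<^sup>+z. ennreal ((cmod (u m z - u k z))\<^sup>2) \<partial>circle_measure)"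
      by (rule nn_integral_liminf) measurable
    also have "\<dots> \<le> ennreal (((1/2) ^ k)\<^sup>2)"
    proof (rule Liminf_le)
      show "\<forall>\<^sub>F m in sequentially. (\<integral>\<^sup>+z. ennreal ((cmod (u m z - u k z))\<^sup>2) \<partial>circle_measure)
          \<le> ennreal (((1/2) ^ k)\<^sup>2)"
        using eventually_ge_at_top[of k]
      proof eventually_elim
        case (elim m)
        have "(\<integral>\<^sup>+z. ennreal ((cmod (u m z - u k z))\<^sup>2) \<partial>circle_measure)
            = (\<integral>\<^sup>+z. ennreal ((cmod (rep_L2 (X (r m) - X (r k)) z))\<^sup>2) \<partial>circle_measure)"
          by (rule nn_integral_cong_AE) (use diff[of m k] in \<open>auto elim: eventually_mono\<close>)
        also have "\<dots> = ennreal ((norm (X (r m) - X (r k)))\<^sup>2)"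
          by (rule norm_L2_nn)
        also have "\<dots> \<le> ennreal (((1/2) ^ k)\<^sup>2)"
          using close[OF elim] by (intro ennreal_leI power_mono) simp_all
        finally show ?case .
      qed
    qed simp
    finally show ?thesis .
  qed
  have sq_diff: "square_integrable (\<lambda>z. f z - u k z)" for k
    unfolding square_integrable_def
  proof
    show "integrable circle_measure (\<lambda>z. (cmod (f z - u k z))\<^sup>2)"
    proof (rule integrableI_bounded)
      have "(\<integral>\<^sup>+z. ennreal (norm ((cmod (f z - u k z))\<^sup>2)) \<partial>circle_measure) \<le> ennreal (((1/2) ^ k)\<^sup>2)"
        using bound[of k] by simp
      also have "\<dots> < \<infinity>" by simp
      finally show "(\<integral>\<^sup>+z. ennreal (norm ((cmod (f z - u k z))\<^sup>2)) \<partial>circle_measure) < \<infinity>" .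
    qed measurable
  qed measurable
  have "square_integrable (\<lambda>z. (f z - u 0 z) + u 0 z)"
    by (intro square_integrable_add sq_diff) (simp add: u_def square_integrable_rep)
  then have sq: "square_integrable f"
    by simp
  define l where "l = abs_L2 f"
  have rep_l: "AE z in circle_measure. rep_L2 l z = f z"
    unfolding l_def by (rule rep_abs_L2[OF sq])
  have "norm (l - X (r k)) \<le> (1/2) ^ k" for k
  proof -
    have "ennreal ((norm (l - X (r k)))\<^sup>2) = (\<integral>\<^sup>+z. ennreal ((cmod (f z - u k z))\<^sup>2) \<partial>circle_measure)"
      unfolding norm_L2_nn[symmetric]
    proof (rule nn_integral_cong_AE)
      show "AE z in circle_measure. ennreal ((cmod (rep_L2 (l - X (r k)) z))\<^sup>2) = ennreal ((cmod (f z - u k z))\<^sup>2)"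
        using rep_l rep_diff[of l "X (r k)"] by eventually_elim (simp add: u_def)
    qed
    then have "ennreal ((norm (l - X (r k)))\<^sup>2) \<le> ennreal (((1/2) ^ k)\<^sup>2)"
      using bound[of k] by (simp only:)
    then have "(norm (l - X (r k)))\<^sup>2 \<le> ((1/2) ^ k)\<^sup>2"
      by (subst (asm) ennreal_le_iff) simp_all
    then show ?thesis
      by (rule power2_le_imp_le) simp
  qed
  then have "(\<lambda>k. X (r k) - l) \<longlonglongrightarrow> 0"
    by (intro Lim_null_comparison[OF _ LIMSEQ_power_zero[of "1/2 :: real"]])
      (simp_all add: norm_minus_commute)
  then have "(X \<circ> r) \<longlonglongrightarrow> l"
    by (simp add: LIM_zero_iff o_def)
  then show "convergent X"
    using Cauchy_converges_subseq[OF X mono] convergentI by blast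
qed

section \<open>Uniqueness of Fourier coefficients\<close>

text \<open>Asks for integrability only, since it is applied to products of two functions in
  \<open>L2\<close>.\<close>

definition vanishing_moments :: "(complex \<Rightarrow> complex) \<Rightarrow> bool" where
  "vanishing_moments f \<longleftrightarrow> integrable circle_measure f \<and> (\<forall>n::int. (\<integral>z. z powi n * f z \<partial>circle_measure) = 0)"

lemma integrable_bounded_mult:
  fixes f g :: "complex \<Rightarrow> complex"
  assumes f: "integrable circle_measure f" and [measurable]: "g \<in> borel_measurable circle_measure"
    and g: "\<And>z. z \<in> space circle_measure \<Longrightarrow> cmod (g z) \<le> C"
  shows "integrable circle_measure (\<lambda>z. g z * f z)"
proof (rule Bochner_Integration.integrable_bound)
  show "integrable circle_measure (\<lambda>z. of_real C * f z)"
    using f by simp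
  show "AE z in circle_measure. norm (g z * f z) \<le> norm (of_real C * f z)"
    using g by (intro AE_I2) (auto simp: norm_mult intro!: mult_right_mono order_trans[OF _ abs_ge_self])
qed (use f in measurable)

lemma integrable_powi_mult: "integrable circle_measure f \<Longrightarrow> integrable circle_measure (\<lambda>z. z powi n * f z)"
  by (rule integrable_bounded_mult[of _ _ 1]) (simp_all add: norm_power_int norm_circle)

lemma vanishing_moments_add:
  "vanishing_moments f \<Longrightarrow> vanishing_moments g \<Longrightarrow> vanishing_moments (\<lambda>z. f z + g z)"
  by (simp add: vanishing_moments_def distrib_left integrable_powi_mult)

lemma vanishing_moments_cmult: "vanishing_moments f \<Longrightarrow> vanishing_moments (\<lambda>z. c * f z)"
  by (simp add: vanishing_moments_def mult.left_commute[of _ c])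

lemma vanishing_moments_cong:
  assumes "vanishing_moments f" "\<And>z. z \<in> space circle_measure \<Longrightarrow> f z = g z"
  shows "vanishing_moments g"
proof -
  have "integrable circle_measure f \<longleftrightarrow> integrable circle_measure g"
    "(\<integral>z. z powi n * f z \<partial>circle_measure) = (\<integral>z. z powi n * g z \<partial>circle_measure)" for n
    using assms(2) by (auto intro!: Bochner_Integration.integrable_cong Bochner_Integration.integral_cong)
  with assms(1) show ?thesis
    by (simp add: vanishing_moments_def)
qed

lemma vanishing_moments_shift:
  assumes "vanishing_moments f"
  shows "vanishing_moments (\<lambda>z. z powi m * f z)"
proof -
  have "(\<integral>z. z powi n * (z powi m * f z) \<partial>circle_measure) = (\<integral>z. z powi (n + m) * f z \<partial>circle_measure)" for n
    by (rule Bochner_Integration.integral_cong) (simp_all add: powi_add_circle mult.assoc)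
  with assms show ?thesis
    by (simp add: vanishing_moments_def integrable_powi_mult)
qed

text \<open>On the circle a real-linear function of \<open>z\<close> is a combination of \<open>z\<close> and \<open>z\<^sup>-\<^sup>1\<close>, so multiplying by
  a polynomial in the coordinates keeps all moments zero.\<close>

lemma vanishing_moments_polynomial:
  "real_polynomial_function p \<Longrightarrow> vanishing_moments f \<Longrightarrow> vanishing_moments (\<lambda>z. of_real (p z) * f z)"
proof (induction arbitrary: f rule: real_polynomial_function.induct)
  case (linear h)
  define a b where "a = (of_real (h 1) - \<i> * of_real (h \<i>)) / 2"
    and "b = (of_real (h 1) + \<i> * of_real (h \<i>)) / 2"
  have "vanishing_moments (\<lambda>z. a * (z powi 1 * f z) + b * (z powi (- 1) * f z))"
    by (intro vanishing_moments_add vanishing_moments_cmult vanishing_moments_shift linear.prems)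
  then show ?case
  proof (rule vanishing_moments_cong)
    fix z assume z: "z \<in> space circle_measure"
    interpret h: bounded_linear h by fact
    have "h z = h (Re z *\<^sub>R 1 + Im z *\<^sub>R \<i>)"
      by (rule arg_cong[of _ _ h]) (simp add: complex_eq_iff)
    then have "h z = Re z * h 1 + Im z * h \<i>"
      by (simp only: h.add h.scaleR real_scaleR_def)
    then have "of_real (h z) = a * z + b * cnj z"
      by (simp add: a_def b_def complex_eq_iff field_simps)
    then show "a * (z powi 1 * f z) + b * (z powi (- 1) * f z) = of_real (h z) * f z"
      by (simp add: power_int_minus cnj_circle[OF z] algebra_simps)
  qed
next
  case (const c)
  then show ?case by (simp add: vanishing_moments_cmult)
next
  case (add p q)
  then show ?case by (simp add: distrib_right vanishing_moments_add)
next
  case (mult p q)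
  then show ?case by (simp add: mult.assoc)
qed

text \<open>A polynomial within \<open>e\<close> of \<open>g\<close> on the circle contributes
  nothing, so the integral is at most \<open>e\<close> times the integral of
  \<open>cmod (f z)\<close>.\<close>

lemma vanishing_moments_continuous:
  fixes g :: "complex \<Rightarrow> real"
  assumes f: "vanishing_moments f" and g: "continuous_on UNIV g"
  shows "(\<integral>z. of_real (g z) * f z \<partial>circle_measure) = 0"
proof -
  have f_int: "integrable circle_measure f"
    using f by (simp add: vanishing_moments_def)
  note [measurable] = borel_measurable_integrable[OF f_int]
  let ?I = "\<integral>z. cmod (f z) \<partial>circle_measure"
  have est: "cmod (\<integral>z. of_real (g z) * f z \<partial>circle_measure) \<le> e * ?I" if e: "e > 0" for e
  proof -
    obtain p where p: "real_polynomial_function p" "\<And>z. z \<in> sphere 0 1 \<Longrightarrow> \<bar>g z - p z\<bar> < e"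
      using Stone_Weierstrass_real_polynomial_function[of "sphere 0 1" g e] compact_sphere[of "0 :: complex" 1]
        continuous_on_subset[OF g subset_UNIV, of "sphere 0 1"] e
      by metis
    have V: "vanishing_moments (\<lambda>z. of_real (p z) * f z)"
      by (rule vanishing_moments_polynomial[OF p(1) f])
    have "continuous_on UNIV (\<lambda>z. g z - p z)"
      by (intro continuous_intros g continuous_on_polymonial_function)
         (use p(1) in \<open>simp add: real_polynomial_function_eq\<close>)
    then have "(\<lambda>z. complex_of_real (g z - p z)) \<in> borel_measurable circle_measure"
      by (intro measurable_circle borel_measurable_continuous_onI continuous_on_of_real)
    then have int: "integrable circle_measure (\<lambda>z. of_real (g z - p z) * f z)"
    proof (rule integrable_bounded_mult[OF f_int])
      show "cmod (complex_of_real (g z - p z)) \<le> e" if "z \<in> space circle_measure" for z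
        unfolding norm_of_real using p(2)[of z] that by (simp add: space_circle)
    qed
    have "(\<integral>z. of_real (g z) * f z \<partial>circle_measure)
        = (\<integral>z. of_real (g z - p z) * f z + of_real (p z) * f z \<partial>circle_measure)"
      by (simp add: algebra_simps)
    also have "\<dots> = (\<integral>z. of_real (g z - p z) * f z \<partial>circle_measure) + (\<integral>z. of_real (p z) * f z \<partial>circle_measure)"
      using int V by (intro Bochner_Integration.integral_add) (auto simp: vanishing_moments_def)
    also have "(\<integral>z. of_real (p z) * f z \<partial>circle_measure) = 0"
      using V[unfolded vanishing_moments_def, THEN conjunct2, rule_format, of 0] by simp
    finally have "cmod (\<integral>z. of_real (g z) * f z \<partial>circle_measure)
        \<le> (\<integral>z. cmod (of_real (g z - p z) * f z) \<partial>circle_measure)"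
      by simp
    also have "\<dots> \<le> (\<integral>z. e * cmod (f z) \<partial>circle_measure)"
      using int f_int p(2)
      by (intro integral_mono integrable_norm integrable_mult_right)
        (auto simp: norm_mult space_circle less_imp_le simp flip: of_real_diff intro!: mult_right_mono)
    finally show ?thesis by simp
  qed
  have I0: "0 \<le> ?I" by simp
  have "cmod (\<integral>z. of_real (g z) * f z \<partial>circle_measure) \<le> 0 + e" if "e > 0" for e
  proof -
    have "cmod (\<integral>z. of_real (g z) * f z \<partial>circle_measure) \<le> e / (?I + 1) * ?I"
      by (intro est divide_pos_pos \<open>e > 0\<close> add_nonneg_pos I0 zero_less_one)
    also have "\<dots> \<le> 0 + e"
      using \<open>e > 0\<close> add_nonneg_pos[OF I0 zero_less_one] by (simp add: field_simps)
    finally show ?thesis .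
  qed
  then have "cmod (\<integral>z. of_real (g z) * f z \<partial>circle_measure) \<le> 0"
    by (rule field_le_epsilon)
  then show ?thesis by simp
qed

lemma indicator_closed_limit:
  fixes K :: "'a::metric_space set"
  assumes "closed K" "K \<noteq> {}"
  shows "(\<lambda>n. max 0 (1 - real n * infdist z K)) \<longlonglongrightarrow> indicator K z"
proof (cases "z \<in> K")
  case False
  then have d: "infdist z K > 0"
    using assms by (simp add: infdist_pos_not_in_closed)
  then obtain N where N: "1 < real N * infdist z K"
    using reals_Archimedean3 by blast
  have "max 0 (1 - real n * infdist z K) = 0" if "n \<ge> N" for n
  proof -
    have "real N * infdist z K \<le> real n * infdist z K"
      using that d by (intro mult_right_mono) auto
    with N show ?thesis by simp
  qed
  then have "\<forall>\<^sub>F n in sequentially. max 0 (1 - real n * infdist z K) = 0"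
    using eventually_sequentially by blast
  then show ?thesis
    using False by (simp add: tendsto_eventually)
qed simp

text \<open>Dynkin's argument over the closed sets, which are stable under intersection and generate
  the Borel sets; their indicators are dominated limits of continuous functions.\<close>

lemma vanishing_moments_indicator:
  assumes f: "vanishing_moments f" and A: "A \<in> sets borel"
  shows "(\<integral>z. indicator A z *\<^sub>R f z \<partial>circle_measure) = 0"
proof -
  have f_int: "integrable circle_measure f"
    using f by (simp add: vanishing_moments_def)
  note [measurable] = borel_measurable_integrable[OF f_int]
  have ind [measurable]: "indicator A \<in> borel_measurable circle_measure" if "A \<in> sets borel" for A :: "complex set"
    using that by (intro measurable_circle borel_measurable_indicator)
  have A: "A \<in> sigma_sets UNIV (Collect closed)"
    using A borel_eq_closed by (metis sets_measure_of subset_UNIV Pow_UNIV)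
  have borel: "B \<in> sets borel" if "B \<in> sigma_sets UNIV (Collect closed)" for B :: "complex set"
    using that borel_eq_closed by (metis sets_measure_of subset_UNIV Pow_UNIV)
  have ind_int: "integrable circle_measure (\<lambda>z. indicator B z *\<^sub>R f z)" if "B \<in> sets borel" for B :: "complex set"
    unfolding scaleR_conv_of_real
  proof (rule integrable_bounded_mult[OF f_int])
    show "(\<lambda>z. complex_of_real (indicator B z)) \<in> borel_measurable circle_measure"
      using ind[OF that] by measurable
    show "cmod (complex_of_real (indicator B z)) \<le> 1" for z
      by (simp add: indicator_def)
  qed
  have stable: "Int_stable (Collect closed :: complex set set)"
    by (auto simp: Int_stable_def)
  have "Collect closed \<subseteq> Pow (UNIV :: complex set)"
    by simp
  from stable this A show ?thesis
  proof (induction rule: sigma_sets_induct_disjoint)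
    case (basic K)
    show ?case
    proof (cases "K = {}")
      case False
      have cont: "continuous_on UNIV (\<lambda>z. max 0 (1 - real n * infdist z K))" for n
        by (intro continuous_intros)
      have "(\<lambda>n. \<integral>z. max 0 (1 - real n * infdist z K) *\<^sub>R f z \<partial>circle_measure)
          \<longlonglongrightarrow> (\<integral>z. indicator K z *\<^sub>R f z \<partial>circle_measure)"
      proof (rule integral_dominated_convergence[where w = "\<lambda>z. cmod (f z)"])
        show "(\<lambda>z. indicator K z *\<^sub>R f z) \<in> borel_measurable circle_measure"
          using basic by (intro borel_measurable_integrable ind_int) auto
        show "(\<lambda>z. max 0 (1 - real n * infdist z K) *\<^sub>R f z) \<in> borel_measurable circle_measure" for n
          by (intro borel_measurable_scaleR measurable_circle[OF borel_measurable_continuous_onI[OF cont]]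
              borel_measurable_integrable[OF f_int])
        show "AE z in circle_measure. (\<lambda>n. max 0 (1 - real n * infdist z K) *\<^sub>R f z) \<longlonglongrightarrow> indicator K z *\<^sub>R f z"
          using basic False by (intro AE_I2 tendsto_intros indicator_closed_limit) auto
        show "AE z in circle_measure. norm (max 0 (1 - real n * infdist z K) *\<^sub>R f z) \<le> cmod (f z)" for n
          by (intro AE_I2) (auto simp: infdist_nonneg intro!: mult_left_le_one_le)
      qed (use f_int in simp)
      moreover have "(\<integral>z. max 0 (1 - real n * infdist z K) *\<^sub>R f z \<partial>circle_measure) = 0" for n
        using vanishing_moments_continuous[OF f cont] by (simp add: scaleR_conv_of_real)
      ultimately show ?thesis
        by (simp add: LIMSEQ_const_iff)
    qed simp
  next
    case (compl B)
    have "(\<integral>z. indicator (UNIV - B) z *\<^sub>R f z \<partial>circle_measure)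
        = (\<integral>z. f z - indicator B z *\<^sub>R f z \<partial>circle_measure)"
      by (intro Bochner_Integration.integral_cong) (auto split: split_indicator)
    also have "\<dots> = (\<integral>z. f z \<partial>circle_measure) - (\<integral>z. indicator B z *\<^sub>R f z \<partial>circle_measure)"
      by (intro Bochner_Integration.integral_diff f_int ind_int borel compl.hyps)
    also have "\<dots> = 0"
      using compl f[unfolded vanishing_moments_def, THEN conjunct2, rule_format, of 0] by simp
    finally show ?case .
  next
    case (union B)
    have B: "B i \<in> sets borel" for i
      using union.hyps by (intro borel) auto
    have "(\<lambda>k. \<integral>z. indicator (\<Union>i<k. B i) z *\<^sub>R f z \<partial>circle_measure)
        \<longlonglongrightarrow> (\<integral>z. indicator (\<Union>i. B i) z *\<^sub>R f z \<partial>circle_measure)"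
    proof (rule integral_dominated_convergence[where w = "\<lambda>z. cmod (f z)"])
      show "(\<lambda>z. indicator (\<Union>i. B i) z *\<^sub>R f z) \<in> borel_measurable circle_measure"
        "(\<lambda>z. indicator (\<Union>i<k. B i) z *\<^sub>R f z) \<in> borel_measurable circle_measure" for k
        using B by (intro borel_measurable_integrable ind_int sets.countable_UN; auto)+
      show "AE z in circle_measure. (\<lambda>k. indicator (\<Union>i<k. B i) z *\<^sub>R f z) \<longlonglongrightarrow> indicator (\<Union>i. B i) z *\<^sub>R f z"
        by (intro AE_I2 tendsto_intros LIMSEQ_indicator_UN)
      show "AE z in circle_measure. norm (indicator (\<Union>i<k. B i) z *\<^sub>R f z) \<le> cmod (f z)" for k
        by (intro AE_I2) (simp add: indicator_def)
    qed (use f_int in simp)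
    moreover have "(\<integral>z. indicator (\<Union>i<k. B i) z *\<^sub>R f z \<partial>circle_measure) = 0" for k
    proof -
      have "(\<integral>z. indicator (\<Union>i<k. B i) z *\<^sub>R f z \<partial>circle_measure)
          = (\<integral>z. (\<Sum>i<k. indicator (B i) z *\<^sub>R f z) \<partial>circle_measure)"
        using union.hyps(1)
        by (intro Bochner_Integration.integral_cong refl)
          (simp add: indicator_UN_disjoint disjoint_family_on_mono[OF subset_UNIV] scaleR_sum_left)
      also have "\<dots> = 0"
        using union.IH by (subst Bochner_Integration.integral_sum) (auto intro: ind_int B)
      finally show ?thesis .
    qed
    ultimately show ?case
      by (simp add: LIMSEQ_const_iff)
  qed auto
qed

lemma vanishing_moments_AE_zero:
  assumes f: "vanishing_moments f"
  shows "AE z in circle_measure. f z = 0"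
proof (rule circle.density_zero)
  show "integrable circle_measure f"
    using f by (simp add: vanishing_moments_def)
  fix A assume "A \<in> sets circle_measure"
  then obtain B where B: "B \<in> sets borel" "A = sphere 0 1 \<inter> B"
    by (auto simp: sets_circle sets_restrict_space)
  have "set_lebesgue_integral circle_measure A f = (\<integral>z. indicator B z *\<^sub>R f z \<partial>circle_measure)"
    unfolding set_lebesgue_integral_def
    by (intro Bochner_Integration.integral_cong) (auto simp: B space_circle split: split_indicator)
  then show "set_lebesgue_integral circle_measure A f = 0"
    using vanishing_moments_indicator[OF f B(1)] by simp
qed

lemma L2_integrable: "integrable circle_measure (rep_L2 f)"
  using square_integrable_product[OF square_integrable_rep square_integrable_powi[of 0]] by simp

lemma fourier_coeff_moment: "fourier_coeff f (- n) = (\<integral>z. z powi n * rep_L2 f z \<partial>circle_measure)"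
  unfolding fourier_coeff_rep
  by (intro Bochner_Integration.integral_cong refl) (simp only: cnj_powi_circle minus_minus mult.commute)

lemma fourier_coeff_zero_imp_zero:
  assumes "\<And>n. fourier_coeff f n = 0"
  shows "f = 0"
proof -
  have "vanishing_moments (rep_L2 f)"
    using assms by (simp add: vanishing_moments_def L2_integrable flip: fourier_coeff_moment)
  from vanishing_moments_AE_zero[OF this] rep_zero show ?thesis
    unfolding L2_eq_iff by eventually_elim simp
qed

section \<open>Closed complex subspaces\<close>

definition closed_csubspace :: "L2 set \<Rightarrow> bool" where
  "closed_csubspace S \<longleftrightarrow> closed S \<and> 0 \<in> S \<and> (\<forall>f\<in>S. \<forall>g\<in>S. f + g \<in> S) \<and> (\<forall>c. \<forall>f\<in>S. c *\<^sub>C f \<in> S)"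

lemma closed_csubspace_subspace: "closed_csubspace S \<Longrightarrow> subspace S"
  by (simp add: closed_csubspace_def subspace_def scaleR_scaleC)

lemma closed_csubspace_diff: "closed_csubspace S \<Longrightarrow> f \<in> S \<Longrightarrow> g \<in> S \<Longrightarrow> f - g \<in> S"
  by (rule subspace_diff[OF closed_csubspace_subspace])

lemma complex_orthogonal_decomposition:
  assumes "closed_csubspace S"
  shows "\<exists>p\<in>S. \<forall>s\<in>S. cinner (x - p) s = 0"
proof -
  obtain p where p: "p \<in> S" "\<forall>s\<in>S. (x - p) \<bullet> s = 0"
    using orthogonal_decomposition[OF closed_csubspace_subspace[OF assms], of x] assms
    by (auto simp: closed_csubspace_def)
  have "cinner (x - p) s = 0" if "s \<in> S" for s
    unfolding cinner_inner using p(2) that assms by (simp add: closed_csubspace_def)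
  with p(1) show ?thesis by blast
qed

lemma bounded_linear_cinner: "bounded_linear (\<lambda>f. cinner f g)"
proof (rule bounded_linear_intro)
  show "cinner (f + h) g = cinner f g + cinner h g" for f h
    by (rule cinner_add_left)
  show "cinner (r *\<^sub>R f) g = r *\<^sub>R cinner f g" for r f
    by (simp add: scaleR_scaleC cinner_scaleC_left scaleR_conv_of_real)
  show "norm (cinner f g) \<le> norm f * norm g" for f
    by (rule cinner_cauchy_schwarz)
qed

lemma fourier_coeff_linear:
  "fourier_coeff (f + g) n = fourier_coeff f n + fourier_coeff g n"
  "fourier_coeff (f - g) n = fourier_coeff f n - fourier_coeff g n"
  "fourier_coeff (c *\<^sub>C f) n = c * fourier_coeff f n"
  "fourier_coeff 0 n = 0"
  by (simp_all add: fourier_coeff_cinner cinner_add_left cinner_diff_left cinner_scaleC_left)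

text \<open>One form for \<open>H2\<close> (with \<open>{..<0}\<close>), for \<open>z\<close> times
  \<open>H2\<close> (with \<open>{..<1}\<close>) and for complementary sets of frequencies, so that
  closedness and orthogonality are shown once.\<close>

definition vanishing_on :: "int set \<Rightarrow> L2 set" where
  "vanishing_on A = {f. \<forall>n\<in>A. fourier_coeff f n = 0}"

lemma H2_eq: "H2 = vanishing_on {..<0}"
  by (auto simp: H2_def vanishing_on_def)

lemma closed_csubspace_vanishing_on: "closed_csubspace (vanishing_on A)"
proof -
  have "closed {f. fourier_coeff f n = 0}" for n
    unfolding fourier_coeff_cinner
    by (intro closed_Collect_eq continuous_intros linear_continuous_on bounded_linear_cinner)
  then have "closed (\<Inter>n\<in>A. {f. fourier_coeff f n = 0})"
    by blast
  moreover have "(\<Inter>n\<in>A. {f. fourier_coeff f n = 0}) = vanishing_on A"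
    by (auto simp: vanishing_on_def)
  ultimately show ?thesis
    by (simp add: closed_csubspace_def vanishing_on_def fourier_coeff_linear)
qed

text \<open>A substitute for Parseval's identity: the projection \<open>p\<close> of
  \<open>a\<close> onto \<open>vanishing_on A\<close> has no nonzero Fourier coefficient, neither in
  \<open>A\<close> nor, by testing with monomials, outside it. So \<open>p = 0\<close>, and
  \<open>a\<close> itself is orthogonal to the subspace.\<close>

lemma vanishing_on_orthogonal:
  assumes a: "a \<in> vanishing_on (- A)" and b: "b \<in> vanishing_on A"
  shows "cinner a b = 0"
proof -
  obtain p where p: "p \<in> vanishing_on A" "\<forall>s\<in>vanishing_on A. cinner (a - p) s = 0"
    using complex_orthogonal_decomposition[OF closed_csubspace_vanishing_on] by blast
  have "fourier_coeff p n = 0" for n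
  proof (cases "n \<in> A")
    case False
    then have "monomial n \<in> vanishing_on A"
      by (auto simp: vanishing_on_def fourier_coeff_monomial)
    then have "fourier_coeff (a - p) n = 0"
      using p(2) by (simp add: fourier_coeff_cinner)
    with a False show ?thesis
      by (simp add: fourier_coeff_linear vanishing_on_def)
  qed (use p(1) in \<open>simp add: vanishing_on_def\<close>)
  then have "p = 0"
    by (rule fourier_coeff_zero_imp_zero)
  with p(2) b show ?thesis by simp
qed

lemma monomial_in_H2: "0 \<le> n \<Longrightarrow> monomial n \<in> H2"
  by (simp add: H2_def fourier_coeff_monomial)

lemma orthogonal_H2_iff: "(\<forall>g\<in>H2. cinner f g = 0) \<longleftrightarrow> (\<forall>n\<ge>0. fourier_coeff f n = 0)"
proof
  assume "\<forall>n\<ge>0. fourier_coeff f n = 0"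
  then have "f \<in> vanishing_on (- {..<0})"
    by (auto simp: vanishing_on_def)
  then show "\<forall>g\<in>H2. cinner f g = 0"
    unfolding H2_eq using vanishing_on_orthogonal by blast
qed (simp add: fourier_coeff_cinner monomial_in_H2)

text \<open>Justifies the description in \<open>proj\<close>: the characterisation of the nearest
  point makes the map complex-linear, contractive and selfadjoint, and every element of
  \<open>Gr\<close> with range \<open>S\<close> satisfies the same characterisation.\<close>

lemma proj_closed_csubspace:
  assumes S: "closed_csubspace S"
  shows "proj S \<in> Gr" "range (blinfun_apply (proj S)) = S"
    "s \<in> S \<Longrightarrow> cinner (x - blinfun_apply (proj S) x) s = 0"
proof -
  obtain f where f: "\<And>x. f x \<in> S" "\<And>x s. s \<in> S \<Longrightarrow> cinner (x - f x) s = 0"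
    using complex_orthogonal_decomposition[OF S] by metis
  have unique: "f x = p" if p: "p \<in> S" "\<And>s. s \<in> S \<Longrightarrow> cinner (x - p) s = 0" for x p
  proof -
    have d: "f x - p \<in> S"
      using S f(1) p(1) by (rule closed_csubspace_diff)
    have "cinner (f x - p) (f x - p) = cinner (x - p) (f x - p) - cinner (x - f x) (f x - p)"
      by (simp add: cinner_diff_left)
    also have "\<dots> = 0"
      using f(2) p(2) d by simp
    finally show ?thesis
      by (simp add: cinner_self_eq_norm)
  qed
  have f_add: "f (x + y) = f x + f y" for x y
  proof (rule unique)
    show "f x + f y \<in> S" using S f(1) by (simp add: closed_csubspace_def)
    show "cinner (x + y - (f x + f y)) s = 0" if "s \<in> S" for s
      using f(2)[OF that, of x] f(2)[OF that, of y] by (simp add: cinner_diff_left cinner_add_left)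
  qed
  have f_scale: "f (c *\<^sub>C x) = c *\<^sub>C f x" for c x
  proof (rule unique)
    show "c *\<^sub>C f x \<in> S" using S f(1) by (simp add: closed_csubspace_def)
    show "cinner (c *\<^sub>C x - c *\<^sub>C f x) s = 0" if "s \<in> S" for s
      using f(2)[OF that, of x] by (simp add: cinner_diff_left cinner_scaleC_left algebra_simps)
  qed
  have f_id: "f x = x" if "x \<in> S" for x
    using that by (intro unique) simp_all
  have f_left: "cinner (f x) y = cinner (f x) (f y)" for x y
    using f(2)[OF f(1)[of x], of y] by (metis cinner_commute cinner_diff_left complex_cnj_cancel_iff right_minus_eq)
  have f_norm: "norm (f x) \<le> norm x" for x
  proof (cases "f x = 0")
    case False
    have "of_real ((norm (f x))\<^sup>2) = cinner (f x) x"
      by (simp only: f_left[symmetric] flip: cinner_self_eq_norm)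
    then have "(norm (f x))\<^sup>2 \<le> norm (f x) * norm x"
      using cinner_cauchy_schwarz[of "f x" x] by (metis norm_of_real abs_of_nonneg zero_le_power2)
    with False show ?thesis
      by (simp add: power2_eq_square)
  qed simp
  have "bounded_linear f"
    by (rule bounded_linear_intro[where K = 1]) (simp_all add: f_add f_scale f_norm scaleR_scaleC)
  then have P: "blinfun_apply (Blinfun f) = f"
    by (rule bounded_linear_Blinfun_apply)
  have self: "cinner (f x) y = cinner x (f y)" for x y
    using f_left[of x y] f_left[of y x] by (metis cinner_commute)
  have Gr: "Blinfun f \<in> Gr"
    unfolding Gr_def bounded_ops_def selfadjoint_def
    by (auto simp: P f_scale self f_id f(1) intro!: blinfun_eqI)
  have range: "range (blinfun_apply (Blinfun f)) = S"
    unfolding P using f(1) f_id by (metis image_subset_iff rangeI subsetI subset_antisym)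
  have eq: "Q = Blinfun f" if Q: "Q \<in> Gr" "range (blinfun_apply Q) = S" for Q
  proof (rule blinfun_eqI)
    fix x
    have idem: "blinfun_apply Q (blinfun_apply Q y) = blinfun_apply Q y" for y
      using Q(1) unfolding Gr_def by (metis (mono_tags, lifting) blinfun_apply_blinfun_compose mem_Collect_eq)
    have "f x = blinfun_apply Q x"
    proof (rule unique)
      show "blinfun_apply Q x \<in> S" using Q(2) by blast
      fix s assume "s \<in> S"
      then obtain y where "s = blinfun_apply Q y"
        using Q(2) by blast
      then have "cinner (x - blinfun_apply Q x) s = cinner (blinfun_apply Q (x - blinfun_apply Q x)) y"
        using Q(1) by (simp add: Gr_def selfadjoint_def)
      then show "cinner (x - blinfun_apply Q x) s = 0"
        by (simp add: blinfun.diff_right idem)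
    qed
    then show "blinfun_apply Q x = blinfun_apply (Blinfun f) x"
      by (simp add: P)
  qed
  have "proj S = Blinfun f"
    unfolding proj_def by (rule the_equality) (use Gr range eq in blast)+
  then show "proj S \<in> Gr" "range (blinfun_apply (proj S)) = S"
    "s \<in> S \<Longrightarrow> cinner (x - blinfun_apply (proj S) x) s = 0"
    using Gr range f(2) by (simp_all add: P)
qed

section \<open>Multiplication operators\<close>

lemma LinfE:
  assumes "\<phi> \<in> Linf"
  obtains C where "\<phi> \<in> borel_measurable circle_measure" "0 \<le> C" "AE z in circle_measure. cmod (\<phi> z) \<le> C"
proof -
  obtain C where C: "\<phi> \<in> borel_measurable circle_measure" "AE z in circle_measure. cmod (\<phi> z) \<le> C"
    using assms by (auto simp: Linf_def)
  from C(2) have "AE z in circle_measure. cmod (\<phi> z) \<le> max C 0"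
    by eventually_elim simp
  with C(1) show ?thesis by (intro that[of "max C 0"]) auto
qed

lemma Linf_measurable [measurable_dest]: "\<phi> \<in> Linf \<Longrightarrow> \<phi> \<in> borel_measurable circle_measure"
  by (simp add: Linf_def)

lemma Linf_mult:
  assumes "\<phi> \<in> Linf" "\<eta> \<in> Linf"
  shows "(\<lambda>z. \<phi> z * \<eta> z) \<in> Linf"
proof -
  obtain C where C: "\<phi> \<in> borel_measurable circle_measure" "0 \<le> C" "AE z in circle_measure. cmod (\<phi> z) \<le> C"
    using assms(1) by (rule LinfE)
  obtain D where D: "\<eta> \<in> borel_measurable circle_measure" "0 \<le> D" "AE z in circle_measure. cmod (\<eta> z) \<le> D"
    using assms(2) by (rule LinfE)
  have "AE z in circle_measure. cmod (\<phi> z * \<eta> z) \<le> C * D"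
    using C(3) D(3) by eventually_elim (simp add: norm_mult mult_mono C(2))
  with C(1) D(1) show ?thesis
    by (auto simp: Linf_def)
qed

lemma Linf_cnj: "\<phi> \<in> Linf \<Longrightarrow> (\<lambda>z. cnj (\<phi> z)) \<in> Linf"
  by (auto simp: Linf_def)

lemma Linf_powi: "(\<lambda>z. z powi n) \<in> Linf"
  unfolding Linf_def
  by (auto intro!: exI[of _ 1] AE_I2 simp: norm_power_int norm_circle)

lemma Linf_inverse:
  assumes "Linf_invertible \<psi>"
  shows "(\<lambda>z. inverse (\<psi> z)) \<in> Linf" "AE z in circle_measure. \<psi> z \<noteq> 0"
proof -
  obtain \<eta> where \<eta>: "\<psi> \<in> Linf" "\<eta> \<in> Linf" "AE z in circle_measure. \<psi> z * \<eta> z = 1"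
    using assms by (auto simp: Linf_invertible_def)
  obtain C where C: "AE z in circle_measure. cmod (\<eta> z) \<le> C"
    using \<eta>(2) by (rule LinfE)
  from \<eta>(3) C have "AE z in circle_measure. cmod (inverse (\<psi> z)) \<le> C"
    by eventually_elim (metis inverse_unique)
  moreover have "(\<lambda>z. inverse (\<psi> z)) \<in> borel_measurable circle_measure"
    using \<eta>(1) by (intro borel_measurable_inverse Linf_measurable)
  ultimately show "(\<lambda>z. inverse (\<psi> z)) \<in> Linf"
    by (auto simp: Linf_def)
  show "AE z in circle_measure. \<psi> z \<noteq> 0"
    using \<eta>(3) by eventually_elim auto
qed

lemma rep_mult_op: "\<phi> \<in> Linf \<Longrightarrow> AE z in circle_measure. rep_L2 (mult_op \<phi> f) z = \<phi> z * rep_L2 f z"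
proof -
  assume \<phi>: "\<phi> \<in> Linf"
  then obtain C where "\<phi> \<in> borel_measurable circle_measure" "AE z in circle_measure. cmod (\<phi> z) \<le> C"
    by (rule LinfE)
  then have "square_integrable (\<lambda>z. \<phi> z * rep_L2 f z)"
    by (rule square_integrable_bounded_mult[OF square_integrable_rep])
  from rep_abs_L2[OF this] show ?thesis
    using \<phi> by (simp add: mult_op_def)
qed

lemma mult_op_mult:
  assumes "\<phi> \<in> Linf" "\<eta> \<in> Linf"
  shows "mult_op \<phi> (mult_op \<eta> f) = mult_op (\<lambda>z. \<phi> z * \<eta> z) f"
  unfolding L2_eq_iff
  using rep_mult_op[OF assms(1), of "mult_op \<eta> f"] rep_mult_op[OF assms(2), of f]
    rep_mult_op[OF Linf_mult[OF assms], of f]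
  by eventually_elim simp

lemma mult_op_commute:
  assumes "\<phi> \<in> Linf" "\<eta> \<in> Linf"
  shows "mult_op \<phi> (mult_op \<eta> f) = mult_op \<eta> (mult_op \<phi> f)"
  using assms by (simp add: mult_op_mult mult.commute)

lemma mult_op_inverse:
  assumes "\<phi> \<in> Linf" "\<eta> \<in> Linf" "AE z in circle_measure. \<phi> z * \<eta> z = 1"
  shows "mult_op \<phi> (mult_op \<eta> f) = f" "mult_op \<eta> (mult_op \<phi> f) = f"
proof -
  show 1: "mult_op \<phi> (mult_op \<eta> f) = f"
    unfolding L2_eq_iff mult_op_mult[OF assms(1,2)]
    using rep_mult_op[OF Linf_mult[OF assms(1,2)], of f] assms(3) by eventually_elim simp
  then show "mult_op \<eta> (mult_op \<phi> f) = f"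
    using mult_op_commute[OF assms(1,2)] by simp
qed

lemma mult_op_add:
  assumes "\<phi> \<in> Linf"
  shows "mult_op \<phi> (f + g) = mult_op \<phi> f + mult_op \<phi> g"
  unfolding L2_eq_iff
  using rep_mult_op[OF assms, of "f + g"] rep_mult_op[OF assms, of f] rep_mult_op[OF assms, of g]
    rep_add[of f g] rep_add[of "mult_op \<phi> f" "mult_op \<phi> g"]
  by eventually_elim (simp add: distrib_left)

lemma mult_op_scaleC:
  assumes "\<phi> \<in> Linf"
  shows "mult_op \<phi> (c *\<^sub>C f) = c *\<^sub>C mult_op \<phi> f"
  unfolding L2_eq_iff
  using rep_mult_op[OF assms, of "c *\<^sub>C f"] rep_mult_op[OF assms, of f]
    rep_scaleC[of c f] rep_scaleC[of c "mult_op \<phi> f"]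
  by eventually_elim simp

lemma mult_op_zero: "\<phi> \<in> Linf \<Longrightarrow> mult_op \<phi> 0 = 0"
  using mult_op_add[of \<phi> 0 0] by simp

lemma bounded_linear_mult_op:
  assumes \<phi>: "\<phi> \<in> Linf"
  shows "bounded_linear (mult_op \<phi>)"
proof -
  obtain C where C: "\<phi> \<in> borel_measurable circle_measure" "0 \<le> C" "AE z in circle_measure. cmod (\<phi> z) \<le> C"
    using \<phi> by (rule LinfE)
  have bound: "norm (mult_op \<phi> f) \<le> norm f * C" for f
  proof -
    have "(norm (mult_op \<phi> f))\<^sup>2 \<le> (\<integral>z. C\<^sup>2 * (cmod (rep_L2 f z))\<^sup>2 \<partial>circle_measure)"
      unfolding norm_L2_integral
    proof (rule integral_mono_AE)
      show "AE z in circle_measure. (cmod (rep_L2 (mult_op \<phi> f) z))\<^sup>2 \<le> C\<^sup>2 * (cmod (rep_L2 f z))\<^sup>2"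
        using rep_mult_op[OF \<phi>, of f] C(3)
        by eventually_elim (simp add: norm_mult power_mult_distrib mult_right_mono power_mono)
    qed (simp_all add: square_integrable_L2)
    also have "\<dots> = (norm f * C)\<^sup>2"
      by (simp add: norm_L2_integral power_mult_distrib)
    finally show ?thesis
      by (rule power2_le_imp_le) (simp add: C(2))
  qed
  show ?thesis
    by (rule bounded_linear_intro[OF _ _ bound])
      (simp_all add: mult_op_add[OF \<phi>] mult_op_scaleC[OF \<phi>] scaleR_scaleC)
qed

lemma cinner_mult_op:
  assumes \<phi>: "\<phi> \<in> Linf"
  shows "cinner (mult_op \<phi> f) g = cinner f (mult_op (\<lambda>z. cnj (\<phi> z)) g)"
  unfolding cinner_rep
proof (rule integral_cong_AE)
  show "AE z in circle_measure. rep_L2 (mult_op \<phi> f) z * cnj (rep_L2 g z)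
      = rep_L2 f z * cnj (rep_L2 (mult_op (\<lambda>z. cnj (\<phi> z)) g) z)"
    using rep_mult_op[OF \<phi>, of f] rep_mult_op[OF Linf_cnj[OF \<phi>], of g] by eventually_elim simp
qed measurable

definition shift :: "int \<Rightarrow> L2 \<Rightarrow> L2" where
  "shift n = mult_op (\<lambda>z. z powi n)"

lemma rep_shift: "AE z in circle_measure. rep_L2 (shift n f) z = z powi n * rep_L2 f z"
  unfolding shift_def by (rule rep_mult_op[OF Linf_powi])

lemma shift_monomial: "shift n (monomial m) = monomial (n + m)"
  unfolding L2_eq_iff using rep_shift[of n "monomial m"] rep_monomial[of m] rep_monomial[of "n + m"] AE_space
  by eventually_elim (simp add: powi_add_circle)

lemma shift_mult_op: "\<phi> \<in> Linf \<Longrightarrow> shift n (mult_op \<phi> f) = mult_op \<phi> (shift n f)"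
  unfolding shift_def by (intro mult_op_commute Linf_powi)

lemma cinner_shift: "cinner (shift n f) g = cinner f (shift (- n) g)"
  unfolding cinner_rep
proof (rule integral_cong_AE)
  show "AE z in circle_measure. rep_L2 (shift n f) z * cnj (rep_L2 g z)
      = rep_L2 f z * cnj (rep_L2 (shift (- n) g) z)"
    using rep_shift[of n f] rep_shift[of "- n" g] AE_space
  proof eventually_elim
    case (elim z)
    have "cnj (z powi (- n)) = z powi n"
      using cnj_powi_circle[OF elim(3), of "- n"] by simp
    then show ?case
      unfolding elim(1,2) complex_cnj_mult by simp
  qed
qed measurable

lemma fourier_coeff_shift: "fourier_coeff (shift n f) m = fourier_coeff f (m - n)"
  unfolding fourier_coeff_cinner cinner_shift shift_monomial by simp

lemma shift_H2: "0 \<le> n \<Longrightarrow> f \<in> H2 \<Longrightarrow> shift n f \<in> H2"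
  by (simp add: H2_def fourier_coeff_shift)

lemma closed_csubspace_H2: "closed_csubspace H2"
  unfolding H2_eq by (rule closed_csubspace_vanishing_on)

text \<open>With \<open>\<eta>\<close> inverse to \<open>\<psi>\<close>, the image under
  \<open>mult_op \<psi>\<close> is the preimage under the continuous
  \<open>mult_op \<eta>\<close>.\<close>

lemma closed_csubspace_mult_op:
  assumes "Linf_invertible \<psi>" and S: "closed_csubspace S"
  shows "closed_csubspace (mult_op \<psi> ` S)"
proof -
  obtain \<eta> where \<eta>: "\<psi> \<in> Linf" "\<eta> \<in> Linf" "AE z in circle_measure. \<psi> z * \<eta> z = 1"
    using assms(1) by (auto simp: Linf_invertible_def)
  have eq: "mult_op \<psi> ` S = mult_op \<eta> -` S"
  proof (intro subset_antisym subsetI)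
    fix x assume "x \<in> mult_op \<eta> -` S"
    then have "mult_op \<psi> (mult_op \<eta> x) \<in> mult_op \<psi> ` S"
      by blast
    then show "x \<in> mult_op \<psi> ` S"
      by (simp add: mult_op_inverse[OF \<eta>])
  qed (auto simp: mult_op_inverse[OF \<eta>])
  have "closed (mult_op \<eta> -` S)"
    using S linear_continuous_on[OF bounded_linear_mult_op[OF \<eta>(2)], of UNIV]
    by (auto simp: closed_csubspace_def intro: closed_vimage)
  with S show ?thesis
    unfolding eq closed_csubspace_def
    by (simp add: mult_op_add[OF \<eta>(2)] mult_op_scaleC[OF \<eta>(2)] mult_op_zero[OF \<eta>(2)])
qed

section \<open>Invariant subspaces and Toeplitz kernels\<close>

text \<open>Beurling's argument: a unit vector \<open>v\<close> of \<open>\<psi>H\<^sup>2\<close> orthogonal to \<open>z\<psi>H\<^sup>2\<close> has constant modulus and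
  generates \<open>\<psi>H\<^sup>2\<close>.\<close>

lemma unimodular_generator:
  assumes \<psi>: "Linf_invertible \<psi>"
  obtains v where "v \<in> Linf" "AE z in circle_measure. cmod (v z) = 1" "mult_op v ` H2 = mult_op \<psi> ` H2"
proof -
  obtain \<eta> where \<eta>: "\<psi> \<in> Linf" "\<eta> \<in> Linf" "AE z in circle_measure. \<psi> z * \<eta> z = 1"
    using \<psi> by (auto simp: Linf_invertible_def)
  define M where "M = mult_op \<psi> ` H2"
  define M1 where "M1 = mult_op \<psi> ` vanishing_on {..<1}"
  have M: "closed_csubspace M" and M1: "closed_csubspace M1"
    unfolding M_def M1_def
    by (intro closed_csubspace_mult_op \<psi> closed_csubspace_H2 closed_csubspace_vanishing_on)+
  have M1_M: "M1 \<subseteq> M"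
    unfolding M_def M1_def H2_eq by (intro image_mono) (auto simp: vanishing_on_def)
  have shift_M: "shift n f \<in> M" if "f \<in> M" "0 \<le> n" for n f
    using that \<eta>(1) shift_H2 by (auto simp: M_def shift_mult_op)
  have shift_M1: "shift n f \<in> M1" if "f \<in> M" "1 \<le> n" for n f
    using that \<eta>(1)
    by (auto simp: M_def M1_def shift_mult_op vanishing_on_def fourier_coeff_shift H2_def)
  \<comment> \<open>The function \<open>\<psi>\<close> itself, which lies in \<open>M\<close> but
    not in \<open>M1\<close>; so its component orthogonal to \<open>M1\<close> is nonzero.\<close>
  define x where "x = mult_op \<psi> (monomial 0)"
  have x: "x \<in> M" "x \<notin> M1"
  proof -
    show "x \<in> M" by (simp add: x_def M_def monomial_in_H2)
    show "x \<notin> M1"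
    proof
      assume "x \<in> M1"
      then have "mult_op \<eta> x \<in> vanishing_on {..<1}"
        using mult_op_inverse(2)[OF \<eta>] by (auto simp: M1_def)
      then have "fourier_coeff (monomial 0) 0 = 0"
        using mult_op_inverse(2)[OF \<eta>] by (simp add: x_def vanishing_on_def)
      then show False by (simp add: fourier_coeff_monomial)
    qed
  qed
  obtain p where p: "p \<in> M1" "\<forall>s\<in>M1. cinner (x - p) s = 0"
    using complex_orthogonal_decomposition[OF M1] by blast
  have ne: "x - p \<noteq> 0"
    using x(2) p(1) by auto
  define w where "w = (1 / norm (x - p)) *\<^sub>R (x - p)"
  have norm_w: "norm w = 1"
    using ne by (simp add: w_def)
  have w_M: "w \<in> M"
    unfolding w_def
    by (intro subspace_scale[OF closed_csubspace_subspace[OF M]] closed_csubspace_diff[OF M] x(1) subsetD[OF M1_M p(1)])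
  have w_orth: "cinner w s = 0" if "s \<in> M1" for s
    using p(2) that by (simp add: w_def scaleR_scaleC cinner_scaleC_left)
  define v where "v = rep_L2 w"
  have v_int: "integrable circle_measure (\<lambda>z. v z * cnj (v z))"
    unfolding v_def by (rule cinner_integrable)
  \<comment> \<open>For \<open>n \<ge> 1\<close> the vector \<open>shift n w\<close> lies in
    \<open>M1\<close>, hence is orthogonal to \<open>w\<close>; for negative \<open>n\<close> the
    shift moves to the other argument. So the squared modulus of \<open>v\<close> has the moments of
    the constant \<open>1\<close>.\<close>
  have v_moment: "(\<integral>z. z powi n * (v z * cnj (v z)) \<partial>circle_measure) = (if n = 0 then 1 else 0)" for n
  proof -
    have eq: "(\<integral>z. z powi n * (v z * cnj (v z)) \<partial>circle_measure) = cinner (shift n w) w"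
      unfolding cinner_rep
    proof (rule integral_cong_AE)
      show "AE z in circle_measure. z powi n * (v z * cnj (v z)) = rep_L2 (shift n w) z * cnj (rep_L2 w z)"
        using rep_shift[of n w] by eventually_elim (simp add: v_def)
    qed (unfold v_def, measurable)
    consider "n = 0" | "n \<ge> 1" | "n \<le> -1" by linarith
    then show ?thesis
    proof cases
      case 1
      have "cinner w w = 1"
        by (simp add: cinner_self_eq_norm norm_w)
      then show ?thesis
        using 1 by (simp add: cinner_rep v_def)
    next
      case 2
      then show ?thesis
        using w_orth[OF shift_M1[OF w_M 2]] eq by (metis cinner_commute complex_cnj_zero not_one_le_zero)
    next
      case 3
      then show ?thesis
        using w_orth[OF shift_M1[OF w_M, of "- n"]] eq by (simp add: cinner_shift)
    qed
  qed
  have "vanishing_moments (\<lambda>z. v z * cnj (v z) - 1)"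
    unfolding vanishing_moments_def
  proof (intro conjI allI)
    show "integrable circle_measure (\<lambda>z. v z * cnj (v z) - 1)"
      using v_int by simp
    show "(\<integral>z. z powi n * (v z * cnj (v z) - 1) \<partial>circle_measure) = 0" for n
      using integrable_powi_mult[OF v_int, of n] integrable_powi_mult[of "\<lambda>_. 1" n]
      by (simp add: right_diff_distrib v_moment integral_powi_circle)
  qed
  from vanishing_moments_AE_zero[OF this] have v_unit: "AE z in circle_measure. v z * cnj (v z) = 1"
    by eventually_elim simp
  then have v_norm: "AE z in circle_measure. cmod (v z) = 1"
  proof eventually_elim
    case (elim z)
    then have "complex_of_real ((cmod (v z))\<^sup>2) = 1"
      by (simp only: complex_norm_square)
    then have "(cmod (v z))\<^sup>2 = 1"
      by (simp only: of_real_eq_1_iff)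
    then show ?case
      by (simp add: power2_eq_1_iff) (use norm_ge_zero[of "v z"] in linarith)
  qed
  have v_meas: "v \<in> borel_measurable circle_measure"
    unfolding v_def by (rule measurable_rep)
  have v: "v \<in> Linf"
    unfolding Linf_def using v_meas v_norm by (auto intro!: exI[of _ 1] elim: eventually_mono)
  have cv: "(\<lambda>z. cnj (v z)) \<in> Linf"
    by (rule Linf_cnj[OF v])
  \<comment> \<open>Multiplication by the conjugate of \<open>v\<close> turns inner products with
    the shifts of \<open>w\<close> into Fourier coefficients, which decide membership in
    \<open>H2\<close>.\<close>
  have coeff: "fourier_coeff (mult_op (\<lambda>z. cnj (v z)) m) n = cinner m (shift n w)" for m n
  proof -
    have "cinner (mult_op (\<lambda>z. cnj (v z)) m) (monomial n) = cinner m (mult_op v (monomial n))"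
      using cinner_mult_op[OF cv] by simp
    also have "mult_op v (monomial n) = shift n w"
      unfolding L2_eq_iff
      using rep_mult_op[OF v, of "monomial n"] rep_monomial[of n] rep_shift[of n w]
      by eventually_elim (simp add: v_def)
    finally show ?thesis
      by (simp add: fourier_coeff_cinner)
  qed
  have "mult_op v ` H2 = M"
  proof
    show "M \<subseteq> mult_op v ` H2"
    proof
      fix m assume m: "m \<in> M"
      have "fourier_coeff (mult_op (\<lambda>z. cnj (v z)) m) n = 0" if "n < 0" for n
      proof -
        have "cinner m (shift n w) = cinner (shift (- n) m) w"
          by (simp add: cinner_shift)
        also have "\<dots> = 0"
          using w_orth[OF shift_M1[OF m, of "- n"]] that by (subst cinner_commute) simp
        finally show ?thesis by (simp add: coeff)
      qed
      then have "mult_op (\<lambda>z. cnj (v z)) m \<in> H2"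
        by (simp add: H2_def)
      moreover have "m = mult_op v (mult_op (\<lambda>z. cnj (v z)) m)"
        using mult_op_inverse(1)[OF v cv v_unit] by simp
      ultimately show "m \<in> mult_op v ` H2" by blast
    qed
    show "mult_op v ` H2 \<subseteq> M"
    proof
      fix y assume "y \<in> mult_op v ` H2"
      then obtain k where k: "k \<in> H2" "y = mult_op v k" by blast
      \<comment> \<open>\<open>y - q\<close> is orthogonal to \<open>M\<close>, in particular to
        \<open>shift n w\<close> for \<open>n \<ge> 0\<close>. Hence its product with the conjugate
        of \<open>v\<close> is orthogonal to \<open>H2\<close>, and \<open>y - q\<close> is
        orthogonal to \<open>y\<close> as well as to \<open>q\<close>.\<close>
      obtain q where q: "q \<in> M" "\<forall>s\<in>M. cinner (y - q) s = 0"
        using complex_orthogonal_decomposition[OF M] by blast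
      have "\<forall>n\<ge>0. fourier_coeff (mult_op (\<lambda>z. cnj (v z)) (y - q)) n = 0"
        using q(2) shift_M[OF w_M] by (simp add: coeff)
      then have "cinner (mult_op (\<lambda>z. cnj (v z)) (y - q)) k = 0"
        using orthogonal_H2_iff k(1) by blast
      then have "cinner (y - q) y = 0"
        using cinner_mult_op[OF cv] k(2) by simp
      moreover have "cinner (y - q) q = 0"
        using q by blast
      ultimately have "cinner (y - q) (y - q) = 0"
        by (simp add: cinner_diff_right)
      then have "y = q"
        by (simp add: cinner_self_eq_norm)
      with q(1) show "y \<in> M" by simp
    qed
  qed
  with v v_norm show ?thesis
    by (intro that[of v]) (simp_all add: M_def)
qed

lemma toeplitz_kernel_iff:
  assumes "\<theta> \<in> Linf"
  shows "f \<in> toeplitz_kernel \<theta> \<longleftrightarrow> f \<in> H2 \<and> (\<forall>g\<in>H2. cinner (mult_op \<theta> f) g = 0)"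
proof -
  note P = proj_closed_csubspace[OF closed_csubspace_H2]
  let ?x = "mult_op \<theta> f" and ?P = "blinfun_apply (proj H2)"
  have "?P ?x = 0 \<longleftrightarrow> (\<forall>g\<in>H2. cinner ?x g = 0)"
  proof
    assume "?P ?x = 0"
    then show "\<forall>g\<in>H2. cinner ?x g = 0"
      using P(3)[of _ ?x] by simp
  next
    assume *: "\<forall>g\<in>H2. cinner ?x g = 0"
    have mem: "?P ?x \<in> H2" using P(2) by blast
    have "cinner (?P ?x) (?P ?x) = cinner ?x (?P ?x) - cinner (?x - ?P ?x) (?P ?x)"
      by (simp add: cinner_diff_left)
    also have "\<dots> = 0"
      using * P(3)[OF mem] mem by simp
    finally show "?P ?x = 0"
      by (simp add: cinner_self_eq_norm)
  qed
  then show ?thesis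
    by (auto simp: toeplitz_kernel_def toeplitz_def)
qed

text \<open>\<open>\<psi>H\<^sup>2 = vH\<^sup>2\<close> with \<open>v\<^sup>-\<^sup>1\<close> the conjugate of \<open>v\<close>, so orthogonality to \<open>\<psi>H\<^sup>2\<close> is a Toeplitz condition, and
  multiplication by \<open>v\<^sup>-\<^sup>1\<psi>\<close> is a bijection of \<open>H\<^sup>2\<close>.\<close>

lemma toeplitz_kernel_trivial_iff:
  assumes \<phi>: "Linf_invertible \<phi>" and \<psi>: "Linf_invertible \<psi>"
  shows "toeplitz_kernel (\<lambda>z. \<phi> z * inverse (\<psi> z)) = {0} \<longleftrightarrow>
    (\<forall>f\<in>H2. (\<forall>g\<in>H2. cinner (mult_op \<phi> f) (mult_op \<psi> g) = 0) \<longrightarrow> f = 0)"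
proof -
  have \<phi>L: "\<phi> \<in> Linf" and \<psi>L: "\<psi> \<in> Linf"
    using \<phi> \<psi> by (auto simp: Linf_invertible_def)
  define \<eta> where "\<eta> = (\<lambda>z. inverse (\<psi> z))"
  have \<eta>: "\<eta> \<in> Linf" and inv: "AE z in circle_measure. \<psi> z * \<eta> z = 1"
    using Linf_inverse[OF \<psi>] by (auto simp: \<eta>_def elim: eventually_mono)
  obtain v where v: "v \<in> Linf" "AE z in circle_measure. cmod (v z) = 1" "mult_op v ` H2 = mult_op \<psi> ` H2"
    by (rule unimodular_generator[OF \<psi>])
  define u where "u = (\<lambda>z. cnj (v z))"
  have u: "u \<in> Linf"
    unfolding u_def by (rule Linf_cnj[OF v(1)])
  have vu: "AE z in circle_measure. v z * u z = 1"
    using v(2) by eventually_elim (simp add: u_def complex_norm_square[symmetric])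
  note cancel = mult_op_inverse[OF \<psi>L \<eta> inv] mult_op_inverse[OF v(1) u vu]
  have orth: "(\<forall>g\<in>H2. cinner (mult_op \<phi> f) (mult_op \<psi> g) = 0) \<longleftrightarrow>
      (\<forall>g\<in>H2. cinner (mult_op u (mult_op \<phi> f)) g = 0)" for f
  proof -
    have "(\<forall>g\<in>H2. cinner (mult_op \<phi> f) (mult_op \<psi> g) = 0) \<longleftrightarrow> (\<forall>y\<in>mult_op \<psi> ` H2. cinner (mult_op \<phi> f) y = 0)"
      by blast
    also have "\<dots> \<longleftrightarrow> (\<forall>g\<in>H2. cinner (mult_op \<phi> f) (mult_op v g) = 0)"
      unfolding v(3)[symmetric] by blast
    finally show ?thesis
      using cinner_mult_op[OF u] by (simp add: u_def)
  qed
  have ker: "f \<in> toeplitz_kernel (\<lambda>z. \<phi> z * \<eta> z) \<longleftrightarrow>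
      f \<in> H2 \<and> (\<forall>g\<in>H2. cinner (mult_op \<phi> (mult_op \<eta> f)) g = 0)" for f
    by (simp add: toeplitz_kernel_iff Linf_mult \<phi>L \<eta> mult_op_mult)
  have H2_1: "mult_op u (mult_op \<psi> f) \<in> H2" if "f \<in> H2" for f
  proof -
    have "mult_op \<psi> f \<in> mult_op v ` H2"
      unfolding v(3) using that by (rule imageI)
    then obtain k where "k \<in> H2" "mult_op \<psi> f = mult_op v k"
      by blast
    then show ?thesis by (simp add: cancel)
  qed
  have H2_2: "mult_op \<eta> (mult_op v f) \<in> H2" if "f \<in> H2" for f
  proof -
    have "mult_op v f \<in> mult_op \<psi> ` H2"
      unfolding v(3)[symmetric] using that by (rule imageI)
    then obtain k where "k \<in> H2" "mult_op v f = mult_op \<psi> k"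
      by blast
    then show ?thesis by (simp add: cancel)
  qed
  have "toeplitz_kernel (\<lambda>z. \<phi> z * \<eta> z) = {0} \<longleftrightarrow> (\<forall>f\<in>toeplitz_kernel (\<lambda>z. \<phi> z * \<eta> z). f = 0)"
    using ker[of 0] by (auto simp: H2_def fourier_coeff_linear mult_op_zero \<phi>L \<eta>)
  also have "\<dots> \<longleftrightarrow> (\<forall>f\<in>H2. (\<forall>g\<in>H2. cinner (mult_op \<phi> f) (mult_op \<psi> g) = 0) \<longrightarrow> f = 0)"
  proof (intro iffI ballI impI)
    fix f assume *: "\<forall>f\<in>toeplitz_kernel (\<lambda>z. \<phi> z * \<eta> z). f = 0" and f: "f \<in> H2"
      and "\<forall>g\<in>H2. cinner (mult_op \<phi> f) (mult_op \<psi> g) = 0"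
    then have o: "\<forall>g\<in>H2. cinner (mult_op u (mult_op \<phi> f)) g = 0"
      by (simp add: orth)
    \<comment> \<open>The candidate in the Toeplitz kernel is \<open>u * \<psi> * f\<close>: the
      factors \<open>\<eta>\<close> and \<open>\<psi>\<close> cancel and leave the function that
      \<open>orth\<close> speaks of.\<close>
    have "mult_op \<phi> (mult_op \<eta> (mult_op u (mult_op \<psi> f))) = mult_op u (mult_op \<phi> f)"
      by (simp add: mult_op_commute[OF \<eta> u] mult_op_commute[OF \<phi>L u] cancel)
    with o have "mult_op u (mult_op \<psi> f) \<in> toeplitz_kernel (\<lambda>z. \<phi> z * \<eta> z)"
      using H2_1[OF f] by (simp add: ker)
    with * have "mult_op u (mult_op \<psi> f) = 0" by blast
    then have "mult_op \<eta> (mult_op v (mult_op u (mult_op \<psi> f))) = 0"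
      by (simp add: mult_op_zero v(1) \<eta>)
    then show "f = 0" by (simp add: cancel)
  next
    fix f assume *: "\<forall>f\<in>H2. (\<forall>g\<in>H2. cinner (mult_op \<phi> f) (mult_op \<psi> g) = 0) \<longrightarrow> f = 0"
      and "f \<in> toeplitz_kernel (\<lambda>z. \<phi> z * \<eta> z)"
    then have f: "f \<in> H2" "\<forall>g\<in>H2. cinner (mult_op \<phi> (mult_op \<eta> f)) g = 0"
      by (simp_all add: ker)
    have "mult_op u (mult_op \<phi> (mult_op \<eta> (mult_op v f))) = mult_op \<phi> (mult_op \<eta> f)"
      by (simp add: mult_op_commute[OF \<eta> v(1)] mult_op_commute[OF \<phi>L v(1)] cancel)
    with f(2) have "\<forall>g\<in>H2. cinner (mult_op \<phi> (mult_op \<eta> (mult_op v f))) (mult_op \<psi> g) = 0"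
      by (simp add: orth)
    with * H2_2[OF f(1)] have "mult_op \<eta> (mult_op v f) = 0" by blast
    then have "mult_op u (mult_op \<psi> (mult_op \<eta> (mult_op v f))) = 0"
      by (simp add: mult_op_zero u \<psi>L)
    then show "f = 0" by (simp add: cancel)
  qed
  finally show ?thesis by (simp add: \<eta>_def)
qed

section \<open>Zero products in the Hardy space and Coburn's alternative\<close>

lemma lowest_coefficient:
  assumes "f \<in> H2" "f \<noteq> 0"
  obtains k where "fourier_coeff f k \<noteq> 0" "f \<in> vanishing_on {..<k}"
proof -
  obtain n where n: "fourier_coeff f n \<noteq> 0"
    using fourier_coeff_zero_imp_zero assms(2) by blast
  then have "n \<ge> 0"
    using assms(1) by (auto simp: H2_def not_less[symmetric])
  define k where "k = (LEAST j. fourier_coeff f (int j) \<noteq> 0)"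
  have "fourier_coeff f (int (nat n)) \<noteq> 0"
    using n \<open>n \<ge> 0\<close> by simp
  then have "fourier_coeff f (int k) \<noteq> 0"
    unfolding k_def by (rule LeastI)
  moreover have "fourier_coeff f m = 0" if "m < int k" for m
  proof (cases "m < 0")
    case False
    then have "nat m < k" using that by simp
    then have "fourier_coeff f (int (nat m)) = 0"
      unfolding k_def using not_less_Least by blast
    with False show ?thesis by simp
  qed (use assms(1) in \<open>simp add: H2_def\<close>)
  ultimately show ?thesis
    by (intro that[of "int k"]) (auto simp: vanishing_on_def)
qed

text \<open>If \<open>k\<close> and \<open>m\<close> are the lowest frequencies of \<open>f\<close>
  and \<open>g\<close>, the coefficient of \<open>f * g\<close> at \<open>k + m\<close> is the
  product of the two lowest coefficients, hence nonzero. It is computed as the inner product of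
  \<open>f\<close> with \<open>b\<close>, the conjugate of \<open>g\<close> shifted by
  \<open>k + m\<close>.\<close>

lemma H2_product_zero:
  assumes f: "f \<in> H2" and g: "g \<in> H2" and zero: "AE z in circle_measure. rep_L2 f z * rep_L2 g z = 0"
  shows "f = 0 \<or> g = 0"
proof (rule ccontr)
  assume "\<not> ?thesis"
  then obtain k m where k: "fourier_coeff f k \<noteq> 0" "f \<in> vanishing_on {..<k}"
    and m: "fourier_coeff g m \<noteq> 0" "g \<in> vanishing_on {..<m}"
    using lowest_coefficient f g by metis
  have sq: "square_integrable (\<lambda>z. cnj (rep_L2 g z))"
    using square_integrable_L2[of g] by (simp add: square_integrable_def)
  define b where "b = shift (k + m) (abs_L2 (\<lambda>z. cnj (rep_L2 g z)))"
  have rep_b: "AE z in circle_measure. rep_L2 b z = z powi (k + m) * cnj (rep_L2 g z)"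
    using rep_shift[of "k + m" "abs_L2 (\<lambda>z. cnj (rep_L2 g z))"] rep_abs_L2[OF sq]
    unfolding b_def by eventually_elim simp
  have coeff_b: "fourier_coeff b n = cnj (fourier_coeff g (k + m - n))" for n
  proof -
    have "fourier_coeff (abs_L2 (\<lambda>z. cnj (rep_L2 g z))) j = cnj (fourier_coeff g (- j))" for j
    proof -
      have "fourier_coeff (abs_L2 (\<lambda>z. cnj (rep_L2 g z))) j
          = (\<integral>z. cnj (rep_L2 g z * cnj (z powi (- j))) \<partial>circle_measure)"
        unfolding fourier_coeff_rep
      proof (rule integral_cong_AE)
        show "AE z in circle_measure. rep_L2 (abs_L2 (\<lambda>z. cnj (rep_L2 g z))) z * cnj (z powi j)
            = cnj (rep_L2 g z * cnj (z powi (- j)))"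
          using rep_abs_L2[OF sq] AE_space
        proof eventually_elim
          case (elim z)
          show ?case
            unfolding elim(1) cnj_powi_circle[OF elim(2)] complex_cnj_mult by simp
        qed
      qed measurable
      then show ?thesis
        by (simp only: Bochner_Integration.integral_cnj fourier_coeff_rep)
    qed
    then show ?thesis
      by (simp add: b_def fourier_coeff_shift)
  qed
  \<comment> \<open>\<open>b\<close> has no frequency above \<open>k\<close>; without its term at
    \<open>k\<close> it is orthogonal to \<open>f\<close>, which starts at \<open>k\<close>.\<close>
  define b' where "b' = b - cnj (fourier_coeff g m) *\<^sub>C monomial k"
  have "b' \<in> vanishing_on {k..}"
    using m(2) by (auto simp: vanishing_on_def b'_def fourier_coeff_linear fourier_coeff_monomial coeff_b)
  moreover have "f \<in> vanishing_on (- {k..})"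
    using k(2) by (auto simp: vanishing_on_def)
  ultimately have "cinner f b' = 0"
    by (intro vanishing_on_orthogonal)
  then have "cinner f b = fourier_coeff g m * fourier_coeff f k"
    by (simp add: b'_def cinner_diff_right cinner_scaleC_right fourier_coeff_cinner[of f])
  moreover have "cinner f b = (\<integral>z. 0 \<partial>circle_measure)"
    unfolding cinner_rep
  proof (rule integral_cong_AE)
    show "AE z in circle_measure. rep_L2 f z * cnj (rep_L2 b z) = 0"
      using rep_b zero by eventually_elim auto
  qed measurable
  ultimately show False
    using k(1) m(1) by simp
qed

text \<open>Coburn's alternative: all moments of \<open>\<phi>f\<close> times the conjugate of \<open>\<psi>g\<close> vanish.\<close>

lemma coburn_alternative:
  assumes \<phi>: "Linf_invertible \<phi>" and \<psi>: "Linf_invertible \<psi>" and f: "f \<in> H2" and g: "g \<in> H2"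
    and f_orth: "\<forall>h\<in>H2. cinner (mult_op \<phi> f) (mult_op \<psi> h) = 0"
    and g_orth: "\<forall>h\<in>H2. cinner (mult_op \<psi> g) (mult_op \<phi> h) = 0"
  shows "f = 0 \<or> g = 0"
proof -
  have \<phi>L: "\<phi> \<in> Linf" and \<psi>L: "\<psi> \<in> Linf"
    using \<phi> \<psi> by (auto simp: Linf_invertible_def)
  let ?F = "\<lambda>z. rep_L2 (mult_op \<phi> f) z * cnj (rep_L2 (mult_op \<psi> g) z)"
  have "vanishing_moments ?F"
    unfolding vanishing_moments_def
  proof (intro conjI allI)
    show "integrable circle_measure ?F"
      by (rule cinner_integrable)
    fix n :: int
    have eq: "(\<integral>z. z powi n * ?F z \<partial>circle_measure) = cinner (shift n (mult_op \<phi> f)) (mult_op \<psi> g)"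
      unfolding cinner_rep
    proof (rule integral_cong_AE)
      show "AE z in circle_measure. z powi n * ?F z
          = rep_L2 (shift n (mult_op \<phi> f)) z * cnj (rep_L2 (mult_op \<psi> g) z)"
        using rep_shift[of n "mult_op \<phi> f"] by eventually_elim simp
    qed measurable
    show "(\<integral>z. z powi n * ?F z \<partial>circle_measure) = 0"
    \<comment> \<open>For \<open>n \<ge> 0\<close> the power of \<open>z\<close> keeps
      \<open>f\<close> in \<open>H2\<close> and the orthogonality of \<open>g\<close> applies; for
      \<open>n < 0\<close> it is moved onto \<open>g\<close>, and that of \<open>f\<close>
      applies.\<close>
    proof (cases "n \<ge> 0")
      case True
      then have "cinner (mult_op \<psi> g) (shift n (mult_op \<phi> f)) = 0"
        using g_orth shift_H2[OF _ f] by (simp add: shift_mult_op[OF \<phi>L])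
      then show ?thesis
        unfolding eq by (metis cinner_commute complex_cnj_zero)
    next
      case False
      then have "cinner (mult_op \<phi> f) (shift (- n) (mult_op \<psi> g)) = 0"
        using f_orth shift_H2[OF _ g] by (simp add: shift_mult_op[OF \<psi>L])
      then show ?thesis
        unfolding eq by (simp add: cinner_shift)
    qed
  qed
  \<comment> \<open>The symbols do not vanish almost everywhere on a set of positive measure, so
    \<open>f\<close> times the conjugate of \<open>g\<close> is zero almost everywhere, and so is
    \<open>f * g\<close>.\<close>
  from vanishing_moments_AE_zero[OF this] rep_mult_op[OF \<phi>L, of f] rep_mult_op[OF \<psi>L, of g]
    Linf_inverse(2)[OF \<phi>] Linf_inverse(2)[OF \<psi>]
  have "AE z in circle_measure. rep_L2 f z * rep_L2 g z = 0"
    by eventually_elim auto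
  with f g show ?thesis
    by (rule H2_product_zero)
qed

section \<open>Projections in \<open>L\<^sup>2\<close> as symmetries\<close>

definition J :: "L2 endo" where "J = Endo (Blinfun (scaleC \<i>))"

definition sym_of :: "(L2 \<Rightarrow>\<^sub>L L2) \<Rightarrow> L2 endo" where
  "sym_of P = 2 *\<^sub>R Endo P - 1"

lemma Endo_app [simp]: "Endo A \<cdot> x = blinfun_apply A x"
  by (simp add: app.abs_eq eq_onp_same_args)

lemma J_app [simp]: "J \<cdot> x = \<i> *\<^sub>C x"
  by (simp add: J_def bounded_linear_Blinfun_apply bounded_linear_scaleC)

lemma Endo_simps:
  fixes A B :: "'a::{real_normed_vector, perfect_space} \<Rightarrow>\<^sub>L 'a"
  shows "Endo 0 = (0 :: 'a endo)" "Endo id_blinfun = (1 :: 'a endo)" "Endo (A + B) = Endo A + Endo B"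
  "Endo (A - B) = Endo A - Endo B" "Endo (A o\<^sub>L B) = Endo A * Endo B" "Endo (r *\<^sub>R A) = r *\<^sub>R Endo A"
  "norm (Endo A) = norm A"
  by (rule endo_eqI; simp add: blinfun.bilinear_simps)+
    (simp add: norm_endo.abs_eq eq_onp_same_args)

lemma Endo_inject_iff: "Endo A = Endo B \<longleftrightarrow> A = B"
  by (simp add: Endo_inject)

text \<open>Real-linearity is built into the type, so commuting with \<open>\<i>\<close> extends to
  all complex scalars.\<close>

lemma bounded_ops_iff: "A \<in> bounded_ops \<longleftrightarrow> J * Endo A = Endo A * J"
proof
  assume "A \<in> bounded_ops"
  then show "J * Endo A = Endo A * J"
    by (intro endo_eqI) (simp add: bounded_ops_def)
next
  assume *: "J * Endo A = Endo A * J"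
  have i: "blinfun_apply A (\<i> *\<^sub>C f) = \<i> *\<^sub>C blinfun_apply A f" for f
    using arg_cong[OF *, of "\<lambda>B. B \<cdot> f"] by simp
  have split: "c *\<^sub>C f = Re c *\<^sub>R f + Im c *\<^sub>R (\<i> *\<^sub>C f)" for c f
    unfolding scaleR_scaleC scaleC_scaleC scaleC_add_left[symmetric]
    by (rule arg_cong[of _ _ "\<lambda>c. c *\<^sub>C f"]) (simp add: complex_eq_iff)
  have "blinfun_apply A (c *\<^sub>C f) = c *\<^sub>C blinfun_apply A f" for c f
    unfolding split[of c f] split[of c "blinfun_apply A f"] by (simp only: blinfun.bilinear_simps i)
  then show "A \<in> bounded_ops"
    by (simp add: bounded_ops_def)
qed

lemma selfadjoint_iff:
  assumes "A \<in> bounded_ops"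
  shows "selfadjoint A \<longleftrightarrow> adj (Endo A) (Endo A)"
proof
  assume "selfadjoint A"
  then show "adj (Endo A) (Endo A)"
    by (simp add: selfadjoint_def adj_def inner_L2_def)
next
  assume *: "adj (Endo A) (Endo A)"
  have "blinfun_apply A f \<bullet> g = f \<bullet> blinfun_apply A g" for f g
    using * by (simp add: adj_def)
  moreover have "blinfun_apply A (\<i> *\<^sub>C g) = \<i> *\<^sub>C blinfun_apply A g" for g
    using assms by (simp add: bounded_ops_def)
  ultimately show "selfadjoint A"
    unfolding selfadjoint_def cinner_inner by metis
qed

lemma Gr_iff: "P \<in> Gr \<longleftrightarrow> J * Endo P = Endo P * J \<and> adj (Endo P) (Endo P) \<and> Endo P * Endo P = Endo P"
  by (auto simp: Gr_def bounded_ops_iff selfadjoint_iff Endo_inject_iff simp flip: Endo_simps(5))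

lemma adj_J: "adj J (- J)"
proof -
  have "cinner x (- y) = - cinner x y" for x y
    using cinner_diff_right[of x 0 y] by simp
  then show ?thesis
    by (simp add: adj_def inner_L2_def cinner_scaleC_left cinner_scaleC_right)
qed

lemma J_squared: "J * J = - 1"
  by (rule endo_eqI) (simp add: scaleC_scaleC uminus_L2_def)

lemma symmetry_pair_Gr:
  assumes "P \<in> Gr" "Q \<in> Gr"
  shows "symmetry_pair J (sym_of P) (sym_of Q)"
proof -
  have *: "sym_of P * sym_of P = 1 \<and> adj (sym_of P) (sym_of P) \<and> J * sym_of P = sym_of P * J" if "P \<in> Gr" for P
  proof -
    have P: "J * Endo P = Endo P * J" "adj (Endo P) (Endo P)" "Endo P * Endo P = Endo P"
      using that by (auto simp: Gr_iff)
    have "sym_of P * sym_of P = 1"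
      by (simp add: sym_of_def left_diff_distrib right_diff_distrib distrib_left distrib_right P(3) scaleR_2)
    moreover have "adj (sym_of P) (sym_of P)"
      unfolding sym_of_def by (intro adj_diff adj_scaleR adj_1 P(2))
    ultimately show ?thesis
      using P(1) by (simp add: sym_of_def left_diff_distrib right_diff_distrib)
  qed
  show ?thesis
    using *[OF assms(1)] *[OF assms(2)] by unfold_locales (auto simp: J_squared adj_J)
qed

lemma sym_of_half: "(1/2) *\<^sub>R (1 + sym_of P) = Endo P"
  by (simp add: sym_of_def)

text \<open>Both sides amount to \<open>P X + X P = X\<close>: multiplying this by \<open>P\<close>
  gives \<open>P X P = 0\<close>, and the other corner is the difference of the two sides up to
  \<open>P X P\<close>.\<close>

lemma codiagonal_iff: "codiagonal P X \<longleftrightarrow> sym_of P * Endo X = - (Endo X * sym_of P)" if "P \<in> Gr"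
proof -
  let ?P = "Endo P" and ?X = "Endo X"
  have PP: "?P * ?P = ?P"
    using that by (simp add: Gr_iff)
  have "sym_of P * ?X = - (?X * sym_of P) \<longleftrightarrow> 2 *\<^sub>R (?P * ?X + ?X * ?P) = 2 *\<^sub>R ?X"
    by (simp add: sym_of_def left_diff_distrib right_diff_distrib scaleR_right_distrib scaleR_2 algebra_simps)
  also have "\<dots> \<longleftrightarrow> ?P * ?X + ?X * ?P = ?X"
    by simp
  also have "\<dots> \<longleftrightarrow> ?P * ?X * ?P = 0 \<and> (1 - ?P) * ?X * (1 - ?P) = 0"
  proof
    assume *: "?P * ?X + ?X * ?P = ?X"
    have "?P * (?P * ?X + ?X * ?P) = ?P * ?X + ?P * ?X * ?P"
      by (simp add: distrib_left PP mult.assoc[symmetric])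
    with * have 1: "?P * ?X * ?P = 0"
      by simp
    moreover have "(1 - ?P) * ?X * (1 - ?P) = ?X - (?P * ?X + ?X * ?P) + ?P * ?X * ?P"
      by (simp add: algebra_simps)
    ultimately show "?P * ?X * ?P = 0 \<and> (1 - ?P) * ?X * (1 - ?P) = 0"
      using * by simp
  next
    assume *: "?P * ?X * ?P = 0 \<and> (1 - ?P) * ?X * (1 - ?P) = 0"
    have "?X - (?P * ?X + ?X * ?P) = (1 - ?P) * ?X * (1 - ?P) - ?P * ?X * ?P"
      by (simp add: algebra_simps)
    also have "\<dots> = 0"
      using * by simp
    finally show "?P * ?X + ?X * ?P = ?X"
      by simp
  qed
  also have "\<dots> \<longleftrightarrow> codiagonal P X"
    unfolding codiagonal_def Endo_inject_iff[symmetric] Endo_simps by simp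
  finally show ?thesis ..
qed

section \<open>Geodesics of projections translated into arcs of symmetries\<close>

lemma Endo_exp_op: "Endo (exp_op A) = exp (Endo A)"
proof -
  have "blinfun_of ((Endo A) ^ n) = ((\<lambda>B. A o\<^sub>L B) ^^ n) id_blinfun" for n
    by (induction n) (simp_all add: blinfun_of_simps Endo_inverse)
  then have "exp_op A = (\<Sum>n. blinfun_of ((Endo A) ^ n /\<^sub>R fact n))"
    by (simp add: exp_op_def blinfun_of_simps divide_inverse)
  also have "\<dots> = blinfun_of (\<Sum>n. (Endo A) ^ n /\<^sub>R fact n)"
    by (rule bounded_linear.suminf[OF bounded_linear_blinfun_of summable_exp_generic, symmetric])
  finally show ?thesis
    by (simp add: exp_def blinfun_of_inverse)
qed

lemma Endo_scaleC_op: "Endo (scaleC_op (\<i> * of_real t) X) = t *\<^sub>R (J * Endo X)"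
  by (rule endo_eqI) (simp add: scaleC_op_apply scaleR_scaleC scaleC_scaleC mult.commute)

lemma Endo_geodesic_curve:
  "Endo (geodesic_curve P X t) = exp (t *\<^sub>R (J * Endo X)) * Endo P * exp (- (t *\<^sub>R (J * Endo X)))"
proof -
  have "Endo (scaleC_op (- \<i> * of_real t) X) = - (t *\<^sub>R (J * Endo X))"
    using Endo_scaleC_op[of "- t" X] by simp
  then show ?thesis
    by (simp only: geodesic_curve_def Endo_simps Endo_exp_op Endo_scaleC_op)
qed

definition direction :: "(L2 \<Rightarrow>\<^sub>L L2) \<Rightarrow> (L2 \<Rightarrow>\<^sub>L L2) \<Rightarrow> bool" where
  "direction P X \<longleftrightarrow> X \<in> bounded_ops \<and> selfadjoint X \<and> codiagonal P X"

lemma direction_iff: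
  assumes "P \<in> Gr"
  shows "direction P X \<longleftrightarrow> J * Endo X = Endo X * J \<and> adj (Endo X) (Endo X) \<and>
    sym_of P * Endo X = - (Endo X * sym_of P)"
  unfolding direction_def codiagonal_iff[OF assms] by (auto simp: bounded_ops_iff selfadjoint_iff)

lemma geodesic_joining_iff:
  "geodesic_joining P Q \<delta> \<longleftrightarrow> (\<exists>X. direction P X \<and> \<delta> = geodesic_curve P X) \<and> \<delta> 1 = Q"
  unfolding geodesic_joining_def direction_def by blast

context
  fixes P Q :: "L2 \<Rightarrow>\<^sub>L L2"
  assumes P: "P \<in> Gr" and Q: "Q \<in> Gr"
begin

interpretation symmetry_pair J "sym_of P" "sym_of Q"
  by (rule symmetry_pair_Gr[OF P Q])

lemma Endo_geodesic_arc:
  assumes "direction P X"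
  shows "Endo (geodesic_curve P X t) = arc (Endo X) t"
  using arc_eq[of "Endo X" t] assms
  by (simp add: Endo_geodesic_curve sym_of_half direction_iff[OF P])

lemma geodesic_curve_end_iff:
  assumes "direction P X"
  shows "geodesic_curve P X 1 = Q \<longleftrightarrow> exp (2 *\<^sub>R (J * Endo X)) = W"
proof -
  have "geodesic_curve P X 1 = Q \<longleftrightarrow> arc (Endo X) 1 = Endo Q"
    by (simp add: Endo_geodesic_arc[OF assms] flip: Endo_inject_iff)
  also have "\<dots> \<longleftrightarrow> exp (2 *\<^sub>R (J * Endo X)) * sym_of P = sym_of Q"
    unfolding arc_def sym_of_half[of Q, symmetric] by simp
  also have "\<dots> \<longleftrightarrow> exp (2 *\<^sub>R (J * Endo X)) = W"
  proof
    assume "exp (2 *\<^sub>R (J * Endo X)) * sym_of P = sym_of Q"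
    then have "exp (2 *\<^sub>R (J * Endo X)) * (sym_of P * sym_of P) = sym_of Q * sym_of P"
      by (simp flip: mult.assoc)
    then show "exp (2 *\<^sub>R (J * Endo X)) = W"
      by (simp add: R1 W_def)
  qed (simp add: W_def mult.assoc R1)
  finally show ?thesis .
qed

text \<open>Co-diagonality with respect to \<open>Q\<close> comes from the other conditions:
  \<open>X\<close> commutes with \<open>W\<close>, an exponential in \<open>X\<close>, and
  anticommutes with \<open>sym_of P\<close>, hence anticommutes with
  \<open>sym_of Q = W * sym_of P\<close>.\<close>

lemma geodesic_generator_iff: "geodesic_generator P Q X \<longleftrightarrow> generator (Endo X)"
proof -
  have end_eq: "exp_op (scaleC_op \<i> X) o\<^sub>L P o\<^sub>L exp_op (scaleC_op (- \<i>) X) = geodesic_curve P X 1"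
    by (simp add: geodesic_curve_def)
  have "codiagonal Q X" if X: "direction P X" "exp (2 *\<^sub>R (J * Endo X)) = W"
  proof -
    have "Endo X * (J * Endo X) = J * Endo X * Endo X"
      using X(1) unfolding direction_iff[OF P] by (metis mult.assoc)
    then have comm: "Endo X * W = W * Endo X"
      unfolding X(2)[symmetric] by (intro exp_intertwine) simp
    have anti: "sym_of P * Endo X = - (Endo X * sym_of P)"
      using X(1) unfolding direction_iff[OF P] by blast
    have Q_eq: "sym_of Q = W * sym_of P"
      by (simp add: W_def mult.assoc R1)
    have "sym_of Q * Endo X = W * sym_of P * Endo X"
      by (rule arg_cong[OF Q_eq, of "\<lambda>A. A * Endo X"])
    also have "\<dots> = - (Endo X * W * sym_of P)"
      by (simp only: anti mult.assoc mult_minus_right comm)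
    also have "\<dots> = - (Endo X * (W * sym_of P))"
      by (simp only: mult.assoc)
    also have "\<dots> = - (Endo X * sym_of Q)"
      by (rule arg_cong[OF Q_eq[symmetric], of "\<lambda>A. - (Endo X * A)"])
    finally show ?thesis
      by (simp add: codiagonal_iff[OF Q])
  qed
  then have "geodesic_generator P Q X \<longleftrightarrow> direction P X \<and> norm X \<le> pi / 2 \<and> exp (2 *\<^sub>R (J * Endo X)) = W"
    using geodesic_curve_end_iff[of X]
    unfolding geodesic_generator_def end_eq direction_def by blast
  then show ?thesis
    by (auto simp: generator_def direction_iff[OF P] Endo_simps)
qed

lemma geodesic_curve_deriv:
  assumes "direction P X"
  shows "(geodesic_curve P X has_vector_derivative
    blinfun_of (exp ((2 * t) *\<^sub>R (J * Endo X)) * (J * Endo X) * sym_of P)) (at t within T)"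
proof -
  have "geodesic_curve P X = (\<lambda>t. blinfun_of (arc (Endo X) t))"
    using Endo_geodesic_arc[OF assms] by (metis Endo_inverse UNIV_I)
  then show ?thesis
    using bounded_linear.has_vector_derivative[OF bounded_linear_blinfun_of arc_deriv] by simp
qed

lemma curve_length_geodesic:
  assumes X: "direction P X"
  shows "curve_length (geodesic_curve P X) = norm X"
proof -
  have "norm (vector_derivative (geodesic_curve P X) (at t within {0..1})) = norm X" if "t \<in> {0..1}" for t
  proof -
    have "vector_derivative (geodesic_curve P X) (at t within {0..1})
        = blinfun_of (exp ((2 * t) *\<^sub>R (J * Endo X)) * (J * Endo X) * sym_of P)"
      using that vector_derivative_within_cbox[OF zero_less_one, of t, unfolded box_real, OF _ geodesic_curve_deriv[OF X]]
      by blast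
    moreover have "norm (exp ((2 * t) *\<^sub>R (J * Endo X)) * (J * Endo X) * sym_of P) = norm (Endo X)"
      using X unfolding direction_iff[OF P] by (intro norm_arc_deriv) blast+
    ultimately show ?thesis
      by (simp only: blinfun_of_simps(8) Endo_simps(7))
  qed
  then have "curve_length (geodesic_curve P X) = integral {0..1} (\<lambda>t::real. norm X)"
    unfolding curve_length_def by (intro integral_cong) auto
  then show ?thesis by simp
qed

lemma geodesic_curve_0: "geodesic_curve P X 0 = P"
  by (simp add: Endo_geodesic_curve flip: Endo_inject_iff)

text \<open>Together with \<open>geodesic_curve_Gr\<close> this admits the geodesic as a competitor
  in \<open>minimal_geodesic_joining\<close>, on which uniqueness of the minimal geodesic
  relies.\<close>

lemma geodesic_curve_piecewise_C1:
  assumes X: "direction P X"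
  shows "piecewise_C1_curve (geodesic_curve P X)"
  unfolding piecewise_C1_curve_def
proof (intro exI[of _ "{0, 1}"] conjI ballI impI)
  fix a b :: real
  let ?D = "\<lambda>t. blinfun_of (exp ((2 * t) *\<^sub>R (J * Endo X)) * (J * Endo X) * sym_of P)"
  have "((\<lambda>t. exp (t *\<^sub>R (2 *\<^sub>R (J * Endo X)))) has_vector_derivative
      exp (t *\<^sub>R (2 *\<^sub>R (J * Endo X))) * (2 *\<^sub>R (J * Endo X))) (at t within {a..b})" for t
    by (rule exp_scaleR_has_vector_derivative_right)
  then have "continuous_on {a..b} (\<lambda>t. exp (t *\<^sub>R (2 *\<^sub>R (J * Endo X))))"
    by (rule continuous_on_vector_derivative)
  then have "continuous_on {a..b} (\<lambda>t. exp ((2 * t) *\<^sub>R (J * Endo X)))"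
    by (simp add: mult.commute)
  then have "continuous_on {a..b} ?D"
    by (intro bounded_linear.continuous_on[OF bounded_linear_blinfun_of] continuous_intros)
  then show "\<exists>D. continuous_on {a..b} D \<and>
      (\<forall>t\<in>{a..b}. (geodesic_curve P X has_vector_derivative D t) (at t within {a..b}))"
    using geodesic_curve_deriv[OF X] by blast
qed auto

lemma geodesic_curve_Gr:
  assumes X: "direction P X"
  shows "geodesic_curve P X t \<in> Gr"
proof -
  let ?U = "exp (t *\<^sub>R (J * Endo X))" and ?U' = "exp (- (t *\<^sub>R (J * Endo X)))"
  have PP: "J * Endo P = Endo P * J" "adj (Endo P) (Endo P)" "Endo P * Endo P = Endo P"
    using P unfolding Gr_iff by blast+
  have XX: "J * Endo X = Endo X * J" "adj (Endo X) (Endo X)"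
    using X unfolding direction_iff[OF P] by blast+
  note U = exp_\<iota>_isometry[OF XX(2,1), of t]
  have "J * (J * Endo X) = J * Endo X * J"
    by (metis XX(1) mult.assoc)
  then have JU: "J * ?U = ?U * J" "J * ?U' = ?U' * J"
    by (intro exp_intertwine; simp)+
  have "J * (?U * Endo P * ?U') = ?U * Endo P * ?U' * J"
    by (metis JU PP(1) mult.assoc)
  moreover have "adj (?U * Endo P * ?U') (?U * (Endo P * ?U'))"
    by (intro adj_mult U PP(2) adj_commute[OF U(1)])
  moreover have "?U * Endo P * ?U' * (?U * Endo P * ?U') = ?U * Endo P * ?U'"
  proof -
    have "?U * Endo P * ?U' * (?U * Endo P * ?U') = ?U * Endo P * (?U' * ?U) * Endo P * ?U'"
      by (simp only: mult.assoc)
    also have "\<dots> = ?U * (Endo P * Endo P) * ?U'"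
      by (simp only: U(2) mult_1_right mult.assoc)
    finally show ?thesis
      by (simp only: PP(3))
  qed
  ultimately show ?thesis
    unfolding Gr_iff Endo_geodesic_curve by (simp add: mult.assoc)
qed

end

section \<open>Lengths of piecewise differentiable curves\<close>

text \<open>Passes from adjacent nodes of a partition to arbitrary ones, by splitting at a node in
  between; the number of such nodes decreases.\<close>

lemma consecutive_induct:
  fixes S :: "real set"
  assumes S: "finite S" and ab: "a \<in> S" "b \<in> S" "a < b"
    and base: "\<And>x y. x \<in> S \<Longrightarrow> y \<in> S \<Longrightarrow> x < y \<Longrightarrow> {x<..<y} \<inter> S = {} \<Longrightarrow> Q x y"
    and trans: "\<And>x y z. y \<in> S \<Longrightarrow> x < y \<Longrightarrow> y < z \<Longrightarrow> Q x y \<Longrightarrow> Q y z \<Longrightarrow> Q x z"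
  shows "Q a b"
  using ab
proof (induction "card ({a<..<b} \<inter> S)" arbitrary: a b rule: less_induct)
  case less
  show ?case
  proof (cases "{a<..<b} \<inter> S = {}")
    case False
    then obtain c where c: "c \<in> S" "a < c" "c < b" by auto
    have "{a<..<c} \<inter> S \<subset> {a<..<b} \<inter> S" "{c<..<b} \<inter> S \<subset> {a<..<b} \<inter> S"
      using c by auto
    then have "Q a c" "Q c b"
      using less c S by (auto intro!: less.hyps psubset_card_mono)
    then show ?thesis
      by (rule trans[OF c])
  qed (use base less.prems in blast)
qed

text \<open>\<open>curve_length\<close> differentiates within \<open>{0..1}\<close>, the pieces
  carry derivatives within themselves. The two agree off the finitely many nodes, which do not
  affect the integral.\<close>

lemma piecewise_C1_curveE:
  fixes \<alpha> :: "real \<Rightarrow> 'a::real_normed_vector"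
  assumes "piecewise_C1_curve \<alpha>"
  obtains S where "finite S" "continuous_on {0..1} \<alpha>"
    "(\<lambda>t. norm (vector_derivative \<alpha> (at t within {0..1}))) integrable_on {0..1}"
    "\<And>t. t \<in> {0<..<1} - S \<Longrightarrow>
      (\<alpha> has_vector_derivative vector_derivative \<alpha> (at t within {0..1})) (at t)"
proof -
  obtain S where S: "finite S" "{0, 1} \<subseteq> S" "S \<subseteq> {0..1}"
    and D: "\<And>a b. a \<in> S \<Longrightarrow> b \<in> S \<Longrightarrow> a < b \<Longrightarrow> {a<..<b} \<inter> S = {} \<Longrightarrow>
      \<exists>D. continuous_on {a..b} D \<and> (\<forall>t\<in>{a..b}. (\<alpha> has_vector_derivative D t) (at t within {a..b}))"
  proof -
    from assms[unfolded piecewise_C1_curve_def] show ?thesis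
    proof (elim exE conjE)
      fix S
      assume "finite S" "{0, 1} \<subseteq> S" "S \<subseteq> {0..1}"
        "\<forall>a\<in>S. \<forall>b\<in>S. a < b \<and> {a<..<b} \<inter> S = {} \<longrightarrow>
          (\<exists>D. continuous_on {a..b} D \<and> (\<forall>t\<in>{a..b}. (\<alpha> has_vector_derivative D t) (at t within {a..b})))"
      then show thesis by (intro that[of S]) auto
    qed
  qed
  let ?d = "\<lambda>t. vector_derivative \<alpha> (at t within {0..1})"
  define Q where "Q a b \<longleftrightarrow> continuous_on {a..b} \<alpha> \<and> (\<lambda>t. norm (?d t)) integrable_on {a..b} \<and>
    (\<forall>t\<in>{a<..<b} - S. (\<alpha> has_vector_derivative ?d t) (at t))" for a b
  have "Q 0 1"
  proof (rule consecutive_induct[OF S(1)])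
    show "0 \<in> S" "1 \<in> S" using S(2) by auto
    fix x y assume xy: "x \<in> S" "y \<in> S" "x < y" "{x<..<y} \<inter> S = {}"
    then obtain D where D: "continuous_on {x..y} D"
      "\<And>t. t \<in> {x..y} \<Longrightarrow> (\<alpha> has_vector_derivative D t) (at t within {x..y})"
      using D by blast
    have D_at: "(\<alpha> has_vector_derivative D t) (at t)" if "t \<in> {x<..<y}" for t
      using D(2)[of t] that by (simp add: at_within_Icc_at)
    have d_eq: "?d t = D t" if "t \<in> {x<..<y}" for t
    proof -
      have "t \<in> {0<..<1}"
        using that xy(1,2) S(3) by force
      then show ?thesis
        using D_at[OF that] by (simp add: at_within_Icc_at vector_derivative_at)
    qed
    have "(\<lambda>t. norm (?d t)) integrable_on {x..y}"
    proof (rule integrable_spike_finite[of "{x, y}"])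
      show "(\<lambda>t. norm (D t)) integrable_on {x..y}"
        by (intro integrable_continuous_interval continuous_intros D(1))
    qed (use d_eq in auto)
    then show "Q x y"
      unfolding Q_def using continuous_on_vector_derivative[OF D(2)] D_at d_eq by auto
  next
    fix x y z :: real assume xyz: "y \<in> S" "x < y" "y < z" "Q x y" "Q y z"
    have eq: "{x..z} = {x..y} \<union> {y..z}" "{x<..<z} - S = ({x<..<y} - S) \<union> ({y<..<z} - S)"
      using xyz(1-3) by (auto, metis linorder_neqE_linordered_idom)
    have "continuous_on {x..z} \<alpha>"
      unfolding eq(1) using xyz by (intro continuous_on_closed_Un) (auto simp: Q_def)
    moreover have "(\<lambda>t. norm (?d t)) integrable_on {x..z}"
      using xyz unfolding Q_def
      by (intro Henstock_Kurzweil_Integration.integrable_combine[of x y z]) linarith+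
    ultimately show "Q x z"
      unfolding Q_def eq(2) using xyz by (auto simp: Q_def)
  qed auto
  then show ?thesis
    unfolding Q_def using S(1) by (intro that) auto
qed

text \<open>The symmetries \<open>sym_of (\<alpha> t)\<close> move twice as fast as the projections,
  which cancels the factor \<open>2\<close> in \<open>generator_norm_le\<close>.\<close>

lemma generator_norm_le_length:
  assumes P: "P \<in> Gr" and Q: "Q \<in> Gr" and X: "geodesic_generator P Q X"
    and \<alpha>: "piecewise_C1_curve \<alpha>" "\<alpha> ` {0..1} \<subseteq> Gr" "\<alpha> 0 = P" "\<alpha> 1 = Q"
  shows "norm X \<le> curve_length \<alpha>"
proof -
  interpret symmetry_pair J "sym_of P" "sym_of Q"
    by (rule symmetry_pair_Gr[OF P Q])
  have gen: "generator (Endo X)"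
    using X geodesic_generator_iff[OF P Q] by blast
  let ?d = "\<lambda>t. vector_derivative \<alpha> (at t within {0..1})"
  obtain S where S: "finite S" and cont: "continuous_on {0..1} \<alpha>"
    and int: "(\<lambda>t. norm (?d t)) integrable_on {0..1}"
    and d: "\<And>t. t \<in> {0<..<1} - S \<Longrightarrow> (\<alpha> has_vector_derivative ?d t) (at t)"
    using piecewise_C1_curveE[OF \<alpha>(1)] by metis
  have "2 * norm (Endo X) \<le> integral {0..1} (\<lambda>t. 2 * norm (?d t))"
  proof (rule generator_norm_le[where R = "\<lambda>t. sym_of (\<alpha> t)" and R' = "\<lambda>t. 2 *\<^sub>R Endo (?d t)", OF _ _ _ _ S])
    show "adj (Endo X) (Endo X)" "J * Endo X = Endo X * J" "norm (Endo X) \<le> pi / 2"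
      "exp (2 *\<^sub>R (J * Endo X)) = W"
      using gen unfolding generator_def by blast+
    show "continuous_on {0..1} (\<lambda>t. sym_of (\<alpha> t))"
      unfolding sym_of_def
      by (intro continuous_intros bounded_linear.continuous_on[OF bounded_linear_Endo] cont)
    show "((\<lambda>t. sym_of (\<alpha> t)) has_vector_derivative 2 *\<^sub>R Endo (?d t)) (at t)" if "t \<in> {0<..<1} - S" for t
    proof -
      have "((\<lambda>t. 2 *\<^sub>R Endo (\<alpha> t) - 1) has_vector_derivative 2 *\<^sub>R Endo (?d t) - 0) (at t)"
        by (intro has_vector_derivative_diff has_vector_derivative_const
            bounded_linear.has_vector_derivative[OF bounded_linear_scaleR_right]
            bounded_linear.has_vector_derivative[OF bounded_linear_Endo] d[OF that])
      then show ?thesis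
        by (simp add: sym_of_def)
    qed
    show "norm (sym_of (\<alpha> t) \<cdot> x) = norm x" if "t \<in> {0..1}" for t x
    proof -
      have "\<alpha> t \<in> Gr" using \<alpha>(2) that by blast
      then interpret \<alpha>: symmetry_pair J "sym_of (\<alpha> t)" "sym_of (\<alpha> t)"
        by (intro symmetry_pair_Gr)
      show ?thesis
        by (rule adj_isometry[OF \<alpha>.R1(2,1)])
    qed
    show "(\<lambda>t. 2 * norm (?d t)) integrable_on {0..1}"
      using integrable_cmul[OF int, of 2] by simp
  qed (simp_all add: \<alpha>(3,4) Endo_simps)
  also have "\<dots> = 2 * curve_length \<alpha>"
    unfolding curve_length_def by (rule integral_mult_right)
  finally show ?thesis
    by (simp add: Endo_simps)
qed

lemma geodesic_of_generator:
  assumes "P \<in> Gr" "Q \<in> Gr" "geodesic_generator P Q X"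
  shows "direction P X" "geodesic_curve P X 1 = Q"
  using assms(3) by (auto simp: geodesic_generator_def direction_def geodesic_curve_def)

lemma unique_minimal_geodesic:
  assumes P: "P \<in> Gr" and Q: "Q \<in> Gr"
    and PQ: "\<And>x. blinfun_apply P x = x \<Longrightarrow> blinfun_apply Q x = 0 \<Longrightarrow> x = 0"
    and QP: "\<And>x. blinfun_apply Q x = x \<Longrightarrow> blinfun_apply P x = 0 \<Longrightarrow> x = 0"
  shows "\<exists>X. geodesic_generator P Q X \<and> (\<forall>Y. geodesic_generator P Q Y \<longrightarrow> Y = X) \<and>
    minimal_geodesic_joining P Q (geodesic_curve P X) \<and>
    (\<forall>\<delta>. minimal_geodesic_joining P Q \<delta> \<longrightarrow> \<delta> = geodesic_curve P X)"
proof -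
  interpret symmetry_pair J "sym_of P" "sym_of Q"
    by (rule symmetry_pair_Gr[OF P Q])
  have idem: "blinfun_apply A (blinfun_apply A x) = blinfun_apply A x" if "A \<in> Gr" for A x
    using that by (auto simp: Gr_def simp flip: blinfun_apply_blinfun_compose)
  \<comment> \<open>\<open>W \<cdot> x = - x\<close> says that \<open>x\<close> is the sum of its
    images under \<open>P\<close> and \<open>Q\<close>. Applying \<open>Q\<close> and
    \<open>P\<close> to this sum puts the two summands into the intersections assumed
    trivial.\<close>
  have no_fixed: "x = 0" if W: "W \<cdot> x = - x" for x
  proof -
    let ?a = "blinfun_apply P x" and ?b = "blinfun_apply Q x"
    have "(sym_of Q * W) \<cdot> x = sym_of P \<cdot> x"
      unfolding W_def mult.assoc[symmetric] R2 by simp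
    then have "sym_of P \<cdot> x = - (sym_of Q \<cdot> x)"
      by (simp add: W)
    then have "2 *\<^sub>R (?a + ?b) = 2 *\<^sub>R x"
      by (simp add: sym_of_def scaleR_right_distrib algebra_simps scaleR_2)
    then have ab: "?a + ?b = x"
      by simp
    have "blinfun_apply Q ?a = 0" "blinfun_apply P ?b = 0"
      using arg_cong[OF ab, of "blinfun_apply Q"] arg_cong[OF ab, of "blinfun_apply P"]
      by (simp_all add: blinfun.add_right idem P Q)
    then have "?a = 0" "?b = 0"
      using PQ QP idem P Q by blast+
    with ab show "x = 0" by simp
  qed
  obtain X' where "generator X'"
    using generator_exists[OF no_fixed] by blast
  then have X: "geodesic_generator P Q (blinfun_of X')"
    by (simp add: geodesic_generator_iff[OF P Q] blinfun_of_inverse)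
  define X where "X = blinfun_of X'"
  note X = X[folded X_def]
  have unique: "Y = X" if "geodesic_generator P Q Y" for Y
    using generator_unique[OF no_fixed, of "Endo Y" "Endo X"] that X by (simp add: geodesic_generator_iff[OF P Q] Endo_inject_iff)
  note geo = geodesic_of_generator[OF P Q X]
  have minimal: "minimal_geodesic_joining P Q (geodesic_curve P X)"
    unfolding minimal_geodesic_joining_def geodesic_joining_iff curve_length_geodesic[OF P Q geo(1)]
    using geo generator_norm_le_length[OF P Q X] by blast
  \<comment> \<open>Comparison with the geodesic of \<open>X\<close> gives
    \<open>norm Y \<le> norm X \<le> pi / 2\<close>, so the direction \<open>Y\<close> of any
    minimal geodesic is itself a generator.\<close>
  have "\<delta> = geodesic_curve P X" if \<delta>: "minimal_geodesic_joining P Q \<delta>" for \<delta>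
  proof -
    obtain Y where Y: "direction P Y" "\<delta> = geodesic_curve P Y" "geodesic_curve P Y 1 = Q"
      using \<delta> unfolding minimal_geodesic_joining_def geodesic_joining_iff by blast
    have le: "curve_length \<delta> \<le> curve_length \<alpha>"
      if "piecewise_C1_curve \<alpha>" "\<alpha> ` {0..1} \<subseteq> Gr" "\<alpha> 0 = P" "\<alpha> 1 = Q" for \<alpha>
      using \<delta> that unfolding minimal_geodesic_joining_def by blast
    have "curve_length \<delta> \<le> curve_length (geodesic_curve P X)"
      using geodesic_curve_Gr[OF P Q geo(1)]
      by (intro le geodesic_curve_piecewise_C1[OF P Q geo(1)] geodesic_curve_0[OF P Q] geo(2)) blast
    then have "norm Y \<le> norm X"
      by (simp add: Y(2) curve_length_geodesic[OF P Q] Y(1) geo(1))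
    also have "norm X \<le> pi / 2"
      using X by (simp add: geodesic_generator_def)
    finally have "norm (Endo Y) \<le> pi / 2"
      by (simp add: Endo_simps)
    then have "generator (Endo Y)"
      using Y(1) geodesic_curve_end_iff[OF P Q Y(1)] Y(3)
      unfolding generator_def direction_iff[OF P] by blast
    then have "Y = X"
      using unique geodesic_generator_iff[OF P Q] by blast
    with Y(2) show ?thesis by simp
  qed
  with X unique minimal show ?thesis
    by blast
qed

text \<open>The two intersections are the parts of the eigenspace of \<open>W\<close> for
  \<open>-1\<close> on which \<open>sym_of P\<close> is \<open>1\<close> and \<open>-1\<close>;
  \<open>exp_swaps_eigenvectors\<close> leads from each to the other.\<close>

lemma geodesic_exchanges_defects:
  assumes P: "P \<in> Gr" and Q: "Q \<in> Gr" and \<delta>: "geodesic_joining P Q \<delta>"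
  shows "(\<exists>x\<noteq>0. blinfun_apply P x = x \<and> blinfun_apply Q x = 0) \<longleftrightarrow>
    (\<exists>x\<noteq>0. blinfun_apply Q x = x \<and> blinfun_apply P x = 0)"
proof -
  interpret symmetry_pair J "sym_of P" "sym_of Q"
    by (rule symmetry_pair_Gr[OF P Q])
  obtain X where X: "direction P X" "geodesic_curve P X 1 = Q"
    using \<delta> unfolding geodesic_joining_iff by blast
  have anti: "sym_of P * Endo X = - (Endo X * sym_of P)"
    using X(1) unfolding direction_iff[OF P] by blast
  have "exp (2 *\<^sub>R (J * Endo X)) = W"
    using X geodesic_curve_end_iff[OF P Q X(1)] by blast
  note swap = exp_swaps_eigenvectors[OF anti this]
  have one: "sym_of A \<cdot> x = 1 *\<^sub>R x \<longleftrightarrow> blinfun_apply A x = x" for A x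
    by (simp add: sym_of_def diff_eq_eq flip: scaleR_2)
  have minus_one: "sym_of A \<cdot> x = - 1 *\<^sub>R x \<longleftrightarrow> blinfun_apply A x = 0" for A x
    by (simp add: sym_of_def)
  have W1: "W \<cdot> x = - x \<longleftrightarrow> sym_of Q \<cdot> x = - 1 *\<^sub>R x" if "sym_of P \<cdot> x = 1 *\<^sub>R x" for x
    using that by (simp add: W_def)
  have W2: "W \<cdot> x = - x \<longleftrightarrow> sym_of Q \<cdot> x = 1 *\<^sub>R x" if "sym_of P \<cdot> x = - 1 *\<^sub>R x" for x
    using that by (simp add: W_def)
  show ?thesis
    unfolding one[symmetric] minus_one[symmetric]
  proof (intro iffI; elim exE conjE)
    fix x assume x: "x \<noteq> 0" "sym_of P \<cdot> x = 1 *\<^sub>R x" "sym_of Q \<cdot> x = - 1 *\<^sub>R x"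
    then have "W \<cdot> x = - x" using W1 by blast
    from swap[OF x(1) this x(2)] obtain y where "y \<noteq> 0" "W \<cdot> y = - y" "sym_of P \<cdot> y = - 1 *\<^sub>R y"
      by metis
    with W2 show "\<exists>x\<noteq>0. sym_of Q \<cdot> x = 1 *\<^sub>R x \<and> sym_of P \<cdot> x = - 1 *\<^sub>R x"
      by blast
  next
    fix x assume x: "x \<noteq> 0" "sym_of Q \<cdot> x = 1 *\<^sub>R x" "sym_of P \<cdot> x = - 1 *\<^sub>R x"
    then have "W \<cdot> x = - x" using W2 by blast
    from swap[OF x(1) this x(3)] obtain y where "y \<noteq> 0" "W \<cdot> y = - y" "sym_of P \<cdot> y = - (- 1) *\<^sub>R y"
      by metis
    then show "\<exists>x\<noteq>0. sym_of P \<cdot> x = 1 *\<^sub>R x \<and> sym_of Q \<cdot> x = - 1 *\<^sub>R x"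
      using W1 by (metis minus_minus)
  qed
qed

section \<open>From the projections back to Toeplitz kernels, and the equivalences\<close>

lemma proj_symbol:
  assumes "Linf_invertible \<phi>"
  shows "proj_symbol \<phi> \<in> Gr"
    "blinfun_apply (proj_symbol \<phi>) x = x \<longleftrightarrow> x \<in> mult_op \<phi> ` H2"
    "blinfun_apply (proj_symbol \<phi>) x = 0 \<longleftrightarrow> (\<forall>h\<in>H2. cinner x (mult_op \<phi> h) = 0)"
proof -
  note M = closed_csubspace_mult_op[OF assms closed_csubspace_H2]
  note P = proj_closed_csubspace[OF M, folded proj_symbol_def]
  show "proj_symbol \<phi> \<in> Gr" by (rule P(1))
  have idem: "blinfun_apply (proj_symbol \<phi>) (blinfun_apply (proj_symbol \<phi>) y) = blinfun_apply (proj_symbol \<phi>) y" for y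
    using P(1) by (auto simp: Gr_def simp flip: blinfun_apply_blinfun_compose)
  show fixed: "blinfun_apply (proj_symbol \<phi>) x = x \<longleftrightarrow> x \<in> mult_op \<phi> ` H2" for x
  proof
    assume "blinfun_apply (proj_symbol \<phi>) x = x"
    then show "x \<in> mult_op \<phi> ` H2"
      unfolding P(2)[symmetric] by (rule range_eqI[OF sym])
  next
    assume "x \<in> mult_op \<phi> ` H2"
    then have "x \<in> range (blinfun_apply (proj_symbol \<phi>))"
      by (simp only: P(2))
    then show "blinfun_apply (proj_symbol \<phi>) x = x"
      by (auto simp: idem)
  qed
  show "blinfun_apply (proj_symbol \<phi>) x = 0 \<longleftrightarrow> (\<forall>h\<in>H2. cinner x (mult_op \<phi> h) = 0)"
  proof
    assume "blinfun_apply (proj_symbol \<phi>) x = 0"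
    then show "\<forall>h\<in>H2. cinner x (mult_op \<phi> h) = 0"
      using P(3)[of _ x] by simp
  next
    let ?p = "blinfun_apply (proj_symbol \<phi>) x"
    assume *: "\<forall>h\<in>H2. cinner x (mult_op \<phi> h) = 0"
    have "?p \<in> mult_op \<phi> ` H2" using P(2) by blast
    then have "cinner (x - ?p) ?p = 0" "cinner x ?p = 0"
      using P(3)[of ?p x] * by auto
    then have "cinner ?p ?p = 0"
      by (simp add: cinner_diff_left)
    then show "?p = 0"
      by (simp add: cinner_self_eq_norm)
  qed
qed

lemma mult_op_eq_zero_iff:
  assumes "Linf_invertible \<phi>"
  shows "mult_op \<phi> f = 0 \<longleftrightarrow> f = 0"
proof -
  obtain \<eta> where \<eta>: "\<phi> \<in> Linf" "\<eta> \<in> Linf" "AE z in circle_measure. \<phi> z * \<eta> z = 1"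
    using assms by (auto simp: Linf_invertible_def)
  show ?thesis
    using mult_op_inverse(2)[OF \<eta>, of f] by (metis \<eta>(1,2) mult_op_zero)
qed

lemma toeplitz_kernel_proj_symbol:
  assumes \<phi>: "Linf_invertible \<phi>" and \<psi>: "Linf_invertible \<psi>"
  shows "toeplitz_kernel (\<lambda>z. \<phi> z * inverse (\<psi> z)) = {0} \<longleftrightarrow>
    \<not> (\<exists>x\<noteq>0. blinfun_apply (proj_symbol \<phi>) x = x \<and> blinfun_apply (proj_symbol \<psi>) x = 0)"
  unfolding toeplitz_kernel_trivial_iff[OF assms] proj_symbol(2)[OF \<phi>] proj_symbol(3)[OF \<psi>]
  by (auto simp: mult_op_eq_zero_iff[OF \<phi>])

theorem theorem3p4:
  fixes \<phi> \<psi> :: "complex \<Rightarrow> complex"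
  assumes "Linf_invertible \<phi>" and "Linf_invertible \<psi>"
  shows
    "let P = proj_symbol \<phi>; Q = proj_symbol \<psi>;
         i = (toeplitz_kernel (\<lambda>z. \<phi> z * inverse (\<psi> z)) = {0} \<and>
              toeplitz_kernel (\<lambda>z. inverse (\<phi> z) * \<psi> z) = {0});
         ii = (\<exists>\<delta>. geodesic_joining P Q \<delta>);
         iii = ((\<exists>!X. geodesic_generator P Q X) \<and>
                (\<exists>!\<delta>. minimal_geodesic_joining P Q \<delta>) \<and>
                (\<forall>X \<delta>. geodesic_generator P Q X \<and> minimal_geodesic_joining P Q \<delta> \<longrightarrow>
                        \<delta> = geodesic_curve P X))
     in (i \<longleftrightarrow> ii) \<and> (ii \<longleftrightarrow> iii)"
proof -
  define P Q where "P = proj_symbol \<phi>" and "Q = proj_symbol \<psi>"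
  define PQ where "PQ \<longleftrightarrow> (\<exists>x\<noteq>0. blinfun_apply P x = x \<and> blinfun_apply Q x = 0)"
  define QP where "QP \<longleftrightarrow> (\<exists>x\<noteq>0. blinfun_apply Q x = x \<and> blinfun_apply P x = 0)"
  define i where "i \<longleftrightarrow> toeplitz_kernel (\<lambda>z. \<phi> z * inverse (\<psi> z)) = {0} \<and>
    toeplitz_kernel (\<lambda>z. inverse (\<phi> z) * \<psi> z) = {0}"
  define ii where "ii \<longleftrightarrow> (\<exists>\<delta>. geodesic_joining P Q \<delta>)"
  define iii where "iii \<longleftrightarrow> (\<exists>!X. geodesic_generator P Q X) \<and>
    (\<exists>!\<delta>. minimal_geodesic_joining P Q \<delta>) \<and>
    (\<forall>X \<delta>. geodesic_generator P Q X \<and> minimal_geodesic_joining P Q \<delta> \<longrightarrow> \<delta> = geodesic_curve P X)"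
  have Gr: "P \<in> Gr" "Q \<in> Gr"
    unfolding P_def Q_def by (intro proj_symbol(1) assms)+
  have i_iff: "i \<longleftrightarrow> \<not> PQ \<and> \<not> QP"
    using toeplitz_kernel_proj_symbol[OF assms] toeplitz_kernel_proj_symbol[OF assms(2,1)]
    by (simp add: i_def PQ_def QP_def P_def Q_def mult.commute)
  have coburn: "\<not> (PQ \<and> QP)"
  proof
    assume "PQ \<and> QP"
    then obtain x y where x: "x \<noteq> 0" "blinfun_apply P x = x" "blinfun_apply Q x = 0"
      and y: "y \<noteq> 0" "blinfun_apply Q y = y" "blinfun_apply P y = 0"
      unfolding PQ_def QP_def by blast
    obtain f g where f: "f \<in> H2" "x = mult_op \<phi> f" and g: "g \<in> H2" "y = mult_op \<psi> g"
      using x(2) y(2) unfolding P_def Q_def proj_symbol(2)[OF assms(1)] proj_symbol(2)[OF assms(2)] by blast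
    have "f = 0 \<or> g = 0"
      using x(3) y(3) unfolding P_def Q_def proj_symbol(3)[OF assms(1)] proj_symbol(3)[OF assms(2)] f(2) g(2)
      by (intro coburn_alternative[OF assms f(1) g(1)])
    with x(1) y(1) f(2) g(2) show False
      using mult_op_eq_zero_iff assms by blast
  qed
  have "i \<Longrightarrow> iii"
  proof -
    assume i
    then have "x = 0" if "blinfun_apply P x = x" "blinfun_apply Q x = 0" for x
      using that unfolding i_iff PQ_def by blast
    moreover have "x = 0" if "blinfun_apply Q x = x" "blinfun_apply P x = 0" for x
      using \<open>i\<close> that unfolding i_iff QP_def by blast
    ultimately have "\<exists>X. geodesic_generator P Q X \<and> (\<forall>Y. geodesic_generator P Q Y \<longrightarrow> Y = X) \<and>
        minimal_geodesic_joining P Q (geodesic_curve P X) \<and>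
        (\<forall>\<delta>. minimal_geodesic_joining P Q \<delta> \<longrightarrow> \<delta> = geodesic_curve P X)"
      by (rule unique_minimal_geodesic[OF Gr])
    then show iii
    proof (elim exE conjE)
      fix X
      assume X: "geodesic_generator P Q X" "\<forall>Y. geodesic_generator P Q Y \<longrightarrow> Y = X"
        and \<delta>: "minimal_geodesic_joining P Q (geodesic_curve P X)"
        "\<forall>\<delta>. minimal_geodesic_joining P Q \<delta> \<longrightarrow> \<delta> = geodesic_curve P X"
      show iii
        unfolding iii_def
      proof (intro conjI allI impI; (elim conjE)?)
        show "\<exists>!X. geodesic_generator P Q X"
          by (rule ex1I[of _ X]) (rule X(1), rule X(2)[rule_format])
        show "\<exists>!\<delta>. minimal_geodesic_joining P Q \<delta>"
          by (rule ex1I[of _ "geodesic_curve P X"]) (rule \<delta>(1), rule \<delta>(2)[rule_format])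
        fix Y \<delta>' assume Y: "geodesic_generator P Q Y" and \<delta>': "minimal_geodesic_joining P Q \<delta>'"
        have "Y = X" "\<delta>' = geodesic_curve P X"
          by (rule X(2)[rule_format, OF Y], rule \<delta>(2)[rule_format, OF \<delta>'])
        then show "\<delta>' = geodesic_curve P Y"
          by (simp only:)
      qed
    qed
  qed
  moreover have "iii \<Longrightarrow> ii"
  proof -
    assume iii
    then obtain \<delta> where "minimal_geodesic_joining P Q \<delta>"
      unfolding iii_def by (elim conjE ex1E) (rule that)
    then have "geodesic_joining P Q \<delta>"
      unfolding minimal_geodesic_joining_def by (rule conjunct1)
    then show ii
      unfolding ii_def by (rule exI[of _ \<delta>])
  qed
  moreover have "ii \<Longrightarrow> i"
  proof -
    assume ii
    then obtain \<delta> where "geodesic_joining P Q \<delta>"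
      unfolding ii_def by (elim exE) (rule that)
    \<comment> \<open>A geodesic makes \<open>PQ\<close> and \<open>QP\<close> equivalent, while
      \<open>coburn\<close> excludes that both hold; so neither does.\<close>
    from geodesic_exchanges_defects[OF Gr this] have "PQ \<longleftrightarrow> QP"
      by (simp only: PQ_def QP_def)
    with coburn show i
      unfolding i_iff by blast
  qed
  ultimately have "(i \<longleftrightarrow> ii) \<and> (ii \<longleftrightarrow> iii)"
    by blast
  then show ?thesis
    unfolding Let_def i_def ii_def iii_def P_def Q_def .
qed

end
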